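(* Let $f\in\widehat{\mathcal B}$. Then all but finitely many fixed rays of $f$ land alone at repelling fixed points. Consequently, if all fixed rays of $f$ land, there are only finitely many fixed ray pairs and finitely many basic regions.
   Context: For an entire map $f$, $S(f)$ is the closure in $\mathbb C$ of the set of critical and (finite) asymptotic values of $f$. $\mathcal B$ is the class of transcendental entire functions with $S(f)$ bounded. $f$ has finite order if $\log\log|f(z)|=O(\log|z|)$ as $|z|\to\infty$. $\widehat{\mathcal B}=\{g_1\circ\dots\circ g_k : k\ge 1,\ g_i\in\mathcal B,\ g_i \text{ of finite order}\}$. The escaping set is $I(f)=\{z: f^n(z)\to\infty\}$. A (dynamic) ray is an injective curve $g:(0,\infty)\to I(f)$ such that (a) $\lim_{t\to\infty}|f^n(g(t))|=\infty$ for all $n\ge 0$; (b) $\lim_{n\to\infty}|f^n(g(t))|=\infty$ uniformly on $[t_0,\infty)$ for every $t_0>0$; (c) $f^n(g(t))$ is not a critical point of $f$ for any $t>0$, $n\ge 0$; and such that $g(0,\infty)$ is maximal with respect to these properties. (Rays are identified with their images.) If $g(0,\infty)$ is not maximal with respect to (a),(b) alone, the ray is called broken. A ray lands at $z_0\in\mathbb C$ if it is not broken and $g(t)\to z_0$ as $t\to0$. A ray is fixed if $f(g)\subset g$. A fixed ray lands alone if it lands and its landing point is not the landing point of any other fixed ray. A fixed ray pair is the curve consisting of two distinct fixed rays landing at a common point, together with this landing point. Let $\Gamma$ be the union of all fixed rays together with their landing points; the connected components of $\mathbb C\setminus\Gamma$ are the basic regions for $f$. *)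

theory Defs
  imports
    "HOL-Complex_Analysis.Complex_Analysis"
    "HOL-Library.Landau_Symbols"
begin

definition transcendental_entire :: "(complex \<Rightarrow> complex) \<Rightarrow> bool" where
  "transcendental_entire f \<longleftrightarrow> f holomorphic_on UNIV \<and> \<not> (\<exists>p. f = poly p)"

definition critical_point :: "(complex \<Rightarrow> complex) \<Rightarrow> complex \<Rightarrow> bool" where
  "critical_point f z \<longleftrightarrow> deriv f z = 0"

definition critical_values :: "(complex \<Rightarrow> complex) \<Rightarrow> complex set" where
  "critical_values f = f ` {z. critical_point f z}"

definition asymptotic_values :: "(complex \<Rightarrow> complex) \<Rightarrow> complex set" where
  "asymptotic_values f =
     {a. \<exists>\<gamma> :: real \<Rightarrow> complex. continuous_on {0..} \<gamma> \<and>
           filterlim \<gamma> at_infinity at_top \<and> ((\<lambda>t. f (\<gamma> t)) \<longlongrightarrow> a) at_top}"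

definition singular_set :: "(complex \<Rightarrow> complex) \<Rightarrow> complex set" where
  "singular_set f = closure (critical_values f \<union> asymptotic_values f)"

definition class_B :: "(complex \<Rightarrow> complex) set" where
  "class_B = {f. transcendental_entire f \<and> bounded (singular_set f)}"

text \<open>
  Finite order is the growth bound log log |f(z)| = O(log |z|). It is an upper bound on the
  growth of |f|, so |f(z)| is cut off below at e, where the double logarithm would be negative
  or undefined.
\<close>

definition finite_order :: "(complex \<Rightarrow> complex) \<Rightarrow> bool" where
  "finite_order f \<longleftrightarrow>
     (\<lambda>z. ln (ln (max (exp 1) (norm (f z))))) \<in> O[at_infinity](\<lambda>z. ln (norm z))"

definition class_B_hat :: "(complex \<Rightarrow> complex) set" where
  "class_B_hat =
     {f. \<exists>gs. gs \<noteq> [] \<and> (\<forall>g \<in> set gs. g \<in> class_B \<and> finite_order g) \<and> f = foldr (\<circ>) gs id}"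

definition escaping_set :: "(complex \<Rightarrow> complex) \<Rightarrow> complex set" where
  "escaping_set f = {z. filterlim (\<lambda>n. (f ^^ n) z) at_infinity sequentially}"

text \<open>
  Injective curves \<open>g : (0, \<infinity>) \<rightarrow> I(f)\<close> whose iterated images tend to infinity as
  \<open>t \<rightarrow> \<infinity>\<close>, and which escape uniformly on every \<open>[t\<^sub>0, \<infinity>)\<close>. The values of
  \<open>g\<close> outside of \<open>(0, \<infinity>)\<close> are irrelevant.
\<close>

definition escaping_curve :: "(complex \<Rightarrow> complex) \<Rightarrow> (real \<Rightarrow> complex) \<Rightarrow> bool" where
  "escaping_curve f g \<longleftrightarrow>
     continuous_on {0<..} g \<and> inj_on g {0<..} \<and> g ` {0<..} \<subseteq> escaping_set f \<and>
     (\<forall>n. filterlim (\<lambda>t. norm ((f ^^ n) (g t))) at_top at_top) \<and>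
     (\<forall>t0>0. \<forall>M. \<forall>\<^sub>F n in sequentially. \<forall>t\<ge>t0. M \<le> norm ((f ^^ n) (g t)))"

definition noncritical_curve :: "(complex \<Rightarrow> complex) \<Rightarrow> (real \<Rightarrow> complex) \<Rightarrow> bool" where
  "noncritical_curve f g \<longleftrightarrow> (\<forall>t>0. \<forall>n. \<not> critical_point f ((f ^^ n) (g t)))"

text \<open>
  Rays are identified with their images, so the following notions concern sets of points.
  Maximality is with respect to inclusion of images.
\<close>

definition ray_param :: "(complex \<Rightarrow> complex) \<Rightarrow> (real \<Rightarrow> complex) \<Rightarrow> bool" where
  "ray_param f g \<longleftrightarrow>
     escaping_curve f g \<and> noncritical_curve f g \<and>
     \<not> (\<exists>h. escaping_curve f h \<and> noncritical_curve f h \<and> g ` {0<..} \<subset> h ` {0<..})"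

definition ray :: "(complex \<Rightarrow> complex) \<Rightarrow> complex set \<Rightarrow> bool" where
  "ray f R \<longleftrightarrow> (\<exists>g. ray_param f g \<and> R = g ` {0<..})"

definition broken :: "(complex \<Rightarrow> complex) \<Rightarrow> complex set \<Rightarrow> bool" where
  "broken f R \<longleftrightarrow> (\<exists>h. escaping_curve f h \<and> R \<subset> h ` {0<..})"

definition lands_at :: "(complex \<Rightarrow> complex) \<Rightarrow> complex set \<Rightarrow> complex \<Rightarrow> bool" where
  "lands_at f R z \<longleftrightarrow>
     \<not> broken f R \<and> (\<exists>g. ray_param f g \<and> R = g ` {0<..} \<and> (g \<longlongrightarrow> z) (at_right 0))"

definition fixed_ray :: "(complex \<Rightarrow> complex) \<Rightarrow> complex set \<Rightarrow> bool" where
  "fixed_ray f R \<longleftrightarrow> ray f R \<and> f ` R \<subseteq> R"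

definition lands_alone_at :: "(complex \<Rightarrow> complex) \<Rightarrow> complex set \<Rightarrow> complex \<Rightarrow> bool" where
  "lands_alone_at f R z \<longleftrightarrow>
     lands_at f R z \<and> (\<forall>R'. fixed_ray f R' \<and> R' \<noteq> R \<longrightarrow> \<not> lands_at f R' z)"

definition repelling_fixed_point :: "(complex \<Rightarrow> complex) \<Rightarrow> complex \<Rightarrow> bool" where
  "repelling_fixed_point f z \<longleftrightarrow> f z = z \<and> norm (deriv f z) > 1"

definition fixed_ray_pairs :: "(complex \<Rightarrow> complex) \<Rightarrow> complex set set" where
  "fixed_ray_pairs f =
     {R1 \<union> {z} \<union> R2 | R1 R2 z. fixed_ray f R1 \<and> fixed_ray f R2 \<and> R1 \<noteq> R2 \<and>
        lands_at f R1 z \<and> lands_at f R2 z}"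

definition fixed_ray_graph :: "(complex \<Rightarrow> complex) \<Rightarrow> complex set" where
  "fixed_ray_graph f = (\<Union>R \<in> {R. fixed_ray f R}. R \<union> {z. lands_at f R z})"

definition basic_regions :: "(complex \<Rightarrow> complex) \<Rightarrow> complex set set" where
  "basic_regions f = components (- fixed_ray_graph f)"

end

theory Submission
  imports Defs
begin

text \<open>
  In logarithmic coordinates the inverse branches of \<open>f\<close> over a punctured neighbourhood of infinity are
  holomorphic maps \<open>\<phi>\<close> of a right half plane with \<open>f (exp (\<phi> \<omega>)) = exp \<omega>\<close>; they contract
  uniformly, since by Bloch's theorem their images contain no large disc. Along a fixed ray all branches
  coincide, so the ray is \<open>G = \<phi> \<circ> G \<circ> \<sigma>\<close> for its lift \<open>G\<close>. Finite order of the innermost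
  function puts tracts into sectors; hence two points of equal real part in one tract are at bounded
  hyperbolic distance in the half plane, and pulling back shows that two curves following the same branch
  meet, and that fixed rays which meet are equal. Thus a fixed ray is determined by its branch. Rays staying
  far away from the origin are invariant under a contraction, so they land at its repelling fixed point, and
  different such rays have different landing points. By compactness of the family of branches only finitely
  many fixed rays meet a given disc. Finally, two points separated by the graph of fixed rays are separated by
  one of its components, hence, by Janiszewski's theorem, by one of the finitely many ray pairs, and each of
  these has finitely many complementary components by the Jordan curve theorem.
\<close>

section \<open>Inverse branches away from the singular set\<close>

text \<open>A ray as defined here carries no potential, may pass near the singular set, and is
  maximal only as a set. The order along it, the action of f on it and its landing must therefore be
  extracted from uniform escape. Logarithms and inverse branches exist only for late iterates of a
  tail; noncriticality carries conclusions about \<open>f ^^ N\<close> on the tail back to the ray.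
  The constant 48: a disc of radius 4 > \<pi> contains two points that differ by 2 \<pi> i, and
  Bloch's theorem costs a factor 12. A composition usually has infinite order, which is why the
  sector estimate is proved for the factor applied first and only then transferred to f. Landing is
  proved for rays far from the origin only. Such a ray can fail to land alone only because of one of
  the finitely many rays that come near the origin, and this costs only finitely many far
  rays.\<close>

lemma norm_of_real_mult: "norm (complex_of_real x * y) = \<bar>x\<bar> * norm y"
  by (simp add: norm_mult)

lemma locally_injective_at:
  assumes "F holomorphic_on UNIV" "deriv F z \<noteq> 0"
  obtains r where "0 < r" "inj_on F (ball z r)"
  using has_complex_derivative_locally_injective[OF assms(1) UNIV_I open_UNIV assms(2)] by metis

lemma critical_value_singular: "deriv h z = 0 \<Longrightarrow> h z \<in> singular_set h"
  unfolding singular_set_def critical_values_def critical_point_def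
  by (intro subsetD[OF closure_subset]) auto

text \<open>Local injectivity of F at the values of p makes the set of agreement open, continuity
  makes it closed. It serves for \<open>exp\<close>, for f \<circ> exp and for iterates
  \<open>f ^^ N\<close> along noncritical curves, whether or not these maps are coverings.\<close>

lemma lift_unique:
  fixes p q :: "'a::topological_space \<Rightarrow> complex"
  assumes F: "F holomorphic_on UNIV" and S: "connected S"
    and p: "continuous_on S p" and q: "continuous_on S q"
    and eq: "\<And>x. x \<in> S \<Longrightarrow> F (p x) = F (q x)"
    and nz: "\<And>x. x \<in> S \<Longrightarrow> deriv F (p x) \<noteq> 0"
    and x0: "x0 \<in> S" "p x0 = q x0" and x: "x \<in> S"
  shows "p x = q x"
proof -
  define E where "E = S \<inter> (\<lambda>x. p x - q x) -` {0}"
  have "closedin (top_of_set S) E"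
    unfolding E_def by (intro continuous_closedin_preimage continuous_intros p q closed_singleton)
  moreover have "openin (top_of_set S) E"
  proof (subst openin_subopen, intro ballI)
    fix y assume y: "y \<in> E"
    then have yS: "y \<in> S" "p y = q y" by (auto simp: E_def)
    obtain r where r: "0 < r" "inj_on F (ball (p y) r)"
      using locally_injective_at[OF F nz[OF yS(1)]] by blast
    define T where "T = (S \<inter> p -` ball (p y) r) \<inter> (S \<inter> q -` ball (p y) r)"
    have "openin (top_of_set S) T"
      unfolding T_def by (intro openin_Int continuous_openin_preimage_gen p q open_ball)
    moreover have "y \<in> T" using r yS by (auto simp: T_def)
    moreover have "T \<subseteq> E"
    proof
      fix u assume "u \<in> T"
      then have u: "u \<in> S" "p u \<in> ball (p y) r" "q u \<in> ball (p y) r" by (auto simp: T_def)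
      have "p u = q u" using inj_onD[OF r(2) eq[OF u(1)] u(2,3)] .
      then show "u \<in> E" using u by (simp add: E_def)
    qed
    ultimately show "\<exists>T. openin (top_of_set S) T \<and> y \<in> T \<and> T \<subseteq> E" by blast
  qed
  moreover have "x0 \<in> E" using x0 by (simp add: E_def)
  ultimately have "E = S" using S unfolding connected_clopen by blast
  then show ?thesis using x by (auto simp: E_def)
qed

text \<open>Otherwise there are pairs of distinct points with equal images ever closer to K. Limits
  of both members lie in K and have the same image, so they coincide, and there F is locally
  injective. Used to push a section over a closed ball beyond its boundary.\<close>

lemma injective_nhd_compact:
  assumes F: "F holomorphic_on UNIV" and K: "compact K" and inj: "inj_on F K"
    and nz: "\<And>z. z \<in> K \<Longrightarrow> deriv F z \<noteq> 0"
  obtains V where "open V" "K \<subseteq> V" "inj_on F V"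
proof (rule ccontr)
  assume H: "\<not> thesis"
  define V where "V n = (\<Union>k\<in>K. ball k (1 / real (Suc n)))" for n
  have "\<not> inj_on F (V n)" for n
  proof
    assume "inj_on F (V n)"
    moreover have "open (V n)" "K \<subseteq> V n" by (auto simp: V_def)
    ultimately show False using that H by blast
  qed
  then have "\<exists>x\<in>V n. \<exists>y\<in>V n. F x = F y \<and> x \<noteq> y" for n
    unfolding inj_on_def by blast
  then obtain x y where xy0: "\<And>n. x n \<in> V n" "\<And>n. y n \<in> V n" "\<And>n. F (x n) = F (y n)" "\<And>n. x n \<noteq> y n"
    by metis
  have "\<exists>k\<in>K. dist k z < 1 / real (Suc n)" if "z \<in> V n" for z n
    using that unfolding V_def UN_iff mem_ball .
  note near = this
  have "\<forall>n. \<exists>k. k \<in> K \<and> dist k (x n) < 1 / real (Suc n)" "\<forall>n. \<exists>l. l \<in> K \<and> dist l (y n) < 1 / real (Suc n)"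
    using near[OF xy0(1)] near[OF xy0(2)] by blast+
  from choice[OF this(1)] choice[OF this(2)] obtain k l where
    kl0: "\<And>n. k n \<in> K" "\<And>n. dist (k n) (x n) < 1 / real (Suc n)"
    "\<And>n. l n \<in> K" "\<And>n. dist (l n) (y n) < 1 / real (Suc n)"
    by blast
  note xy = xy0(4,3) kl0(1,3,2,4)
  obtain k0 r where k0: "k0 \<in> K" "strict_mono r" "(k \<circ> r) \<longlonglongrightarrow> k0"
    using seq_compactE[OF compact_imp_seq_compact[OF K], of k] xy(3) by blast
  obtain l0 s where l0: "l0 \<in> K" "strict_mono s" "((l \<circ> r) \<circ> s) \<longlonglongrightarrow> l0"
    using seq_compactE[OF compact_imp_seq_compact[OF K], of "l \<circ> r"] xy(4) by auto
  define t where "t = r \<circ> s"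
  have t: "strict_mono t" using k0(2) l0(2) by (simp add: t_def strict_mono_o)
  have kt: "(k \<circ> t) \<longlonglongrightarrow> k0" "(l \<circ> t) \<longlonglongrightarrow> l0"
    using LIMSEQ_subseq_LIMSEQ[OF k0(3) l0(2)] l0(3) by (simp_all add: t_def o_assoc)
  have inv0: "(\<lambda>n. 1 / real (Suc (t n))) \<longlonglongrightarrow> 0"
    using LIMSEQ_subseq_LIMSEQ[OF LIMSEQ_inverse_real_of_nat t] by (simp add: o_def inverse_eq_divide)
  have close: "(\<lambda>n. b (t n)) \<longlonglongrightarrow> c"
    if "\<And>n. dist (a n) (b n) < 1 / real (Suc n)" "(a \<circ> t) \<longlonglongrightarrow> c" for a b :: "nat \<Rightarrow> complex" and c
  proof -
    have "(\<lambda>n. dist (a (t n)) (b (t n))) \<longlonglongrightarrow> 0"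
      by (rule tendsto_sandwich[OF _ _ tendsto_const inv0]) (auto intro!: always_eventually less_imp_le that(1) simp del: of_nat_Suc)
    then have "(\<lambda>n. a (t n) - b (t n)) \<longlonglongrightarrow> 0"
      by (simp add: dist_norm tendsto_norm_zero_iff)
    then have "(\<lambda>n. a (t n) - (a (t n) - b (t n))) \<longlonglongrightarrow> c - 0"
      using that(2) by (intro tendsto_diff) (auto simp: o_def)
    then show ?thesis by simp
  qed
  have xl: "(\<lambda>n. x (t n)) \<longlonglongrightarrow> k0" using close xy(5) kt(1) by blast
  have yl: "(\<lambda>n. y (t n)) \<longlonglongrightarrow> l0" using close xy(6) kt(2) by blast
  have cF: "isCont F z" for z
    using F by (simp add: holomorphic_on_imp_continuous_on continuous_on_eq_continuous_at
        holomorphic_on_imp_differentiable_at field_differentiable_imp_continuous_at)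
  have "(\<lambda>n. F (x (t n))) \<longlonglongrightarrow> F k0" "(\<lambda>n. F (x (t n))) \<longlonglongrightarrow> F l0"
    using isCont_tendsto_compose[OF cF xl] isCont_tendsto_compose[OF cF yl] xy(2) by simp_all
  then have "F k0 = F l0" by (rule LIMSEQ_unique)
  then have kl: "k0 = l0" using inj k0(1) l0(1) by (auto dest: inj_onD)
  obtain e where e: "0 < e" "inj_on F (ball k0 e)"
    using locally_injective_at[OF F nz[OF k0(1)]] by blast
  have "\<forall>\<^sub>F n in sequentially. x (t n) \<in> ball k0 e" "\<forall>\<^sub>F n in sequentially. y (t n) \<in> ball k0 e"
    using xl yl kl e(1) by (auto simp: tendsto_iff dist_commute)
  then have "\<forall>\<^sub>F n in sequentially. False"
  proof eventually_elim
    case (elim n)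
    then show ?case using inj_onD[OF e(2) xy(2)] xy(1) by blast
  qed
  then show False by simp
qed

lemma entire_local_inverse:
  assumes h: "h holomorphic_on UNIV" and "deriv h q \<noteq> 0"
  obtains e \<kappa> V where "0 < e" "\<kappa> holomorphic_on ball (h q) e" "open V" "q \<in> V"
    "\<And>w. w \<in> ball (h q) e \<Longrightarrow> h (\<kappa> w) = w" "\<And>z. z \<in> V \<Longrightarrow> \<kappa> (h z) = z"
proof -
  obtain r where r: "0 < r" "inj_on h (ball q r)"
    using locally_injective_at[OF assms] by blast
  have hr: "h holomorphic_on ball q r" using h holomorphic_on_subset by blast
  obtain g where g: "g holomorphic_on h ` ball q r" "\<And>z. z \<in> ball q r \<Longrightarrow> g (h z) = z"
    using holomorphic_has_inverse[OF hr open_ball r(2)] by metis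
  have "open (h ` ball q r)" by (rule open_mapping_thm3[OF hr open_ball r(2)])
  moreover have "h q \<in> h ` ball q r" using r by auto
  ultimately obtain e where e: "0 < e" "ball (h q) e \<subseteq> h ` ball q r"
    using open_contains_ball by blast
  show thesis
  proof (rule that[of e g "ball q r"])
    show "g holomorphic_on ball (h q) e" using g(1) e(2) holomorphic_on_subset by blast
    show "h (g w) = w" if "w \<in> ball (h q) e" for w using e(2) that g(2) by force
  qed (use e r g in auto)
qed

text \<open>Supplies the finite cluster point from which the lift of a radius can be continued when
  its endpoint is not an asymptotic value.\<close>

lemma bounded_along_subsequence:
  assumes "\<not> filterlim \<gamma> at_infinity (at_top :: real filter)"
  obtains q :: complex and t :: "nat \<Rightarrow> real"
  where "filterlim t at_top sequentially" "(\<lambda>n. \<gamma> (t n)) \<longlonglongrightarrow> q"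
proof -
  obtain B where B: "\<not> (\<forall>\<^sub>F t in at_top. B \<le> norm (\<gamma> t))"
    using assms unfolding filterlim_at_infinity[OF order_refl] by blast
  then have "\<forall>n::nat. \<exists>t. real n \<le> t \<and> norm (\<gamma> t) \<le> B"
    unfolding eventually_at_top_linorder by (metis linear)
  then obtain t where t: "\<And>n. real n \<le> t n" "\<And>n. norm (\<gamma> (t n)) \<le> B" by metis
  have "compact (cball 0 B :: complex set)" by simp
  moreover have "\<forall>n. \<gamma> (t n) \<in> cball 0 B" using t(2) by simp
  ultimately obtain q r where q: "strict_mono (r::nat\<Rightarrow>nat)" "((\<lambda>n. \<gamma> (t n)) \<circ> r) \<longlonglongrightarrow> q"
    using seq_compactE[OF compact_imp_seq_compact, of "cball 0 B" "\<lambda>n. \<gamma> (t n)"] by blast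
  have "filterlim t at_top sequentially"
    using filterlim_at_top_mono[OF filterlim_real_sequentially] t(1) by (simp add: always_eventually)
  then have "filterlim (\<lambda>n. t (r n)) at_top sequentially"
    using filterlim_compose[OF _ filterlim_subseq[OF q(1)]] by blast
  then show thesis using that[of "\<lambda>n. t (r n)" q] q(2) by (simp add: o_def)
qed

text \<open>Continuation along radii: let s be the supremum of the radii that carry a branch with
  value z0 at w1. If s < \<rho>, a lifted radius ending at a boundary point b does not run to
  infinity, as b is not an asymptotic value. It clusters at a preimage of b, which is not critical,
  and the local inverse there continues the branch. The continuations glue to the closed ball and,
  by injectivity, extend to a larger ball.\<close>

lemma inverse_branch_on_ball:
  assumes h: "h holomorphic_on UNIV" and w1: "h z0 = w1" and \<rho>: "0 < \<rho>"
    and sing: "ball w1 \<rho> \<inter> singular_set h = {}"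
  obtains \<eta> where "\<eta> holomorphic_on ball w1 \<rho>" "\<eta> w1 = z0" "\<And>w. w \<in> ball w1 \<rho> \<Longrightarrow> h (\<eta> w) = w"
proof -
  have nz: "deriv h z \<noteq> 0" if "h z \<in> ball w1 \<rho>" for z
  proof
    assume "deriv h z = 0"
    then have "h z \<in> singular_set h" by (rule critical_value_singular)
    then show False using sing that by blast
  qed
  have conth: "continuous_on A h" for A
    using h holomorphic_on_imp_continuous_on continuous_on_subset by blast
  define P where "P r \<eta> \<longleftrightarrow> \<eta> holomorphic_on ball w1 r \<and> \<eta> w1 = z0 \<and> (\<forall>w\<in>ball w1 r. h (\<eta> w) = w)" for r \<eta>
  define A where "A = {r. 0 < r \<and> r \<le> \<rho> \<and> (\<exists>\<eta>. P r \<eta>)}"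
  have "h z0 \<in> ball w1 \<rho>" using w1 \<rho> by simp
  from nz[OF this] obtain e \<kappa> V where e: "0 < e" "\<kappa> holomorphic_on ball w1 e" "z0 \<in> V"
    "\<And>w. w \<in> ball w1 e \<Longrightarrow> h (\<kappa> w) = w" "\<And>z. z \<in> V \<Longrightarrow> \<kappa> (h z) = z"
    using entire_local_inverse[OF h, of z0] w1 by metis
  have "min e \<rho> \<in> A"
    unfolding A_def P_def using e \<rho> w1 by (auto intro!: exI[of _ \<kappa>] elim: holomorphic_on_subset)
  then have Ane: "A \<noteq> {}" by blast
  have Abd: "bdd_above A" unfolding A_def by (auto intro!: bdd_aboveI[of _ \<rho>])
  define s where "s = Sup A"
  have s0: "0 < s" using \<open>min e \<rho> \<in> A\<close> cSup_upper[OF _ Abd] e(1) \<rho> unfolding s_def by fastforce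
  have s\<rho>: "s \<le> \<rho>" unfolding s_def by (rule cSup_least[OF Ane]) (auto simp: A_def)
  have uniq: "\<eta> w = \<eta>' w" if "P r \<eta>" "P r' \<eta>'" "r \<le> \<rho>" "w \<in> ball w1 r" "w \<in> ball w1 r'" for r r' \<eta> \<eta>' w
  proof -
    have w: "w \<in> ball w1 (min r r')" using that by simp
    show ?thesis
    proof (rule lift_unique[OF h, of "ball w1 (min r r')" \<eta> \<eta>' w1])
      show "connected (ball w1 (min r r'))" by simp
      show "continuous_on (ball w1 (min r r')) \<eta>" "continuous_on (ball w1 (min r r')) \<eta>'"
        using that(1,2) unfolding P_def
        by (auto intro!: holomorphic_on_imp_continuous_on elim!: holomorphic_on_subset)
      show "w1 \<in> ball w1 (min r r')" using w by (smt (verit) mem_ball zero_le_dist dist_self)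
      show "\<eta> w1 = \<eta>' w1" using that(1,2) unfolding P_def by auto
      show "h (\<eta> x) = h (\<eta>' x)" if "x \<in> ball w1 (min r r')" for x
        using \<open>P r \<eta>\<close> \<open>P r' \<eta>'\<close> that unfolding P_def by auto
      show "deriv h (\<eta> x) \<noteq> 0" if "x \<in> ball w1 (min r r')" for x
        using \<open>P r \<eta>\<close> that \<open>r \<le> \<rho>\<close> unfolding P_def by (intro nz) auto
    qed (use w in auto)
  qed
  have "\<forall>r\<in>A. \<exists>\<eta>. P r \<eta>" unfolding A_def by blast
  from bchoice[OF this] obtain E where E: "\<And>r. r \<in> A \<Longrightarrow> P r (E r)" by blast
  define \<eta> where "\<eta> w = E (SOME r. r \<in> A \<and> dist w1 w < r) w" for w
  have \<eta>E: "\<eta> w = E r w" if "r \<in> A" "w \<in> ball w1 r" for r w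
  proof -
    have ex: "\<exists>r. r \<in> A \<and> dist w1 w < r" using that by auto
    define r' where "r' = (SOME r. r \<in> A \<and> dist w1 w < r)"
    have r': "r' \<in> A" "dist w1 w < r'" using someI_ex[OF ex] unfolding r'_def by auto
    have "E r' w = E r w"
      by (rule uniq[OF E E]) (use r' that in \<open>auto simp: A_def\<close>)
    then show ?thesis by (simp add: \<eta>_def r'_def)
  qed
  have exr: "\<exists>r\<in>A. w \<in> ball w1 r" if "w \<in> ball w1 s" for w
    using that less_cSup_iff[OF Ane Abd] unfolding s_def by auto
  have Ps: "P s \<eta>"
    unfolding P_def
  proof (intro conjI ballI)
    show "\<eta> holomorphic_on ball w1 s"
    proof (rule holomorphic_on_open[THEN iffD2, OF open_ball], intro ballI)
      fix w assume "w \<in> ball w1 s"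
      then obtain r where r: "r \<in> A" "w \<in> ball w1 r" using exr by blast
      have "E r holomorphic_on ball w1 r" using E r unfolding P_def by blast
      then obtain D where "(E r has_field_derivative D) (at w)"
        using holomorphic_on_open[OF open_ball] r by blast
      then have "(\<eta> has_field_derivative D) (at w)"
        by (rule DERIV_cong_ev[OF refl _ refl, THEN iffD1, rotated])
           (use r \<eta>E in \<open>auto simp: eventually_nhds intro!: exI[of _ "ball w1 r"]\<close>)
      then show "\<exists>D. (\<eta> has_field_derivative D) (at w)" by blast
    qed
    show "\<eta> w1 = z0" using exr[of w1] s0 \<eta>E[of _ w1] E unfolding P_def by auto
    show "h (\<eta> w) = w" if "w \<in> ball w1 s" for w
      using exr[OF that] \<eta>E E unfolding P_def by fastforce
  qed
  show thesis
  proof (cases "s = \<rho>")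
    case True
    then show ?thesis using that Ps unfolding P_def by blast
  next
    case False
    then have s\<rho>: "s < \<rho>" using s\<rho> by simp
    have ext: "\<exists>e>0. \<exists>\<kappa>. continuous_on (ball b e) \<kappa> \<and> (\<forall>v\<in>ball b e \<inter> ball w1 s. \<eta> v = \<kappa> v) \<and> h (\<kappa> b) = b"
      if b: "b \<in> cball w1 s" for b
    proof (cases "b \<in> ball w1 s")
      case True
      then obtain e where "0 < e" "ball b e \<subseteq> ball w1 s" using open_contains_ball open_ball by metis
      moreover have "continuous_on (ball w1 s) \<eta>"
        using Ps holomorphic_on_imp_continuous_on unfolding P_def by blast
      ultimately show ?thesis using Ps True unfolding P_def
        by (intro exI[of _ e] conjI exI[of _ \<eta>]) (auto elim: continuous_on_subset)
    next
      case False
      then have db: "dist w1 b = s" using b by simp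
      \<comment> \<open>Asymptotic values are tested on curves over [0, \<infinity>), hence the
        parameter t / (1 + t) for the radius from w1 to b.\<close>
      define c where "c t = w1 + of_real (t / (1 + t)) * (b - w1)" for t :: real
      define \<gamma> where "\<gamma> t = \<eta> (c t)" for t
      have cb: "c t \<in> ball w1 s" if "0 \<le> t" for t
      proof -
        have "dist w1 (c t) = \<bar>t / (1 + t)\<bar> * s"
          using db norm_of_real_mult[of "t / (1 + t)" "b - w1"]
          by (simp add: c_def dist_norm norm_minus_commute[of w1 b] del: of_real_divide)
        also have "\<dots> < 1 * s" using that s0 by (intro mult_strict_right_mono) (auto simp: field_simps)
        finally show ?thesis by simp
      qed
      have clim: "(c \<longlongrightarrow> b) at_top"
      proof -
        have "((\<lambda>t::real. 1 - inverse (1 + t)) \<longlongrightarrow> 1 - 0) at_top"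
          by (intro tendsto_intros tendsto_inverse_0_at_top filterlim_tendsto_add_at_top[OF tendsto_const] filterlim_ident)
        moreover have "1 - inverse (1 + t) = t / (1 + t)" if "0 \<le> t" for t :: real
          using that by (simp add: divide_simps)
        ultimately have "((\<lambda>t::real. t / (1 + t)) \<longlongrightarrow> 1) at_top"
          by (subst (asm) diff_0_right, elim Lim_transform_eventually)
             (auto intro!: eventually_at_top_linorderI[of 0])
        then have "(c \<longlongrightarrow> w1 + of_real 1 * (b - w1)) at_top"
          unfolding c_def by (intro tendsto_intros)
        then show ?thesis by simp
      qed
      have "continuous_on {0..} \<gamma>"
        unfolding \<gamma>_def
      proof (rule continuous_on_compose2[of "ball w1 s" \<eta>])
        show "continuous_on (ball w1 s) \<eta>"
          using Ps holomorphic_on_imp_continuous_on unfolding P_def by blast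
        show "continuous_on {0..} c" unfolding c_def by (intro continuous_intros) auto
      qed (use cb in auto)
      moreover have hg: "h (\<gamma> t) = c t" if "0 \<le> t" for t
        using Ps cb[OF that] unfolding P_def \<gamma>_def by blast
      have "((\<lambda>t. h (\<gamma> t)) \<longlongrightarrow> b) at_top"
        by (rule Lim_transform_eventually[OF clim])
           (auto intro!: eventually_at_top_linorderI[of 0] simp: hg)
      moreover have "b \<notin> asymptotic_values h"
      proof
        assume "b \<in> asymptotic_values h"
        then have "b \<in> singular_set h" unfolding singular_set_def
          by (intro subsetD[OF closure_subset]) auto
        then show False using sing db s\<rho> by auto
      qed
      ultimately have "\<not> filterlim \<gamma> at_infinity at_top" unfolding asymptotic_values_def by blast
      then obtain q t where qt: "filterlim t at_top sequentially" "(\<lambda>n. \<gamma> (t n)) \<longlonglongrightarrow> q"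
        using bounded_along_subsequence by blast
      have tpos: "\<forall>\<^sub>F n in sequentially. 0 \<le> t n"
        using qt(1) by (simp add: filterlim_at_top)
      have ct: "(\<lambda>n. c (t n)) \<longlonglongrightarrow> b" by (rule filterlim_compose[OF clim qt(1)])
      have "isCont h q" using conth[of UNIV] continuous_on_eq_continuous_at by blast
      then have "(\<lambda>n. h (\<gamma> (t n))) \<longlonglongrightarrow> h q" using qt(2) isCont_tendsto_compose by blast
      moreover have "(\<lambda>n. h (\<gamma> (t n))) \<longlonglongrightarrow> b"
        by (rule Lim_transform_eventually[OF ct]) (use tpos hg in \<open>auto elim: eventually_mono\<close>)
      ultimately have hq: "h q = b" by (rule LIMSEQ_unique)
      then have "deriv h q \<noteq> 0" using nz[of q] db s\<rho> by simp
      then obtain e \<kappa> V where e: "0 < e" "\<kappa> holomorphic_on ball b e" "open V" "q \<in> V"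
        "\<And>w. w \<in> ball b e \<Longrightarrow> h (\<kappa> w) = w" "\<And>z. z \<in> V \<Longrightarrow> \<kappa> (h z) = z"
        using entire_local_inverse[OF h, of q] hq by metis
      have "\<forall>\<^sub>F n in sequentially. \<gamma> (t n) \<in> V \<and> c (t n) \<in> ball b e \<and> 0 \<le> t n"
        using topological_tendstoD[OF qt(2) e(3,4)] topological_tendstoD[OF ct open_ball, of b e] e(1) tpos
        by (auto intro: eventually_conj)
      \<comment> \<open>One parameter at which the lifted radius lies in the domain V of the local
        inverse: there \<kappa> and \<eta> agree, so they agree on the intersection of the two
        balls.\<close>
      then obtain n where n: "\<gamma> (t n) \<in> V" "c (t n) \<in> ball b e" "0 \<le> t n"
        using eventually_happens' sequentially_bot by blast
      have "\<kappa> v = \<eta> v" if "v \<in> ball b e \<inter> ball w1 s" for v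
      proof (rule lift_unique[OF h, of "ball b e \<inter> ball w1 s" \<kappa> \<eta> "c (t n)"])
        show "connected (ball b e \<inter> ball w1 s)" by (simp add: convex_Int convex_connected)
        show "continuous_on (ball b e \<inter> ball w1 s) \<kappa>" "continuous_on (ball b e \<inter> ball w1 s) \<eta>"
          using e(2) Ps unfolding P_def
          by (auto intro!: holomorphic_on_imp_continuous_on elim!: holomorphic_on_subset)
        show "c (t n) \<in> ball b e \<inter> ball w1 s" using n cb by auto
        show "\<kappa> (c (t n)) = \<eta> (c (t n))" using e(6)[OF n(1)] hg[OF n(3)] by (simp add: \<gamma>_def)
        show "h (\<kappa> x) = h (\<eta> x)" if "x \<in> ball b e \<inter> ball w1 s" for x
          using that e(5) Ps unfolding P_def by auto
        show "deriv h (\<kappa> x) \<noteq> 0" if "x \<in> ball b e \<inter> ball w1 s" for x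
          using that e(5) s\<rho> by (intro nz) auto
      qed (use that in auto)
      then show ?thesis using e
        by (intro exI[of _ e] conjI exI[of _ \<kappa>]) (auto intro: holomorphic_on_imp_continuous_on)
    qed
    then have "\<forall>b\<in>cball w1 s. \<exists>e. 0 < e \<and> (\<exists>\<kappa>. continuous_on (ball b e) \<kappa> \<and>
        (\<forall>v\<in>ball b e \<inter> ball w1 s. \<eta> v = \<kappa> v) \<and> h (\<kappa> b) = b)"
      by blast
    from bchoice[OF this] obtain ee where ee: "\<forall>b\<in>cball w1 s. 0 < ee b \<and>
        (\<exists>\<kappa>. continuous_on (ball b (ee b)) \<kappa> \<and> (\<forall>v\<in>ball b (ee b) \<inter> ball w1 s. \<eta> v = \<kappa> v) \<and> h (\<kappa> b) = b)"
      by blast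
    then have "\<forall>b\<in>cball w1 s. \<exists>\<kappa>. continuous_on (ball b (ee b)) \<kappa> \<and>
        (\<forall>v\<in>ball b (ee b) \<inter> ball w1 s. \<eta> v = \<kappa> v) \<and> h (\<kappa> b) = b"
      by blast
    from bchoice[OF this] obtain \<kappa> where \<kappa>: "\<forall>b\<in>cball w1 s. continuous_on (ball b (ee b)) (\<kappa> b) \<and>
        (\<forall>v\<in>ball b (ee b) \<inter> ball w1 s. \<eta> v = \<kappa> b v) \<and> h (\<kappa> b b) = b"
      by blast
    have ek: "\<And>b. b \<in> cball w1 s \<Longrightarrow> 0 < ee b"
      "\<And>b. b \<in> cball w1 s \<Longrightarrow> continuous_on (ball b (ee b)) (\<kappa> b)"
      "\<And>b v. b \<in> cball w1 s \<Longrightarrow> v \<in> ball b (ee b) \<inter> ball w1 s \<Longrightarrow> \<eta> v = \<kappa> b v"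
      "\<And>b. b \<in> cball w1 s \<Longrightarrow> h (\<kappa> b b) = b"
      using ee \<kappa> by blast+
    have ntr: "at b within ball w1 s \<noteq> bot" if "b \<in> cball w1 s" for b
      using that s0 islimpt_ball[of b w1 s] by (simp add: trivial_limit_within)
    have lim: "(\<eta> \<longlongrightarrow> \<kappa> b v) (at v within ball w1 s)" if "b \<in> cball w1 s" "v \<in> cball w1 s" "v \<in> ball b (ee b)" for b v
    proof -
      have "isCont (\<kappa> b) v" using ek(2)[OF that(1)] that(3) continuous_on_eq_continuous_at open_ball by blast
      then have "(\<kappa> b \<longlongrightarrow> \<kappa> b v) (at v within ball w1 s)"
        using isCont_def tendsto_within_subset by blast
      moreover have "\<forall>\<^sub>F x in at v within ball w1 s. \<kappa> b x = \<eta> x"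
        unfolding eventually_at_topological
        using that ek(3)[OF that(1)] by (intro exI[of _ "ball b (ee b)"]) auto
      ultimately show ?thesis by (rule Lim_transform_eventually)
    qed
    \<comment> \<open>Each \<kappa> b was chosen separately. Its values on the closed ball are
      limits of \<eta> from inside, so the choices are compatible (\<open>HK\<close>).\<close>
    define H where "H b = \<kappa> b b" for b
    have HK: "H v = \<kappa> b v" if "b \<in> cball w1 s" "v \<in> cball w1 s" "v \<in> ball b (ee b)" for b v
      unfolding H_def using tendsto_unique[OF ntr[OF that(2)] lim[OF that(2,2)] lim[OF that]] ek(1)[OF that(2)] by simp
    have contH: "continuous_on (cball w1 s) H"
      unfolding continuous_on_def
    proof
      fix b assume b: "b \<in> cball w1 s"
      have "isCont (\<kappa> b) b"
        using ek(1,2)[OF b] continuous_on_eq_continuous_at open_ball centre_in_ball by blast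
      then have "(\<kappa> b \<longlongrightarrow> H b) (at b within cball w1 s)"
        unfolding H_def using isCont_def tendsto_within_subset by blast
      moreover have "\<forall>\<^sub>F x in at b within cball w1 s. \<kappa> b x = H x"
        unfolding eventually_at_topological
        using HK[OF b] ek(1)[OF b] by (intro exI[of _ "ball b (ee b)"]) auto
      ultimately show "(H \<longlongrightarrow> H b) (at b within cball w1 s)" by (rule Lim_transform_eventually)
    qed
    have hH: "h (H w) = w" if "w \<in> cball w1 s" for w using ek(4)[OF that] by (simp add: H_def)
    have H\<eta>: "H w = \<eta> w" if "w \<in> ball w1 s" for w
      using ek(1)[of w] ek(3)[of w w] that by (simp add: H_def)
    define K where "K = H ` cball w1 s"
    have "compact K" unfolding K_def by (intro compact_continuous_image contH) simp
    moreover have "inj_on h K" unfolding K_def by (rule inj_onI) (use hH in force)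
    moreover have "deriv h z \<noteq> 0" if "z \<in> K" for z
      using that hH s\<rho> by (intro nz) (auto simp: K_def)
    ultimately obtain V where V: "open V" "K \<subseteq> V" "inj_on h V" by (rule injective_nhd_compact[OF h])
    have hV: "h holomorphic_on V" using h holomorphic_on_subset by blast
    have ohV: "open (h ` V)" by (rule open_mapping_thm3[OF hV V(1,3)])
    obtain g where g: "g holomorphic_on h ` V" "\<And>z. z \<in> V \<Longrightarrow> g (h z) = z"
      using holomorphic_has_inverse[OF hV V(1,3)] by metis
    have cV: "cball w1 s \<subseteq> h ` V"
    proof
      fix w assume w: "w \<in> cball w1 s"
      then have "H w \<in> V" using V(2) by (auto simp: K_def)
      then show "w \<in> h ` V" using hH[OF w] by (metis imageI)
    qed
    obtain e where e: "0 < e" "(\<Union>x\<in>cball w1 s. ball x e) \<subseteq> h ` V"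
      using compact_subset_open_imp_ball_epsilon_subset[OF compact_cball ohV cV] by blast
    define s' where "s' = min \<rho> (s + e / 2)"
    have s': "s < s'" "s' \<le> \<rho>" using e s\<rho> by (auto simp: s'_def)
    have sub: "ball w1 s' \<subseteq> h ` V"
    proof
      fix w assume "w \<in> ball w1 s'"
      then have w: "dist w1 w < s + e / 2" by (simp add: s'_def)
      show "w \<in> h ` V"
      proof (cases "w \<in> cball w1 s")
        case False
        then have d: "s < dist w1 w" by simp
        \<comment> \<open>Radial projection of w to the sphere of radius s; it lies within e of
          w.\<close>
        define v where "v = w1 + of_real (s / dist w1 w) * (w - w1)"
        have dpos: "0 < dist w1 w" using d s0 by linarith
        have vs: "dist w1 v = s" using dpos s0
          using norm_of_real_mult[of "s / dist w1 w" "w - w1"]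
          by (simp add: v_def dist_norm norm_minus_commute[of w1 w] del: of_real_divide)
        have "w - v = of_real (1 - s / dist w1 w) * (w - w1)" by (simp add: v_def algebra_simps)
        then have "dist v w = \<bar>1 - s / dist w1 w\<bar> * dist w1 w"
          by (simp only: dist_norm norm_minus_commute[of v w] norm_of_real_mult norm_minus_commute[of w w1])
        moreover have "s / dist w1 w \<le> 1" using d dpos by simp
        ultimately have "dist v w = (1 - s / dist w1 w) * dist w1 w" by (simp only: abs_of_nonneg diff_ge_0_iff_ge)
        then have "dist v w = dist w1 w - s" using dpos by (simp add: left_diff_distrib)
        then have "dist v w < e" using w e by linarith
        then have "w \<in> (\<Union>x\<in>cball w1 s. ball x e)" using vs by (intro UN_I[of v]) auto
        then show ?thesis using e(2) by blast
      qed (use cV in blast)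
    qed
    have "P s' g"
      unfolding P_def
    proof (intro conjI ballI)
      show "g holomorphic_on ball w1 s'" using g(1) sub holomorphic_on_subset by blast
      have "z0 = H w1" using H\<eta>[of w1] s0 Ps by (simp add: P_def)
      then have "z0 \<in> V" using V(2) s0 by (auto simp: K_def)
      then show "g w1 = z0" using g(2) w1 by metis
      show "h (g w) = w" if "w \<in> ball w1 s'" for w using sub that g(2) by force
    qed
    then have "s' \<in> A" unfolding A_def using s' s0 by auto
    then show ?thesis using cSup_upper[OF _ Abd] s'(1) unfolding s_def by fastforce
  qed
qed

text \<open>By Liouville and the open mapping theorem the image is non-empty and open. It is
  relatively closed because a branch exists on every ball inside the complement of the disc, with a
  radius independent of the chosen preimage. The images of such branches are the sheets.\<close>

lemma covering_outside_singular_set: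
  assumes h: "h holomorphic_on UNIV" and nc: "\<not> h constant_on UNIV"
    and R: "singular_set h \<subseteq> cball 0 R"
  shows "covering_space (h -` (- cball 0 R)) h (- cball 0 R)"
proof
  define V where "V = - cball (0::complex) R"
  have oV: "open V" by (simp add: V_def open_Compl)
  have branch: "\<exists>\<eta>. \<eta> holomorphic_on ball (h z) \<rho> \<and> \<eta> (h z) = z \<and> (\<forall>w\<in>ball (h z) \<rho>. h (\<eta> w) = w)"
    if "ball (h z) \<rho> \<subseteq> V" "0 < \<rho>" for z \<rho>
  proof -
    have "ball (h z) \<rho> \<inter> singular_set h = {}" using that(1) R unfolding V_def by blast
    from inverse_branch_on_ball[OF h refl that(2) this] show ?thesis by metis
  qed
  have nz: "deriv h z \<noteq> 0" if "h z \<in> V" for z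
  proof
    assume "deriv h z = 0"
    then have "h z \<in> singular_set h" by (rule critical_value_singular)
    then show False using R that by (auto simp: V_def)
  qed
  have ch: "continuous_on A h" for A
    using h holomorphic_on_imp_continuous_on continuous_on_subset by blast
  have conn: "connected V" unfolding V_def by (intro connected_complement_bounded_convex) auto
  show "continuous_on (h -` (- cball 0 R)) h" by (rule ch)
  have "h -` V \<noteq> {}"
  proof
    assume "h -` V = {}"
    then have "range h \<subseteq> cball 0 R" by (auto simp: V_def)
    then have "bounded (range h)" using bounded_subset bounded_cball by blast
    then show False using nc Liouville_theorem[OF h] by blast
  qed
  then have ne: "h ` (h -` V) \<noteq> {}" by blast
  have oW: "open (h -` V)" using open_vimage[OF oV ch] .
  have "open (h ` (h -` V))"
    by (rule open_mapping_thm[OF h open_UNIV connected_UNIV oW _ nc]) simp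
  then have op: "openin (top_of_set V) (h ` (h -` V))"
    by (intro open_subset) auto
  have surj: "w \<in> h ` (h -` V)" if w: "w \<in> V" "w \<in> closure (h ` (h -` V))" for w
  proof -
    obtain r where r: "0 < r" "ball w r \<subseteq> V" using oV w(1) open_contains_ball by blast
    obtain z where z: "z \<in> h -` V" "dist (h z) w < r / 3"
      using w(2) r(1) unfolding closure_approachable by (metis divide_pos_pos imageE zero_less_numeral)
    have "ball (h z) (r / 2) \<subseteq> V"
    proof
      fix y assume "y \<in> ball (h z) (r / 2)"
      then have "dist w y < r" using z(2) dist_triangle[of w y "h z"] r(1) by (simp add: dist_commute)
      then show "y \<in> V" using r(2) by auto
    qed
    then obtain \<eta> where "\<And>v. v \<in> ball (h z) (r / 2) \<Longrightarrow> h (\<eta> v) = v"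
      using branch[of z "r/2"] r(1) by (metis half_gt_zero)
    moreover have "w \<in> ball (h z) (r / 2)" using z(2) r(1) by simp
    ultimately show ?thesis using w(1) by (metis image_eqI vimage_eq)
  qed
  have "closedin (top_of_set V) (h ` (h -` V))"
  proof -
    have "h ` (h -` V) = V \<inter> closure (h ` (h -` V))"
    proof (intro equalityI subsetI)
      fix w assume "w \<in> h ` (h -` V)"
      moreover from this have "w \<in> closure (h ` (h -` V))" by (rule subsetD[OF closure_subset])
      ultimately show "w \<in> V \<inter> closure (h ` (h -` V))" by auto
    next
      fix w assume "w \<in> V \<inter> closure (h ` (h -` V))"
      then show "w \<in> h ` (h -` V)" by (intro surj) simp_all
    qed
    then show ?thesis using closedin_closed_Int[OF closed_closure, of V "h ` (h -` V)"] by simp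
  qed
  then have "h ` (h -` V) = V" using conn op ne unfolding connected_clopen by blast
  then show im: "h ` (h -` (- cball 0 R)) = - cball 0 R" unfolding V_def .
  fix w0 assume "w0 \<in> - cball (0::complex) R"
  then obtain r where r: "0 < r" "ball w0 r \<subseteq> V" using oV open_contains_ball V_def by blast
  \<comment> \<open>With a third of the radius, the ball of radius 2 r / 3 about any point
    \<open>h z\<close> of B contains B and stays inside \<open>ball w0 r\<close>; so a branch
    through z is defined on all of B.\<close>
  define B where "B = ball w0 (r / 3)"
  have w0B: "w0 \<in> B" and BV: "B \<subseteq> V" using r by (auto simp: B_def)
  have "\<exists>\<eta>. \<eta> holomorphic_on B \<and> \<eta> (h z) = z \<and> (\<forall>w\<in>B. h (\<eta> w) = w)" if z: "h z \<in> B" for z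
  proof -
    have "ball (h z) (2 * r / 3) \<subseteq> ball w0 r" 
    proof
      fix y assume "y \<in> ball (h z) (2 * r / 3)"
      then show "y \<in> ball w0 r" using z dist_triangle[of w0 y "h z"] unfolding B_def by simp
    qed
    moreover have "B \<subseteq> ball (h z) (2 * r / 3)"
    proof
      fix y assume "y \<in> B"
      then show "y \<in> ball (h z) (2 * r / 3)" using z dist_triangle[of "h z" y w0]
        unfolding B_def by (simp add: dist_commute)
    qed
    ultimately have sub: "ball (h z) (2 * r / 3) \<subseteq> V" "B \<subseteq> ball (h z) (2 * r / 3)" using r by auto
    obtain \<eta> where "\<eta> holomorphic_on ball (h z) (2 * r / 3)" "\<eta> (h z) = z"
        "\<forall>w\<in>ball (h z) (2 * r / 3). h (\<eta> w) = w" using branch[OF sub(1)] r(1) by auto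
    then show ?thesis using sub(2) holomorphic_on_subset by (intro exI[of _ \<eta>]) blast
  qed
  then obtain \<eta> where \<eta>: "\<And>z. h z \<in> B \<Longrightarrow> \<eta> z holomorphic_on B" "\<And>z. h z \<in> B \<Longrightarrow> \<eta> z (h z) = z"
    "\<And>z w. h z \<in> B \<Longrightarrow> w \<in> B \<Longrightarrow> h (\<eta> z w) = w" by metis
  have same: "\<eta> z w = \<eta> z' w" if "h z \<in> B" "h z' \<in> B" "v \<in> B" "\<eta> z v = \<eta> z' v" "w \<in> B" for z z' v w
  proof (rule lift_unique[OF h, of B "\<eta> z" "\<eta> z'" v])
    show "connected B" unfolding B_def by simp
    show "continuous_on B (\<eta> z)" "continuous_on B (\<eta> z')"
      using \<eta>(1) that holomorphic_on_imp_continuous_on by blast+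
    show "h (\<eta> z x) = h (\<eta> z' x)" if "x \<in> B" for x using \<eta>(3) that \<open>h z \<in> B\<close> \<open>h z' \<in> B\<close> by simp
    show "deriv h (\<eta> z x) \<noteq> 0" if "x \<in> B" for x using nz \<eta>(3) that \<open>h z \<in> B\<close> BV by auto
  qed (use that in auto)
  define vs where "vs = (\<lambda>z. \<eta> z ` B) ` (h -` B)"
  show "\<exists>T. w0 \<in> T \<and> openin (top_of_set (- cball 0 R)) T \<and>
          (\<exists>v. \<Union>v = h -` (- cball 0 R) \<inter> h -` T \<and> (\<forall>u\<in>v. openin (top_of_set (h -` (- cball 0 R))) u) \<and>
          pairwise disjnt v \<and> (\<forall>u\<in>v. \<exists>q. homeomorphism u T h q))"
  proof (intro exI[of _ B] conjI exI[of _ vs] ballI)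
    show "w0 \<in> B" by (rule w0B)
    show "openin (top_of_set (- cball 0 R)) B"
      using BV unfolding V_def by (intro open_subset) (auto simp: B_def)
    show "\<Union>vs = h -` (- cball 0 R) \<inter> h -` B"
    proof (intro equalityI subsetI)
      fix x assume "x \<in> \<Union>vs"
      then show "x \<in> h -` (- cball 0 R) \<inter> h -` B" using \<eta>(3) BV unfolding vs_def V_def by auto
    next
      fix x assume "x \<in> h -` (- cball 0 R) \<inter> h -` B"
      then have "h x \<in> B" by simp
      then show "x \<in> \<Union>vs" 
        using \<eta>(2)[of x] unfolding vs_def by (intro UnionI[of "\<eta> x ` B"] imageI rev_image_eqI[of "h x"]) auto
    qed
    fix u assume "u \<in> vs"
    then obtain z where z: "h z \<in> B" "u = \<eta> z ` B" unfolding vs_def by auto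
    have inj: "inj_on (\<eta> z) B" using \<eta>(3)[OF z(1)] by (metis inj_onI)
    have "open u" unfolding z(2) 
      by (rule open_mapping_thm3[OF \<eta>(1)[OF z(1)] _ inj]) (simp add: B_def)
    moreover have "u \<subseteq> h -` (- cball 0 R)" using \<eta>(3)[OF z(1)] z BV unfolding V_def by auto
    ultimately show "openin (top_of_set (h -` (- cball 0 R))) u" by (rule open_subset[rotated])
    show "\<exists>q. homeomorphism u B h q"
    proof (intro exI[of _ "\<eta> z"] homeomorphismI)
      show "continuous_on B (\<eta> z)" using \<eta>(1)[OF z(1)] holomorphic_on_imp_continuous_on by blast
    qed (use ch \<eta>(3)[OF z(1)] z(2) in auto)
  next
    show "pairwise disjnt vs"
    proof (rule pairwiseI)
      fix u u' assume "u \<in> vs" "u' \<in> vs" "u \<noteq> u'"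
      then obtain z z' where z: "h z \<in> B" "u = \<eta> z ` B" "h z' \<in> B" "u' = \<eta> z' ` B" unfolding vs_def by auto
      show "disjnt u u'"
      proof (rule ccontr)
        assume "\<not> disjnt u u'"
        then obtain v v' where v: "v \<in> B" "v' \<in> B" "\<eta> z v = \<eta> z' v'" using z by (auto simp: disjnt_def)
        then have "v = v'" using \<eta>(3) z(1,3) by metis
        then have "\<eta> z w = \<eta> z' w" if "w \<in> B" for w using same[OF z(1,3)] v that by blast
        then show False using \<open>u \<noteq> u'\<close> z by (auto simp: image_def)
      qed
    qed
  qed
qed

section \<open>Lifting maps of half planes through compositions\<close>

text \<open>A lifting property for arbitrary q, rather than a covering property, because it passes
  to compositions: the lift through the outer map is the q for the inner one.\<close>

definition lifts_above :: "(complex \<Rightarrow> complex) \<Rightarrow> real \<Rightarrow> bool" where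
  "lifts_above f R \<longleftrightarrow> f holomorphic_on UNIV \<and> (\<forall>z. R < norm (f z) \<longrightarrow> deriv f z \<noteq> 0) \<and>
     (\<forall>a q \<omega> z. q holomorphic_on {\<omega>. a < Re \<omega>} \<longrightarrow> (\<forall>\<omega>. a < Re \<omega> \<longrightarrow> R < norm (q \<omega>)) \<longrightarrow> a < Re \<omega> \<longrightarrow>
        f z = q \<omega> \<longrightarrow>
        (\<exists>\<psi>. \<psi> holomorphic_on {\<omega>. a < Re \<omega>} \<and> \<psi> \<omega> = z \<and> (\<forall>\<omega>. a < Re \<omega> \<longrightarrow> f (\<psi> \<omega>) = q \<omega>)))"

lemma lifts_aboveD:
  assumes "lifts_above f R"
  shows "f holomorphic_on UNIV" "\<And>z. R < norm (f z) \<Longrightarrow> deriv f z \<noteq> 0"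
    "\<And>q a \<omega> z. q holomorphic_on {\<omega>. a < Re \<omega>} \<Longrightarrow> (\<And>\<omega>. a < Re \<omega> \<Longrightarrow> R < norm (q \<omega>)) \<Longrightarrow> a < Re \<omega> \<Longrightarrow> f z = q \<omega> \<Longrightarrow>
      \<exists>\<psi>. \<psi> holomorphic_on {\<omega>. a < Re \<omega>} \<and> \<psi> \<omega> = z \<and> (\<forall>\<omega>. a < Re \<omega> \<longrightarrow> f (\<psi> \<omega>) = q \<omega>)"
  using assms unfolding lifts_above_def by simp_all

lemma lifts_above_id: "lifts_above id R"
  unfolding lifts_above_def
proof (intro conjI allI impI)
  show "\<exists>\<psi>. \<psi> holomorphic_on {\<omega>. a < Re \<omega>} \<and> \<psi> \<omega> = z \<and> (\<forall>\<omega>. a < Re \<omega> \<longrightarrow> id (\<psi> \<omega>) = q \<omega>)"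
    if "q holomorphic_on {\<omega>. a < Re \<omega>}" "id z = q \<omega>" for a q \<omega> z
    using that by (intro exI[of _ q]) simp
qed (simp_all add: id_def)

text \<open>\<open>uR\<close> keeps the lift through u outside the disc of radius Rh, so that it can
  be lifted once more through h.\<close>

lemma lifts_above_comp:
  assumes u: "lifts_above u Ru" and h: "lifts_above h Rh" and R: "Ru \<le> R"
    and uR: "\<And>z. R < norm (u z) \<Longrightarrow> Rh < norm z"
  shows "lifts_above (u \<circ> h) R"
  unfolding lifts_above_def
proof (intro conjI allI impI)
  have uh: "u holomorphic_on UNIV" "h holomorphic_on UNIV" using u h by (auto simp: lifts_above_def)
  show "(u \<circ> h) holomorphic_on UNIV" using holomorphic_on_compose[OF uh(2)] uh(1) holomorphic_on_subset by blast
  show "deriv (u \<circ> h) z \<noteq> 0" if "R < norm ((u \<circ> h) z)" for z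
  proof -
    have "deriv (u \<circ> h) z = deriv u (h z) * deriv h z"
      using uh by (intro deriv_chain) (auto simp: holomorphic_on_imp_differentiable_at)
    moreover have "deriv u (h z) \<noteq> 0" using that u R by (auto simp: lifts_above_def)
    moreover have "deriv h z \<noteq> 0" using uR[of "h z"] that h by (auto simp: lifts_above_def)
    ultimately show ?thesis by simp
  qed
  fix a q \<omega> z
  assume q: "q holomorphic_on {\<omega>. a < Re \<omega>}" "\<forall>\<omega>. a < Re \<omega> \<longrightarrow> R < norm (q \<omega>)" "a < Re \<omega>" "(u \<circ> h) z = q \<omega>"
  have q2: "Ru < norm (q \<omega>)" if "a < Re \<omega>" for \<omega> using q(2) R that by fastforce
  from lifts_aboveD(3)[OF u q(1) q2 q(3), of "h z"] q(4)
  obtain p where p: "p holomorphic_on {\<omega>. a < Re \<omega>}" "p \<omega> = h z" "\<And>\<omega>. a < Re \<omega> \<Longrightarrow> u (p \<omega>) = q \<omega>"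
    by auto
  have p2: "Rh < norm (p \<omega>)" if "a < Re \<omega>" for \<omega> using q(2) p(3)[OF that] uR[of "p \<omega>"] that by simp
  from lifts_aboveD(3)[OF h p(1) p2 q(3), of z] p(2)
  obtain \<psi> where "\<psi> holomorphic_on {\<omega>. a < Re \<omega>}" "\<psi> \<omega> = z" "\<And>\<omega>. a < Re \<omega> \<Longrightarrow> h (\<psi> \<omega>) = p \<omega>"
    by auto
  then show "\<exists>\<psi>. \<psi> holomorphic_on {\<omega>. a < Re \<omega>} \<and> \<psi> \<omega> = z \<and> (\<forall>\<omega>. a < Re \<omega> \<longrightarrow> (u \<circ> h) (\<psi> \<omega>) = q \<omega>)"
    using p(3) by auto
qed

lemma class_B_lifts_above:
  assumes "h \<in> class_B"
  obtains R where "lifts_above h R"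
proof -
  have h: "h holomorphic_on UNIV" and np: "\<nexists>p. h = poly p" and bd: "bounded (singular_set h)"
    using assms by (auto simp: class_B_def transcendental_entire_def)
  obtain R where R: "singular_set h \<subseteq> cball 0 R" using bd unfolding bounded_iff by (auto simp: subset_eq)
  have "\<not> h constant_on UNIV"
  proof
    assume "h constant_on UNIV"
    then obtain c where "h = (\<lambda>_. c)" unfolding constant_on_def by auto
    then have "h = poly [:c:]" by auto
    then show False using np by blast
  qed
  note cov = covering_outside_singular_set[OF h this R]
  have oW: "open (h -` (- cball 0 R))"
    using h holomorphic_on_imp_continuous_on by (intro open_vimage) (auto simp: open_Compl)
  have hW: "h holomorphic_on h -` (- cball 0 R)" using h holomorphic_on_subset by blast
  have "lifts_above h R"
    unfolding lifts_above_def
  proof (intro conjI allI impI)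
    show "deriv h z \<noteq> 0" if "R < norm (h z)" for z
    proof
      assume "deriv h z = 0"
      then have "h z \<in> singular_set h" by (rule critical_value_singular)
      then show False using R that by auto
    qed
    fix a q \<omega> z
    assume q: "q holomorphic_on {\<omega>. a < Re \<omega>}" "\<forall>\<omega>. a < Re \<omega> \<longrightarrow> R < norm (q \<omega>)" "a < Re \<omega>" "h z = q \<omega>"
    have cv: "convex {\<omega>. a < Re \<omega>}" by (rule convex_halfspace_Re_gt)
    obtain \<psi> where \<psi>: "continuous_on {\<omega>. a < Re \<omega>} \<psi>" "\<psi> \<in> {\<omega>. a < Re \<omega>} \<rightarrow> h -` (- cball 0 R)"
      "\<psi> \<omega> = z" "\<And>y. y \<in> {\<omega>. a < Re \<omega>} \<Longrightarrow> h (\<psi> y) = q y"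
    proof (rule covering_space_lift_strong[OF cov, of z \<omega> "{\<omega>. a < Re \<omega>}" q])
      show "simply_connected {\<omega>. a < Re \<omega>}" using cv convex_imp_simply_connected by blast
      show "locally path_connected {\<omega>. a < Re \<omega>}" using cv convex_imp_locally_path_connected by blast
      show "continuous_on {\<omega>. a < Re \<omega>} q" using q(1) holomorphic_on_imp_continuous_on by blast
    qed (use q in auto)
    have "\<psi> holomorphic_on {\<omega>. a < Re \<omega>}"
      by (rule covering_space_lift_is_holomorphic[OF cov oW hW q(1)]) (use q \<psi> in auto)
    then show "\<exists>\<psi>. \<psi> holomorphic_on {\<omega>. a < Re \<omega>} \<and> \<psi> \<omega> = z \<and> (\<forall>\<omega>. a < Re \<omega> \<longrightarrow> h (\<psi> \<omega>) = q \<omega>)"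
      using \<psi> by auto
  qed (rule h)
  then show thesis by (rule that)
qed

lemma entire_bounded_on_cball:
  assumes "u holomorphic_on UNIV"
  obtains R :: real where "0 \<le> R" "\<And>z. norm z \<le> r \<Longrightarrow> norm (u z) \<le> R"
proof -
  have "compact (u ` cball 0 r)"
    using continuous_on_subset[OF holomorphic_on_imp_continuous_on[OF assms]]
    by (intro compact_continuous_image) auto
  then obtain R where "\<forall>w\<in>u ` cball 0 r. norm w \<le> R" using compact_imp_bounded bounded_iff by metis
  then have "norm (u z) \<le> max 0 R" if "norm z \<le> r" for z using that by (auto simp: max.coboundedI2)
  then show thesis by (intro that[of "max 0 R"]) auto
qed

lemma foldr_lifts_above:
  assumes "\<forall>g\<in>set gs. g \<in> class_B"
  shows "\<exists>R. lifts_above (foldr (\<circ>) gs id) R"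
  using assms
proof (induction gs)
  case Nil
  have "lifts_above (foldr (\<circ>) [] id) 0" using lifts_above_id by simp
  then show ?case by blast
next
  case (Cons g gs)
  have "\<exists>R. lifts_above (foldr (\<circ>) gs id) R" using Cons by (simp del: comp_apply id_apply)
  then obtain Rh where Rh: "lifts_above (foldr (\<circ>) gs id) Rh" by blast
  obtain Ru where Ru: "lifts_above g Ru" using Cons.prems class_B_lifts_above[of g] by (metis list.set_intros(1))
  then have "g holomorphic_on UNIV" by (simp add: lifts_above_def)
  \<comment> \<open>Values of g beyond modulus B are taken only at points beyond modulus Rh, as
    \<open>lifts_above_comp\<close> demands.\<close>
  then obtain B where B: "\<And>z. norm z \<le> Rh \<Longrightarrow> norm (g z) \<le> B" using entire_bounded_on_cball by metis
  have "lifts_above (g \<circ> foldr (\<circ>) gs id) (max Ru B)"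
  proof (rule lifts_above_comp[OF Ru Rh])
    show "Rh < norm z" if "max Ru B < norm (g z)" for z
    proof (rule ccontr)
      assume "\<not> Rh < norm z"
      then show False using B[of z] that by simp
    qed
  qed simp
  then have "lifts_above (foldr (\<circ>) (g # gs) id) (max Ru B)" by simp
  then show ?case by blast
qed

section \<open>Inverse branches in logarithmic coordinates\<close>

definition per :: "int \<Rightarrow> complex" where
  "per n = complex_of_real (2 * pi * of_int n) * \<i>"

lemma Re_per [simp]: "Re (per n) = 0" and Im_per [simp]: "Im (per n) = 2 * pi * of_int n"
  by (simp_all add: per_def)

lemma per_0 [simp]: "per 0 = 0" by (simp add: per_def)

lemma per_add: "per (m + n) = per m + per n" and per_minus: "per (- n) = - per n"
  by (simp_all add: per_def algebra_simps)

lemma per_eq_iff [simp]: "per m = per n \<longleftrightarrow> m = n"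
  by (auto simp: complex_eq_iff)

lemma per_eq_0_iff [simp]: "per m = 0 \<longleftrightarrow> m = 0"
  by (auto simp: complex_eq_iff)

lemma exp_per [simp]: "exp (per n) = 1"
  using exp_eq_1 by fastforce

lemma exp_add_per [simp]: "exp (z + per n) = exp z" and exp_diff_per [simp]: "exp (z - per n) = exp z"
  by (simp_all add: exp_add exp_diff)

lemma exp_eq_perE:
  assumes "exp w = exp z"
  obtains n where "w = z + per n"
proof -
  obtain n where "w = z + (of_int (2 * n) * pi) * \<i>" using assms unfolding exp_eq by auto
  then have "w = z + per n" by (simp add: complex_eq_iff)
  then show thesis by (rule that)
qed

lemma tendsto_infinity_imp_poly:
  assumes h: "h holomorphic_on UNIV" and "filterlim h at_infinity at_infinity"
  shows "\<exists>p. h = poly p"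
proof -
  have "((inverse \<circ> h) \<longlongrightarrow> 0) at_infinity"
    using filterlim_compose[OF tendsto_inverse_0 assms(2)] by (simp add: o_def)
  then obtain a n where an: "\<And>z. h z = (\<Sum>i\<le>n. a i * z ^ i)" using pole_at_infinity[OF h] by blast
  have "h = poly (\<Sum>i\<le>n. monom (a i) i)"
    by (rule ext) (simp add: an poly_sum poly_monom)
  then show ?thesis by blast
qed

text \<open>\<open>small\<close> keeps all points with |f| > R outside the unit disc, so that their
  logarithms have positive real part. \<open>not_pole\<close> excludes tracts that are punctured
  neighbourhoods of infinity, over which inverse branches would be periodic.\<close>

locale log_map =
  fixes f :: "complex \<Rightarrow> complex" and R :: real
  assumes lifts: "lifts_above f R" and R1: "1 \<le> R"
    and small: "\<And>z. norm z \<le> 1 \<Longrightarrow> norm (f z) \<le> R"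
    and not_pole: "\<not> filterlim f at_infinity at_infinity"
begin

definition \<rho> :: real where "\<rho> = ln R"

definition H :: "complex set" where "H = {\<omega>. \<rho> < Re \<omega>}"

definition F :: "complex \<Rightarrow> complex" where "F z = f (exp z)"

text \<open>\<phi> is an inverse branch of a logarithmic transform of f. The relation
  \<open>F (\<phi> \<omega>) = exp \<omega>\<close> avoids choosing a logarithm of f on a tract, and
  makes translates by periods branches as well (\<open>branch_shift\<close>).\<close>

definition branch :: "(complex \<Rightarrow> complex) \<Rightarrow> bool" where
  "branch \<phi> \<longleftrightarrow> \<phi> holomorphic_on H \<and> (\<forall>\<omega>\<in>H. F (\<phi> \<omega>) = exp \<omega>)"

lemma f_holo: "f holomorphic_on A"
  using lifts holomorphic_on_subset unfolding lifts_above_def by blast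

lemma F_holo: "F holomorphic_on A"
proof -
  have "(f \<circ> exp) holomorphic_on A"
    by (rule holomorphic_on_compose[OF holomorphic_on_exp f_holo])
  then show ?thesis by (simp add: F_def[abs_def] o_def)
qed

lemma isCont_f: "isCont f z"
  using f_holo[of UNIV] holomorphic_on_imp_continuous_on continuous_on_eq_continuous_at by blast

lemma isCont_F: "isCont F z"
  using F_holo[of UNIV] holomorphic_on_imp_continuous_on continuous_on_eq_continuous_at by blast

lemma deriv_F: "deriv F z = deriv f (exp z) * exp z"
proof -
  have "(f has_field_derivative deriv f (exp z)) (at (exp z))"
    using holomorphic_derivI[OF f_holo open_UNIV] by simp
  then have "((\<lambda>z. f (exp z)) has_field_derivative deriv f (exp z) * exp z) (at z)"
    by (rule DERIV_chain2[OF _ DERIV_exp])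
  then show ?thesis unfolding F_def[abs_def] by (rule DERIV_imp_deriv)
qed

lemma F_regular: "R < norm (F z) \<Longrightarrow> deriv F z \<noteq> 0"
  using lifts_aboveD(2)[OF lifts, of "exp z"] by (simp add: deriv_F F_def)

lemma \<rho>_nonneg: "0 \<le> \<rho>" using R1 by (simp add: \<rho>_def)

lemma mem_H: "\<omega> \<in> H \<longleftrightarrow> \<rho> < Re \<omega>" by (simp add: H_def)

lemma open_H: "open H" and convex_H: "convex H" and connected_H: "connected H"
  unfolding H_def by (simp_all add: open_halfspace_Re_gt convex_halfspace_Re_gt convex_connected)

lemma norm_exp_H: "\<omega> \<in> H \<Longrightarrow> R < norm (exp \<omega>)"
  using R1 by (simp add: H_def \<rho>_def ln_less_cancel_iff flip: exp_less_cancel_iff[of "ln R"])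

lemma branchD:
  assumes "branch \<phi>"
  shows "\<phi> holomorphic_on H" "\<And>\<omega>. \<omega> \<in> H \<Longrightarrow> F (\<phi> \<omega>) = exp \<omega>" "continuous_on H \<phi>"
  using assms holomorphic_on_imp_continuous_on unfolding branch_def by blast+

lemma isCont_branch: "branch \<phi> \<Longrightarrow> \<omega> \<in> H \<Longrightarrow> isCont \<phi> \<omega>"
  using branchD(3) open_H continuous_on_eq_continuous_at by blast

lemma branch_regular: "branch \<phi> \<Longrightarrow> \<omega> \<in> H \<Longrightarrow> deriv F (\<phi> \<omega>) \<noteq> 0"
  using F_regular[of "\<phi> \<omega>"] branchD(2) norm_exp_H by simp

lemma branch_unique:
  assumes "branch \<phi>" "branch \<psi>" "\<omega>0 \<in> H" "\<phi> \<omega>0 = \<psi> \<omega>0" "\<omega> \<in> H"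
  shows "\<phi> \<omega> = \<psi> \<omega>"
  by (rule lift_unique[OF F_holo connected_H, of \<phi> \<psi>])
     (use assms branch_regular in \<open>auto simp: branchD\<close>)

text \<open>This is how a curve is assigned to a branch: G and \<phi> \<circ> G' lift the same curve
  through F, so agreement at one parameter suffices.\<close>

lemma branch_lift:
  fixes G G' :: "'a::topological_space \<Rightarrow> complex"
  assumes "branch \<phi>" "connected S" "continuous_on S G" "continuous_on S G'"
    and "\<And>x. x \<in> S \<Longrightarrow> G' x \<in> H" "\<And>x. x \<in> S \<Longrightarrow> F (G x) = exp (G' x)"
    and "x0 \<in> S" "\<phi> (G' x0) = G x0" "x \<in> S"
  shows "\<phi> (G' x) = G x"
proof (rule lift_unique[OF F_holo assms(2), of "\<lambda>x. \<phi> (G' x)" G])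
  show "continuous_on S (\<lambda>x. \<phi> (G' x))"
    by (rule continuous_on_compose2[OF branchD(3)[OF assms(1)] assms(4)]) (use assms(5) in auto)
qed (use assms branch_regular[OF assms(1)] branchD(2)[OF assms(1)] in auto)

text \<open>First \<open>exp\<close> is lifted through f, then a logarithm of the lift is taken; the
  lift has no zero because |f 0| is at most R.\<close>

lemma branch_exists:
  assumes "\<omega> \<in> H" "F \<zeta> = exp \<omega>"
  obtains \<phi> where "branch \<phi>" "\<phi> \<omega> = \<zeta>"
proof -
  have "\<exists>\<psi>. \<psi> holomorphic_on {\<omega>. \<rho> < Re \<omega>} \<and> \<psi> \<omega> = exp \<zeta> \<and> (\<forall>\<omega>. \<rho> < Re \<omega> \<longrightarrow> f (\<psi> \<omega>) = exp \<omega>)"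
    by (rule lifts_aboveD(3)[OF lifts])
       (use assms norm_exp_H in \<open>auto simp: mem_H F_def intro!: holomorphic_intros\<close>)
  then obtain \<psi> where \<psi>: "\<psi> holomorphic_on H" "\<psi> \<omega> = exp \<zeta>" "\<And>\<omega>. \<omega> \<in> H \<Longrightarrow> f (\<psi> \<omega>) = exp \<omega>"
    unfolding H_def by auto
  have nz: "\<psi> y \<noteq> 0" if "y \<in> H" for y
    using small[of 0] \<psi>(3)[OF that] norm_exp_H[OF that] by auto
  obtain g where g: "continuous_on H g" "g \<in> H \<rightarrow> UNIV" "g \<omega> = \<zeta>" "\<And>y. y \<in> H \<Longrightarrow> exp (g y) = \<psi> y"
  proof (rule covering_space_lift_strong[OF covering_space_exp_punctured_plane, of \<zeta> \<omega> H \<psi>])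
    show "simply_connected H" using convex_H convex_imp_simply_connected by blast
    show "locally path_connected H" using convex_H convex_imp_locally_path_connected by blast
    show "continuous_on H \<psi>" using \<psi>(1) holomorphic_on_imp_continuous_on by blast
  qed (use assms(1) \<psi>(2) nz in auto)
  have "g holomorphic_on H"
    by (rule covering_space_lift_is_holomorphic[OF covering_space_exp_punctured_plane open_UNIV _ \<psi>(1) _ _ g(1)])
       (use nz g in \<open>auto intro!: holomorphic_intros\<close>)
  then have "branch g" using g(4) \<psi>(3) by (simp add: branch_def F_def)
  then show thesis using g(3) by (rule that)
qed

lemma branch_Re_pos: "branch \<phi> \<Longrightarrow> \<omega> \<in> H \<Longrightarrow> 0 < Re (\<phi> \<omega>)"
  using small[of "exp (\<phi> \<omega>)"] branchD(2)[of \<phi> \<omega>] norm_exp_H[of \<omega>]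
  by (fastforce simp: F_def)

lemma H_shift [simp]: "\<omega> - per m \<in> H \<longleftrightarrow> \<omega> \<in> H" "\<omega> + per m \<in> H \<longleftrightarrow> \<omega> \<in> H"
  by (simp_all add: mem_H)

lemma branch_shift:
  assumes "branch \<phi>"
  shows "branch (\<lambda>\<omega>. \<phi> (\<omega> - per m) + per j)"
proof -
  have "(\<phi> \<circ> (\<lambda>\<omega>. \<omega> - per m)) holomorphic_on H"
    by (rule holomorphic_on_compose_gen[OF _ branchD(1)[OF assms]]) (auto intro!: holomorphic_intros)
  then have "(\<lambda>\<omega>. \<phi> (\<omega> - per m) + per j) holomorphic_on H"
    by (intro holomorphic_on_add) (auto simp: o_def)
  moreover have "F (\<phi> (\<omega> - per m) + per j) = exp \<omega>" if "\<omega> \<in> H" for \<omega>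
    using branchD(2)[OF assms, of "\<omega> - per m"] that by (simp add: F_def)
  ultimately show ?thesis by (simp add: branch_def)
qed

text \<open>A branch \<open>\<phi>\<close> with \<open>\<phi>(\<omega> + 2\<pi>im) - \<phi>(\<omega>)\<close> a constant multiple of \<open>2\<pi>i\<close> would make
  the tract \<open>exp \<phi>(H)\<close> a punctured neighbourhood of infinity on which \<open>f\<close> tends to infinity.\<close>

lemma branch_not_periodic:
  assumes \<phi>: "branch \<phi>" and m: "0 < m" and per: "\<And>\<omega>. \<omega> \<in> H \<Longrightarrow> exp (\<phi> (\<omega> + per m)) = exp (\<phi> \<omega>)"
  shows False
proof -
  define \<psi> where "\<psi> \<omega> = exp (\<phi> \<omega>)" for \<omega>
  have cont\<psi>: "continuous_on H \<psi>" unfolding \<psi>_def by (intro continuous_intros branchD(3)[OF \<phi>])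
  have f\<psi>: "f (\<psi> \<omega>) = exp \<omega>" if "\<omega> \<in> H" for \<omega> using branchD(2)[OF \<phi> that] by (simp add: \<psi>_def F_def)
  have per_nat: "\<psi> (\<omega> + per (m * int n)) = \<psi> \<omega>" if "\<omega> \<in> H" for \<omega> n
  proof (induction n)
    case (Suc n)
    have "\<psi> ((\<omega> + per (m * int n)) + per m) = \<psi> (\<omega> + per (m * int n))"
      unfolding \<psi>_def using that by (intro per) simp
    then show ?case using Suc by (simp add: algebra_simps per_add)
  qed simp
  have per_int: "\<psi> (\<omega> + per (m * k)) = \<psi> \<omega>" if "\<omega> \<in> H" for \<omega> k
  proof (cases "0 \<le> k")
    case True
    then show ?thesis using per_nat[OF that, of "nat k"] by simp
  next
    case False
    then show ?thesis using per_nat[of "\<omega> + per (m * k)" "nat (- k)"] that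
      by (simp add: per_minus)
  qed
  define L where "L = 2 * pi * of_int m"
  have L: "0 < L" using m by (simp add: L_def)
  \<comment> \<open>The strip 0 \<le> Im \<le> L contains a fundamental domain for the period of
    \<psi>, so bounded real parts leave only a compact rectangle to consider.\<close>
  have reduce: "\<exists>\<omega>'. Re \<omega>' = Re \<omega> \<and> 0 \<le> Im \<omega>' \<and> Im \<omega>' \<le> L \<and> \<psi> \<omega>' = \<psi> \<omega>" if "\<omega> \<in> H" for \<omega>
  proof (intro exI conjI)
    define k where "k = \<lfloor>Im \<omega> / L\<rfloor>"
    have k: "of_int k \<le> Im \<omega> / L" "Im \<omega> / L < of_int k + 1" by (simp_all add: k_def)
    show "\<psi> (\<omega> + per (m * - k)) = \<psi> \<omega>" by (rule per_int[OF that])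
    show "Re (\<omega> + per (m * - k)) = Re \<omega>" by simp
    have "Im (\<omega> + per (m * - k)) = Im \<omega> - of_int k * L" by (simp add: L_def)
    moreover have "of_int k * L \<le> Im \<omega>" "Im \<omega> < of_int k * L + L"
      using k L by (simp_all add: pos_le_divide_eq pos_divide_less_eq distrib_right)
    ultimately show "0 \<le> Im (\<omega> + per (m * - k))" "Im (\<omega> + per (m * - k)) \<le> L"
      by linarith+
  qed
  \<comment> \<open>The image \<Omega> of the half plane right of x is open, and outside a disc
    containing the image Q of its boundary line it is relatively closed. The exterior of the disc is
    connected and meets \<Omega>, hence lies in \<Omega>, where |f| exceeds exp x.\<close>
  have big: "\<exists>r. \<forall>z. r < norm z \<longrightarrow> exp x < norm (f z)" if x: "\<rho> < x" for x
  proof -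
    define \<Omega> where "\<Omega> = \<psi> ` {\<omega>. x < Re \<omega>}"
    define Q where "Q = \<psi> ` cbox (Complex x 0) (Complex x L)"
    have QH: "cbox (Complex x 0) (Complex x L) \<subseteq> H" using x by (auto simp: in_cbox_complex_iff mem_H)
    have "compact Q" unfolding Q_def by (intro compact_continuous_image continuous_on_subset[OF cont\<psi> QH] compact_cbox)
    then obtain r where r: "\<And>z. z \<in> Q \<Longrightarrow> norm z \<le> r" using compact_imp_bounded bounded_iff by metis
    define r' where "r' = max r 0"
    have sH: "{\<omega>. x < Re \<omega>} \<subseteq> H" using x by (auto simp: mem_H)
    have hol\<psi>: "\<psi> holomorphic_on {\<omega>. x < Re \<omega>}"
      unfolding \<psi>_def by (intro holomorphic_intros holomorphic_on_subset[OF branchD(1)[OF \<phi>] sH])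
    have "open \<Omega>" unfolding \<Omega>_def
    proof (rule open_mapping_thm[OF hol\<psi> _ _ _ order_refl])
      show op: "open {\<omega>. x < Re \<omega>}" "open {\<omega>. x < Re \<omega>}" by (simp_all add: open_halfspace_Re_gt)
      show "connected {\<omega>. x < Re \<omega>}" by (simp add: convex_connected convex_halfspace_Re_gt)
      show "\<not> \<psi> constant_on {\<omega>. x < Re \<omega>}"
      proof
        assume "\<psi> constant_on {\<omega>. x < Re \<omega>}"
        then have "\<psi> (of_real (x + 1)) = \<psi> (of_real (x + 2))" unfolding constant_on_def by auto
        then have "f (\<psi> (of_real (x + 1))) = f (\<psi> (of_real (x + 2)))" by simp
        then have "exp (complex_of_real (x + 1)) = exp (complex_of_real (x + 2))"
          using x by (simp add: f\<psi> mem_H)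
        then have "norm (exp (complex_of_real (x + 1))) = norm (exp (complex_of_real (x + 2)))" by simp
        then show False by simp
      qed
    qed
    define E where "E = - cball (0::complex) r'"
    have cl: "z \<in> \<Omega>" if z: "z \<in> closure \<Omega>" "z \<in> E" for z
    proof -
      obtain s where s: "\<And>n. s n \<in> \<Omega>" "s \<longlonglongrightarrow> z" using z(1) closure_sequential by blast
      have "\<exists>\<omega>. s n = \<psi> \<omega> \<and> x < Re \<omega> \<and> 0 \<le> Im \<omega> \<and> Im \<omega> \<le> L" for n
      proof -
        obtain \<omega> where w: "s n = \<psi> \<omega>" "x < Re \<omega>" using s(1) unfolding \<Omega>_def by blast
        then have "\<omega> \<in> H" using x by (simp add: mem_H)
        from reduce[OF this] obtain \<omega>' where "Re \<omega>' = Re \<omega>" "0 \<le> Im \<omega>'" "Im \<omega>' \<le> L" "\<psi> \<omega>' = \<psi> \<omega>" by blast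
        then show ?thesis using w by (intro exI[of _ \<omega>']) simp
      qed
      then obtain w where w: "\<And>n. s n = \<psi> (w n)" "\<And>n. x < Re (w n)" "\<And>n. 0 \<le> Im (w n)" "\<And>n. Im (w n) \<le> L"
        by metis
      have "(\<lambda>n. f (s n)) \<longlonglongrightarrow> f z" by (rule isCont_tendsto_compose[OF isCont_f s(2)])
      then have "Bseq (\<lambda>n. f (s n))" by (rule convergent_imp_Bseq[OF convergentI])
      then obtain B where B: "0 < B" "\<And>n. norm (f (s n)) \<le> B" by (auto elim: BseqE)
      have fw: "norm (f (s n)) = exp (Re (w n))" for n
        using f\<psi>[of "w n"] w(1,2)[of n] x by (simp add: mem_H)
      have "Re (w n) \<le> ln B" for n
        using B(2)[of n] B(1) fw[of n] by (simp add: ln_ge_iff)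
      then have wb: "w n \<in> cbox (Complex x 0) (Complex (ln B) L)" for n
        using w(2-4)[of n] by (simp add: in_cbox_complex_iff less_imp_le)
      obtain w0 t where w0: "w0 \<in> cbox (Complex x 0) (Complex (ln B) L)" "strict_mono t" "(w \<circ> t) \<longlonglongrightarrow> w0"
        using seq_compactE[OF compact_imp_seq_compact[OF compact_cbox], of w] wb by blast
      have w0H: "w0 \<in> H" "x \<le> Re w0" using w0(1) x by (auto simp: in_cbox_complex_iff mem_H)
      have "isCont \<psi> w0" using cont\<psi> w0H open_H continuous_on_eq_continuous_at by blast
      then have "(\<lambda>n. \<psi> ((w \<circ> t) n)) \<longlonglongrightarrow> \<psi> w0" using w0(3) isCont_tendsto_compose by blast
      moreover have "(\<lambda>n. \<psi> ((w \<circ> t) n)) \<longlonglongrightarrow> z"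
        using LIMSEQ_subseq_LIMSEQ[OF s(2) w0(2)] by (simp add: o_def w(1))
      ultimately have z\<psi>: "z = \<psi> w0" using LIMSEQ_unique by blast
      show ?thesis
      proof (cases "x < Re w0")
        case True
        then show ?thesis using z\<psi> by (auto simp: \<Omega>_def)
      next
        case False
        then have "w0 \<in> cbox (Complex x 0) (Complex x L)" using w0(1) w0H(2) by (auto simp: in_cbox_complex_iff)
        then have "z \<in> Q" using z\<psi> by (simp add: Q_def)
        then show ?thesis using r[of z] z(2) by (auto simp: E_def r'_def)
      qed
    qed
    have "closedin (top_of_set E) (E \<inter> \<Omega>)"
    proof -
      have "E \<inter> \<Omega> = E \<inter> closure \<Omega>"
      proof (intro equalityI subsetI)
        fix z assume "z \<in> E \<inter> \<Omega>"
        then show "z \<in> E \<inter> closure \<Omega>" by (auto intro: closure_subset[THEN subsetD])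
      next
        fix z assume "z \<in> E \<inter> closure \<Omega>"
        then show "z \<in> E \<inter> \<Omega>" using cl by blast
      qed
      then show ?thesis using closedin_closed_Int[OF closed_closure, of E \<Omega>] by simp
    qed
    moreover have "openin (top_of_set E) (E \<inter> \<Omega>)" using \<open>open \<Omega>\<close> by (rule openin_open_Int)
    moreover have "connected E" unfolding E_def by (intro connected_complement_bounded_convex) auto
    moreover have "E \<inter> \<Omega> \<noteq> {}"
    proof
      assume "E \<inter> \<Omega> = {}"
      then have sub: "\<Omega> \<subseteq> cball 0 r'" by (auto simp: E_def)
      obtain B where B: "\<And>z. norm z \<le> r' \<Longrightarrow> norm (f z) \<le> B"
        using entire_bounded_on_cball[OF f_holo] by metis
      \<comment> \<open>Makes |f| at \<psi> y larger than its bound B on the disc.\<close>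
      define y where "y = max (x + 1) (ln (B + 1))"
      have B0: "0 \<le> B" using B[of 0] by (smt (verit) norm_ge_zero r'_def norm_zero max.cobounded2)
      have "complex_of_real y \<in> {\<omega>. x < Re \<omega>}" by (simp add: y_def)
      then have "\<psi> (of_real y) \<in> \<Omega>" unfolding \<Omega>_def by blast
      then have "norm (f (\<psi> (of_real y))) \<le> B" using sub B by (auto simp: subset_eq)
      moreover have "norm (f (\<psi> (of_real y))) = exp y" using x by (simp add: f\<psi> mem_H y_def)
      moreover have "B + 1 \<le> exp y"
      proof -
        have "exp (ln (B + 1)) \<le> exp y" unfolding y_def by simp
        then show ?thesis using B0 by simp
      qed
      ultimately show False by simp
    qed
    ultimately have "E \<inter> \<Omega> = E" unfolding connected_clopen by blast
    then have sub: "E \<subseteq> \<Omega>" by blast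
    have "exp x < norm (f z)" if "r' < norm z" for z
    proof -
      have "z \<in> E" using that by (simp add: E_def)
      then obtain \<omega> where w: "z = \<psi> \<omega>" "x < Re \<omega>" using sub by (auto simp: \<Omega>_def)
      then show ?thesis using x by (simp add: f\<psi> mem_H)
    qed
    then show ?thesis by blast
  qed
  have "filterlim f at_infinity at_infinity"
    unfolding filterlim_at_infinity[OF order_refl]
  proof (intro allI impI)
    fix B :: real assume "0 < B"
    define x where "x = max (\<rho> + 1) (ln B)"
    have "\<rho> < x" by (simp add: x_def)
    from big[OF this] obtain r where r: "\<And>z. r < norm z \<Longrightarrow> exp x < norm (f z)" by blast
    have "exp (ln B) \<le> exp x" by (simp add: x_def)
    then have Bx: "B \<le> exp x" using \<open>0 < B\<close> by simp
    show "\<forall>\<^sub>F z in at_infinity. B \<le> norm (f z)"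
      unfolding eventually_at_infinity
    proof (intro exI[of _ "r + 1"] allI impI)
      fix z :: complex assume "r + 1 \<le> norm z"
      then have "exp x < norm (f z)" by (intro r) simp
      then show "B \<le> norm (f z)" using Bx by linarith
    qed
  qed
  then show False using not_pole by blast
qed

text \<open>A coincidence modulo a period spreads to all of H by \<open>branch_unique\<close>:
  translating the argument by a period m would change \<phi> only by a constant period, and non-zero
  m is excluded by \<open>branch_not_periodic\<close>. In particular \<phi>(H) is disjoint from its
  translates by non-zero periods.\<close>

lemma branch_inj:
  assumes \<phi>: "branch \<phi>" and w: "\<omega> \<in> H" "\<omega>' \<in> H" and eq: "\<phi> \<omega> = \<phi> \<omega>' + per j"
  shows "\<omega> = \<omega>'"
proof -
  have "exp \<omega> = exp \<omega>'" using branchD(2)[OF \<phi>] w eq by (metis F_def exp_add_per)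
  then obtain m where m: "\<omega> = \<omega>' + per m" by (rule exp_eq_perE)
  have same: "\<phi> \<nu> = \<phi> (\<nu> - per m) + per j" if "\<nu> \<in> H" for \<nu>
    by (rule branch_unique[OF \<phi> branch_shift[OF \<phi>] w(1) _ that]) (simp add: m eq[unfolded m])
  show ?thesis
  proof (rule ccontr)
    assume "\<omega> \<noteq> \<omega>'"
    then consider "0 < m" | "0 < - m" using m by fastforce
    then show False
    proof cases
      case 1
      have "exp (\<phi> (\<nu> + per m)) = exp (\<phi> \<nu>)" if "\<nu> \<in> H" for \<nu>
        using same[of "\<nu> + per m"] that by simp
      then show False using branch_not_periodic[OF \<phi> 1] by blast
    next
      case 2
      have "exp (\<phi> (\<nu> + per (- m))) = exp (\<phi> \<nu>)" if "\<nu> \<in> H" for \<nu>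
        using same[of "\<nu>"] that by (simp add: per_minus)
      then show False using branch_not_periodic[OF \<phi> 2] by blast
    qed
  qed
qed

text \<open>The image of a branch contains no disc of radius \<open>4 > \<pi>\<close>, so Bloch's theorem bounds the derivative.\<close>

lemma branch_deriv_bound:
  assumes \<phi>: "branch \<phi>" and w: "\<omega> \<in> H"
  shows "norm (deriv \<phi> \<omega>) \<le> 48 / (Re \<omega> - \<rho>)"
proof (rule ccontr)
  define r where "r = Re \<omega> - \<rho>"
  have r: "0 < r" using w by (simp add: r_def mem_H)
  assume "\<not> ?thesis"
  then have "48 / r < norm (deriv \<phi> \<omega>)" by (simp add: r_def)
  then have big: "4 \<le> r * norm (deriv \<phi> \<omega>) / 12" using r by (simp add: field_simps)
  have sub: "ball \<omega> r \<subseteq> H"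
  proof
    fix y assume "y \<in> ball \<omega> r"
    then have "\<bar>Re (\<omega> - y)\<bar> < r" using abs_Re_le_cmod[of "\<omega> - y"] by (simp add: dist_norm)
    then show "y \<in> H" by (simp add: mem_H r_def)
  qed
  obtain b where b: "ball b 4 \<subseteq> \<phi> ` ball \<omega> r"
    using Bloch[OF holomorphic_on_subset[OF branchD(1)[OF \<phi>] sub] r big] by blast
  have "dist b (b - of_real pi * \<i>) = pi" "dist b (b + of_real pi * \<i>) = pi"
    by (simp_all add: dist_norm norm_mult)
  then have "b - of_real pi * \<i> \<in> ball b 4" "b + of_real pi * \<i> \<in> ball b 4" using pi_less_4 by simp_all
  then have "b - of_real pi * \<i> \<in> \<phi> ` ball \<omega> r" "b + of_real pi * \<i> \<in> \<phi> ` ball \<omega> r"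
    using b by blast+
  then obtain y y' where y: "y \<in> ball \<omega> r" "\<phi> y = b - of_real pi * \<i>" "y' \<in> ball \<omega> r" "\<phi> y' = b + of_real pi * \<i>"
    by (elim imageE) simp
  have eq: "\<phi> y' = \<phi> y + per 1" using y by (simp add: per_def complex_eq_iff)
  have "y' \<in> H" "y \<in> H" using sub y by blast+
  from branch_inj[OF \<phi> this eq] eq show False by simp
qed

lemma branch_Lipschitz:
  assumes \<phi>: "branch \<phi>" and d: "0 < d" and "\<rho> + d \<le> Re x" "\<rho> + d \<le> Re y"
  shows "norm (\<phi> x - \<phi> y) \<le> 48 / d * norm (x - y)"
proof (rule field_differentiable_bound[of "{\<omega>. \<rho> + d \<le> Re \<omega>}" \<phi> "deriv \<phi>"])
  show "convex {\<omega>. \<rho> + d \<le> Re \<omega>}" using convex_halfspace_Re_ge[of "\<rho> + d"] by simp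
  fix z assume z: "z \<in> {\<omega>. \<rho> + d \<le> Re \<omega>}"
  then have zH: "z \<in> H" using d by (simp add: mem_H)
  show "(\<phi> has_field_derivative deriv \<phi> z) (at z within {\<omega>. \<rho> + d \<le> Re \<omega>})"
    using holomorphic_derivI[OF branchD(1)[OF \<phi>] open_H zH] .
  have "norm (deriv \<phi> z) \<le> 48 / (Re z - \<rho>)" by (rule branch_deriv_bound[OF \<phi> zH])
  also have "\<dots> \<le> 48 / d" using z d by (intro divide_left_mono) auto
  finally show "norm (deriv \<phi> z) \<le> 48 / d" .
qed (use assms in auto)

text \<open>The values \<phi> k (w k) accumulate at some \<zeta> with |F \<zeta>| > R, and a branch
  \<psi> passes through \<zeta>. Since F is injective near \<zeta>, the late branches do not merely
  approach \<psi>: they equal it after a translation of the argument by a period.\<close>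

lemma branch_compactness:
  assumes \<phi>: "\<And>k::nat. branch (\<phi> k)" and w: "\<And>k. x \<le> Re (w k)" and x: "\<rho> < x"
    and bd: "\<And>k. norm (\<phi> k (w k)) \<le> B"
  obtains r \<psi> m w0 where "strict_mono r" "branch \<psi>" "w0 \<in> H"
    "\<And>k \<omega>. \<omega> \<in> H \<Longrightarrow> \<phi> (r k) \<omega> = \<psi> (\<omega> - per (m k))" "(\<lambda>k. w (r k) - per (m k)) \<longlonglongrightarrow> w0"
proof -
  have wH: "w k \<in> H" for k using w[of k] x by (simp add: mem_H)
  have "\<forall>k. \<phi> k (w k) \<in> cball 0 B" using bd by simp
  then obtain \<zeta> s where s: "strict_mono s" "((\<lambda>k. \<phi> k (w k)) \<circ> s) \<longlonglongrightarrow> \<zeta>"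
    using seq_compactE[OF compact_imp_seq_compact[OF compact_cball], of "\<lambda>k. \<phi> k (w k)" 0 B] by blast
  have Flim: "(\<lambda>k. exp (w (s k))) \<longlonglongrightarrow> F \<zeta>"
    using isCont_tendsto_compose[OF isCont_F s(2)] by (simp add: branchD(2)[OF \<phi> wH] o_def)
  have ge: "exp x \<le> norm (exp (w (s k)))" for k using w by simp
  have "exp x \<le> norm (F \<zeta>)"
    by (rule tendsto_lowerbound[OF tendsto_norm[OF Flim]]) (use ge in auto)
  then have F\<zeta>: "F \<zeta> \<noteq> 0" "exp x \<le> norm (F \<zeta>)" by (auto simp: not_le[symmetric])
  define w0 where "w0 = Ln (F \<zeta>)"
  have w0: "exp w0 = F \<zeta>" using F\<zeta> by (simp add: w0_def)
  have "exp x \<le> exp (Re w0)" using F\<zeta>(2) w0[symmetric] by simp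
  then have w0H: "w0 \<in> H" using x by (simp add: mem_H)
  obtain \<psi> where \<psi>: "branch \<psi>" "\<psi> w0 = \<zeta>" using branch_exists[OF w0H w0[symmetric]] by blast
  \<comment> \<open>The logarithms of \<open>exp (w (s k))\<close> that converge to w0; the w
    themselves may differ from them by unbounded periods.\<close>
  define v where "v k = w0 + Ln (exp (w (s k)) / F \<zeta>)" for k
  have vexp: "exp (v k) = exp (w (s k))" for k
    using F\<zeta>(1) w0 by (simp add: v_def exp_add)
  have "(\<lambda>k. exp (w (s k)) / F \<zeta>) \<longlonglongrightarrow> F \<zeta> / F \<zeta>" by (intro tendsto_divide Flim tendsto_const F\<zeta>(1))
  then have "(\<lambda>k. exp (w (s k)) / F \<zeta>) \<longlonglongrightarrow> 1" using F\<zeta>(1) by simp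
  then have "(\<lambda>k. Ln (exp (w (s k)) / F \<zeta>)) \<longlonglongrightarrow> Ln 1" by (intro tendsto_Ln) auto
  then have vlim: "v \<longlonglongrightarrow> w0" unfolding v_def using tendsto_add[OF tendsto_const] by fastforce
  have vH: "v k \<in> H" for k
  proof -
    have "exp (Re (v k)) = exp (Re (w (s k)))" using arg_cong[OF vexp[of k], of norm] by simp
    then show ?thesis using wH[of "s k"] by (simp add: mem_H)
  qed
  have "\<forall>k. \<exists>m. w (s k) = v k + per m" using exp_eq_perE[OF vexp[symmetric]] by metis
  then obtain m where m: "\<And>k. w (s k) = v k + per (m k)" by metis
  have \<psi>lim: "(\<lambda>k. \<psi> (v k)) \<longlonglongrightarrow> \<zeta>" using isCont_tendsto_compose[OF isCont_branch[OF \<psi>(1) w0H] vlim] \<psi>(2) by simp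
  have "deriv F \<zeta> \<noteq> 0" using branch_regular[OF \<psi>(1) w0H] \<psi>(2) by simp
  then obtain e where e: "0 < e" "inj_on F (ball \<zeta> e)" using locally_injective_at[OF F_holo] by blast
  have "\<forall>\<^sub>F k in sequentially. \<psi> (v k) \<in> ball \<zeta> e \<and> \<phi> (s k) (w (s k)) \<in> ball \<zeta> e"
    using topological_tendstoD[OF \<psi>lim open_ball, of \<zeta> e] topological_tendstoD[OF s(2) open_ball, of \<zeta> e] e(1)
    by (auto intro: eventually_conj simp: o_def)
  then obtain N where N: "\<And>k. N \<le> k \<Longrightarrow> \<psi> (v k) \<in> ball \<zeta> e \<and> \<phi> (s k) (w (s k)) \<in> ball \<zeta> e"
    unfolding eventually_sequentially by blast
  have same: "\<phi> (s k) \<omega> = \<psi> (\<omega> - per (m k))" if "N \<le> k" "\<omega> \<in> H" for k \<omega>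
  proof -
    have "F (\<psi> (v k)) = F (\<phi> (s k) (w (s k)))"
      using branchD(2)[OF \<psi>(1) vH] branchD(2)[OF \<phi> wH] vexp by simp
    then have "\<psi> (v k) = \<phi> (s k) (w (s k))" using inj_onD[OF e(2)] N[OF that(1)] by blast
    then show ?thesis
      using branch_unique[OF \<phi> branch_shift[OF \<psi>(1), of "m k" 0] wH[of "s k"] _ that(2)] m[of k] by simp
  qed
  show thesis
  proof (rule that[of "\<lambda>k. s (k + N)" \<psi> w0 "\<lambda>k. m (k + N)"])
    show "strict_mono (\<lambda>k. s (k + N))" using s(1) by (simp add: strict_mono_def)
    show "(\<lambda>k. w (s (k + N)) - per (m (k + N))) \<longlonglongrightarrow> w0"
      using LIMSEQ_ignore_initial_segment[OF vlim, of N] by (simp add: m)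
  qed (use \<psi>(1) w0H same in auto)
qed

end

section \<open>Tracts of functions of finite order\<close>

lemma log_difference_const:
  fixes p q :: "'a::topological_space \<Rightarrow> complex"
  assumes "connected S" "continuous_on S p" "continuous_on S q" "\<And>x. x \<in> S \<Longrightarrow> exp (p x) = exp (q x)"
    and "x \<in> S" "y \<in> S"
  shows "p x - q x = p y - q y"
proof -
  have "p x = q x + (p y - q y)"
  proof (rule lift_unique[OF _ assms(1,2), of exp "\<lambda>x. q x + (p y - q y)" y])
    show "continuous_on S (\<lambda>x. q x + (p y - q y))" by (intro continuous_intros assms)
    show "exp (p u) = exp (q u + (p y - q y))" if "u \<in> S" for u
      using assms(4)[OF that] assms(4)[OF assms(6)] by (simp add: exp_add exp_diff)
  qed (use assms in \<open>auto intro!: holomorphic_on_exp simp: DERIV_imp_deriv[OF DERIV_exp]\<close>)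
  then show ?thesis by simp
qed

text \<open>Logarithms cut along the negative and the positive imaginary axis; they differ by \<open>2\<pi>i\<close>
  on the left half plane only.\<close>

definition Ln_neg :: "complex \<Rightarrow> complex" where "Ln_neg z = Ln (- \<i> * z) + \<i> * complex_of_real (pi / 2)"
definition Ln_pos :: "complex \<Rightarrow> complex" where "Ln_pos z = Ln (\<i> * z) - \<i> * complex_of_real (pi / 2)"

lemma exp_Ln_neg: "z \<noteq> 0 \<Longrightarrow> exp (Ln_neg z) = z" and exp_Ln_pos: "z \<noteq> 0 \<Longrightarrow> exp (Ln_pos z) = z"
proof -
  have e: "exp (\<i> * complex_of_real (pi / 2)) = \<i>"
    using cis_conv_exp[of "pi / 2"] cis_pi_half by simp
  have "- \<i> * z * \<i> = z" "\<i> * z / \<i> = z" by (simp_all add: complex_eq_iff)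
  then show "z \<noteq> 0 \<Longrightarrow> exp (Ln_neg z) = z" "z \<noteq> 0 \<Longrightarrow> exp (Ln_pos z) = z"
    unfolding Ln_neg_def Ln_pos_def exp_add exp_diff e by (simp_all only: exp_Ln mult_eq_0_iff
        complex_i_not_zero neg_equal_0_iff_equal simp_thms)
qed

lemma Im_Ln_bounds:
  assumes "Im w \<noteq> 0"
  shows "0 < Im w \<Longrightarrow> 0 < Im (Ln w) \<and> Im (Ln w) < pi" "Im w < 0 \<Longrightarrow> - pi < Im (Ln w) \<and> Im (Ln w) < 0"
proof -
  have w: "w \<noteq> 0" using assms by auto
  show "0 < Im w \<Longrightarrow> 0 < Im (Ln w) \<and> Im (Ln w) < pi" using Im_Ln_pos_lt[OF w] by simp
  show "Im w < 0 \<Longrightarrow> - pi < Im (Ln w) \<and> Im (Ln w) < 0"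
    using Im_Ln_pos_le[OF w] mpi_less_Im_Ln[OF w] Im_Ln_le_pi[OF w] by auto
qed

lemma Im_Ln_neg_pos:
  shows "0 < Re z \<Longrightarrow> Im (Ln_neg z - Ln_pos z) < pi" "Re z < 0 \<Longrightarrow> pi < Im (Ln_neg z - Ln_pos z)"
proof -
  assume z: "0 < Re z"
  have "Im (Ln (- \<i> * z)) < 0" using Im_Ln_bounds(2)[of "- \<i> * z"] z by simp
  moreover have "0 < Im (Ln (\<i> * z))" using Im_Ln_bounds(1)[of "\<i> * z"] z by simp
  ultimately show "Im (Ln_neg z - Ln_pos z) < pi" by (simp add: Ln_neg_def Ln_pos_def)
next
  assume z: "Re z < 0"
  have "0 < Im (Ln (- \<i> * z))" using Im_Ln_bounds(1)[of "- \<i> * z"] z by simp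
  moreover have "Im (Ln (\<i> * z)) < 0" using Im_Ln_bounds(2)[of "\<i> * z"] z by simp
  ultimately show "pi < Im (Ln_neg z - Ln_pos z)" by (simp add: Ln_neg_def Ln_pos_def)
qed

lemma continuous_on_Ln_neg:
  assumes "continuous_on S v" "\<And>x. x \<in> S \<Longrightarrow> Re (v x) = 0 \<Longrightarrow> 0 < Im (v x)"
  shows "continuous_on S (\<lambda>x. Ln_neg (v x))"
  unfolding Ln_neg_def
  by (intro continuous_intros assms(1)) (use assms(2) in \<open>force simp: complex_nonpos_Reals_iff\<close>)

lemma continuous_on_Ln_pos:
  assumes "continuous_on S v" "\<And>x. x \<in> S \<Longrightarrow> Re (v x) = 0 \<Longrightarrow> Im (v x) < 0"
  shows "continuous_on S (\<lambda>x. Ln_pos (v x))"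
  unfolding Ln_pos_def
  by (intro continuous_intros assms(1)) (use assms(2) in \<open>force simp: complex_nonpos_Reals_iff\<close>)

text \<open>If the start of \<open>P\<close> lay above the translated curve \<open>\<gamma> + id\<close>, then the argument of
  \<open>P(s) - \<gamma>(u) - id\<close> would increase by \<open>2\<pi>\<close> around the boundary of a rectangle of parameters on
  which this difference has no zero.\<close>

lemma curve_below_translate:
  fixes P \<gamma> :: "real \<Rightarrow> complex" and d :: real
  assumes contP: "continuous_on {0..} P" and cont\<gamma>: "continuous_on {0..} \<gamma>"
    and lim: "filterlim (\<lambda>u. Re (\<gamma> u)) at_top at_top"
    and disj: "\<And>s u. 0 \<le> s \<Longrightarrow> 0 \<le> u \<Longrightarrow> P s \<noteq> \<gamma> u + \<i> * d"
    and start: "Re (\<gamma> 0) < Re (P 0)"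
    and join: "0 \<le> s1" "\<And>u. 0 \<le> u \<Longrightarrow> P (s1 + u) = \<gamma> u"
    and low: "\<And>s. 0 \<le> s \<Longrightarrow> Re (P s) = Re (\<gamma> 0) \<Longrightarrow> Im (P s) < Im (\<gamma> 0) + d"
    and d: "0 < d"
  shows "\<exists>u\<ge>0. Re (\<gamma> u) = Re (P 0) \<and> Im (P 0) \<le> Im (\<gamma> u) + d"
proof (rule ccontr)
  assume "\<not> ?thesis"
  then have high: "Im (\<gamma> u) + d < Im (P 0)" if "0 \<le> u" "Re (\<gamma> u) = Re (P 0)" for u
    using that by fastforce
  define X where "X = Re (\<gamma> 0) + 1"
  obtain N where N: "\<And>u. N \<le> u \<Longrightarrow> X + 1 \<le> Re (\<gamma> u)"
    using lim unfolding filterlim_at_top eventually_at_top_linorder by blast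
  \<comment> \<open>V collects the points of \<gamma> on the line Re = X. The rectangle ends where P
    passes the lowest of them, so that on its right edge all points of the translate with the same
    real part lie above P.\<close>
  define V where "V = {u \<in> {0..max N 0}. Re (\<gamma> u) = X}"
  have contR: "continuous_on {0..max N 0} (\<lambda>u. Re (\<gamma> u))"
    by (intro continuous_intros continuous_on_subset[OF cont\<gamma>]) auto
  have Vne: "V \<noteq> {}"
  proof -
    have "\<exists>u. 0 \<le> u \<and> u \<le> max N 0 \<and> Re (\<gamma> u) = X"
      by (rule IVT'[OF _ _ _ contR]) (use N[of "max N 0"] in \<open>auto simp: X_def\<close>)
    then show ?thesis by (auto simp: V_def)
  qed
  have "compact V"
  proof -
    have "V = {0..max N 0} \<inter> (\<lambda>u. Re (\<gamma> u)) -` {X}" by (auto simp: V_def)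
    moreover have "closed ({0..max N 0} \<inter> (\<lambda>u. Re (\<gamma> u)) -` {X})"
      by (rule continuous_closed_preimage[OF contR]) auto
    moreover have "bounded V" by (rule bounded_subset[of "{0..max N 0}"]) (auto simp: V_def)
    ultimately show ?thesis by (simp add: compact_eq_bounded_closed)
  qed
  moreover have "continuous_on V (\<lambda>u. Im (\<gamma> u))"
    by (intro continuous_intros continuous_on_subset[OF cont\<gamma>]) (auto simp: V_def)
  ultimately obtain w0 where w0: "w0 \<in> V" "\<And>u. u \<in> V \<Longrightarrow> Im (\<gamma> w0) \<le> Im (\<gamma> u)"
    using continuous_attains_inf[OF _ Vne] by metis
  have w0': "0 \<le> w0" "Re (\<gamma> w0) = X" using w0(1) by (auto simp: V_def)
  have lowest: "Im (\<gamma> w0) \<le> Im (\<gamma> u)" if "0 \<le> u" "Re (\<gamma> u) = X" for u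
  proof (rule w0(2))
    have "u \<le> N" using N[of u] that(2) by fastforce
    then show "u \<in> V" using that by (simp add: V_def)
  qed
  define S where "S = s1 + w0"
  have S: "0 \<le> S" "P S = \<gamma> w0" using join w0'(1) by (auto simp: S_def)
  have "compact ((\<lambda>s. Re (P s)) ` {0..S})"
    by (intro compact_continuous_image continuous_intros continuous_on_subset[OF contP]) auto
  then obtain B where B: "\<And>s. 0 \<le> s \<Longrightarrow> s \<le> S \<Longrightarrow> \<bar>Re (P s)\<bar> \<le> B"
    using compact_imp_bounded by (fastforce simp: bounded_iff)
  obtain U' where U': "\<And>u. U' \<le> u \<Longrightarrow> B + 1 \<le> Re (\<gamma> u)"
    using lim unfolding filterlim_at_top eventually_at_top_linorder by blast
  \<comment> \<open>Far enough for \<gamma> U to lie to the right of P on all of [0, S]: on the top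
    edge the difference has negative real part.\<close>
  define U where "U = max U' 0"
  have U: "0 \<le> U" "B < Re (\<gamma> U)" using U'[of U] by (auto simp: U_def)
  define v where "v x = P (fst x) - \<gamma> (snd x) - \<i> * d" for x :: "real \<times> real"
  define Q where "Q = {0..S} \<times> {0..U}"
  have contv: "continuous_on Q v"
    unfolding v_def Q_def
    by (intro continuous_intros continuous_on_compose2[OF contP] continuous_on_compose2[OF cont\<gamma>]) auto
  have vnz: "v x \<noteq> 0" if "x \<in> Q" for x
    using disj[of "fst x" "snd x"] that by (auto simp: v_def Q_def algebra_simps)
  have "contractible Q" unfolding Q_def by (intro convex_imp_contractible convex_Times) auto
  then obtain L where L: "continuous_on Q L" "\<And>x. x \<in> Q \<Longrightarrow> v x = exp (L x)"
    using continuous_logarithm_on_contractible[OF contv] vnz by metis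
  \<comment> \<open>The two halves of the boundary from (0, 0) to (S, U). On T1 the difference
    avoids the negative imaginary axis, on T2 the positive one (\<open>A\<close>,
    \<open>A'\<close>), so each half has its own continuous logarithm.\<close>
  define T1 where "T1 = {0} \<times> {0..U} \<union> {0..S} \<times> {U}"
  define T2 where "T2 = {0..S} \<times> {0} \<union> {S} \<times> {0..U}"
  have T: "T1 \<subseteq> Q" "T2 \<subseteq> Q" using S(1) U(1) by (auto simp: T1_def T2_def Q_def)
  have corners: "(0, 0) \<in> T1" "(S, U) \<in> T1" "(0, 0) \<in> T2" "(S, U) \<in> T2"
    using S(1) U(1) by (auto simp: T1_def T2_def)
  have con1: "connected T1" unfolding T1_def
  proof (rule connected_Un)
    have "(0, U) \<in> {0} \<times> {0..U} \<inter> {0..S} \<times> {U}" using S(1) U(1) by simp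
    then show "{0} \<times> {0..U} \<inter> {0..S} \<times> {U} \<noteq> {}" by blast
  qed (simp_all add: connected_Times)
  have con2: "connected T2" unfolding T2_def
  proof (rule connected_Un)
    have "(S, 0) \<in> {0..S} \<times> {0} \<inter> {S} \<times> {0..U}" using S(1) U(1) by simp
    then show "{0..S} \<times> {0} \<inter> {S} \<times> {0..U} \<noteq> {}" by blast
  qed (simp_all add: connected_Times)
  have A: "0 < Im (v x)" if "x \<in> T1" "Re (v x) = 0" for x
  proof -
    obtain s u where x: "x = (s, u)" by force
    have "s = 0 \<and> 0 \<le> u \<or> 0 \<le> s \<and> s \<le> S \<and> u = U" using that(1) x by (auto simp: T1_def)
    then consider "s = 0" "0 \<le> u" | "0 \<le> s" "s \<le> S" "u = U" by blast
    then show ?thesis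
    proof cases
      case 1
      then show ?thesis using high[of u] that(2) x by (simp add: v_def)
    next
      case 2
      then show ?thesis using B[of s] U(2) that(2) x by (simp add: v_def)
    qed
  qed
  have A': "Im (v x) < 0" if "x \<in> T2" "Re (v x) = 0" for x
  proof -
    obtain s u where x: "x = (s, u)" by force
    have "0 \<le> s \<and> u = 0 \<or> s = S \<and> 0 \<le> u" using that(1) x by (auto simp: T2_def)
    then consider "0 \<le> s" "u = 0" | "s = S" "0 \<le> u" by blast
    then show ?thesis
    proof cases
      case 1
      then show ?thesis using low[of s] that(2) x by (simp add: v_def)
    next
      case 2
      then show ?thesis using lowest[of u] that(2) x d S(2) w0'(2) by (simp add: v_def)
    qed
  qed
  have cn: "continuous_on T1 (\<lambda>x. Ln_neg (v x))"
    by (rule continuous_on_Ln_neg[OF continuous_on_subset[OF contv T(1)]]) (rule A)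
  have cp: "continuous_on T2 (\<lambda>x. Ln_pos (v x))"
    by (rule continuous_on_Ln_pos[OF continuous_on_subset[OF contv T(2)]]) (rule A')
  have en: "exp (L x) = exp (Ln_neg (v x))" if "x \<in> T1" for x
    using exp_Ln_neg[OF vnz] L(2) T(1) that by (metis subsetD)
  have ep: "exp (L x) = exp (Ln_pos (v x))" if "x \<in> T2" for x
    using exp_Ln_pos[OF vnz] L(2) T(2) that by (metis subsetD)
  have "L (0, 0) - Ln_neg (v (0, 0)) = L (S, U) - Ln_neg (v (S, U))"
    by (rule log_difference_const[OF con1 continuous_on_subset[OF L(1) T(1)] cn en corners(1,2)])
  moreover have "L (0, 0) - Ln_pos (v (0, 0)) = L (S, U) - Ln_pos (v (S, U))"
    by (rule log_difference_const[OF con2 continuous_on_subset[OF L(1) T(2)] cp ep corners(3,4)])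
  ultimately have "(L (0, 0) - Ln_pos (v (0, 0))) - (L (0, 0) - Ln_neg (v (0, 0))) =
      (L (S, U) - Ln_pos (v (S, U))) - (L (S, U) - Ln_neg (v (S, U)))"
    by (simp only:)
  then have "Ln_neg (v (0, 0)) - Ln_pos (v (0, 0)) = Ln_neg (v (S, U)) - Ln_pos (v (S, U))"
    by (simp add: algebra_simps)
  moreover have "0 < Re (v (0, 0))" using start by (simp add: v_def)
  moreover have "Re (v (S, U)) < 0" using B[of S] S(1) U(2) by (simp add: v_def)
  \<comment> \<open>L differs from each logarithm by a constant, so \<open>Ln_neg\<close> minus
    \<open>Ln_pos\<close> would be the same at both corners; but its imaginary part is below \<pi>
    at (0, 0) and above \<pi> at (S, U).\<close>
  ultimately show False using Im_Ln_neg_pos by (metis less_asym)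
qed

section \<open>Tracts of a finite-order function lie in sectors\<close>

lemma finite_orderE:
  assumes "finite_order h"
  obtains A r where "0 < A" "1 \<le> r" "\<And>z. r \<le> norm z \<Longrightarrow> ln (ln (max (exp 1) (norm (h z)))) \<le> A * ln (norm z)"
proof -
  obtain c where c: "0 < c" "\<forall>\<^sub>F z in at_infinity. norm (ln (ln (max (exp 1) (norm (h z))))) \<le> c * norm (ln (norm z))"
    using assms unfolding finite_order_def by (elim landau_o.bigE) blast
  then obtain b where b: "\<And>z. b \<le> norm z \<Longrightarrow> norm (ln (ln (max (exp 1) (norm (h z))))) \<le> c * norm (ln (norm z))"
    unfolding eventually_at_infinity by blast
  show thesis
  proof (rule that[of c "max b 1"])
    fix z :: complex assume z: "max b 1 \<le> norm z"
    then have "0 \<le> ln (norm z)" by (intro ln_ge_zero) simp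
    then show "ln (ln (max (exp 1) (norm (h z)))) \<le> c * ln (norm z)" using b[of z] z by simp
  qed (use c in auto)
qed

context log_map begin

text \<open>Shift the values into a bounded set by periods j and apply compactness. The shifted
  branches are translates of one \<psi>, and injectivity modulo periods forces all these
  translations to coincide. Hence the arguments, and with them the unshifted values, stay bounded
  along a subsequence.\<close>

lemma branch_Im_bounded:
  assumes \<phi>: "branch \<phi>" and x: "\<rho> < x"
  obtains B where "0 \<le> B" "\<And>\<omega>. x \<le> Re \<omega> \<Longrightarrow> Re (\<phi> \<omega>) \<le> y \<Longrightarrow> \<bar>Im (\<phi> \<omega>)\<bar> \<le> B"
proof (rule ccontr)
  assume H: "\<not> thesis"
  have "\<exists>\<omega>. x \<le> Re \<omega> \<and> Re (\<phi> \<omega>) \<le> y \<and> real k < \<bar>Im (\<phi> \<omega>)\<bar>" for k :: nat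
  proof (rule ccontr)
    assume "\<nexists>\<omega>. x \<le> Re \<omega> \<and> Re (\<phi> \<omega>) \<le> y \<and> real k < \<bar>Im (\<phi> \<omega>)\<bar>"
    then have "\<bar>Im (\<phi> \<omega>)\<bar> \<le> real k" if "x \<le> Re \<omega>" "Re (\<phi> \<omega>) \<le> y" for \<omega> using that by force
    then show False using H that[of "real k"] by simp
  qed
  then obtain w where w: "\<And>k. x \<le> Re (w k)" "\<And>k. Re (\<phi> (w k)) \<le> y" "\<And>k::nat. real k < \<bar>Im (\<phi> (w k))\<bar>"
    by metis
  have wH: "w k \<in> H" for k using w(1)[of k] x by (simp add: mem_H)
  define j where "j k = - \<lfloor>Im (\<phi> (w k)) / (2 * pi)\<rfloor>" for k
  have jb: "\<bar>Im (\<phi> (w k) + per (j k))\<bar> \<le> 2 * pi" for k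
  proof -
    have "0 \<le> Im (\<phi> (w k)) - of_int \<lfloor>Im (\<phi> (w k)) / (2 * pi)\<rfloor> * (2 * pi)"
      "Im (\<phi> (w k)) - of_int \<lfloor>Im (\<phi> (w k)) / (2 * pi)\<rfloor> * (2 * pi) < 2 * pi"
      using floor_divide_lower[of "2 * pi" "Im (\<phi> (w k))"] floor_divide_upper[of "2 * pi" "Im (\<phi> (w k))"]
      by (simp_all add: algebra_simps)
    then show ?thesis by (simp add: j_def algebra_simps)
  qed
  have br: "branch (\<lambda>\<omega>. \<phi> \<omega> + per (j k))" for k using branch_shift[OF \<phi>, of 0 "j k"] by simp
  have nb: "norm (\<phi> (w k) + per (j k)) \<le> \<bar>y\<bar> + 2 * pi" for k
  proof -
    have "norm (\<phi> (w k) + per (j k)) \<le> \<bar>Re (\<phi> (w k) + per (j k))\<bar> + \<bar>Im (\<phi> (w k) + per (j k))\<bar>"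
      by (rule cmod_le)
    moreover have "\<bar>Re (\<phi> (w k) + per (j k))\<bar> \<le> \<bar>y\<bar>"
      using w(2)[of k] branch_Re_pos[OF \<phi> wH[of k]] by simp
    ultimately show ?thesis using jb[of k] by linarith
  qed
  obtain r \<psi> m w0 where r: "strict_mono r" "branch \<psi>" "w0 \<in> H"
    "\<And>k \<omega>. \<omega> \<in> H \<Longrightarrow> \<phi> \<omega> + per (j (r k)) = \<psi> (\<omega> - per (m k))" "(\<lambda>k. w (r k) - per (m k)) \<longlonglongrightarrow> w0"
    by (rule branch_compactness[where \<phi> = "\<lambda>k \<omega>. \<phi> \<omega> + per (j k)" and w = w, OF br w(1) x nb]) blast
  have m0: "m k = m 0" for k
  proof -
    have "\<psi> (w 0 - per (m k)) = \<psi> (w 0 - per (m 0)) + per (j (r k) - j (r 0))"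
      using per_add[of "j (r k)" "- j (r 0)"] by (simp add: r(4)[OF wH, symmetric] per_minus)
    then have "w 0 - per (m k) = w 0 - per (m 0)" by (rule branch_inj[OF r(2), rotated 2]) (simp_all add: wH)
    then show ?thesis by simp
  qed
  have "(\<lambda>k. w (r k) - per (m 0)) \<longlonglongrightarrow> w0" using r(5) by (subst (asm) m0)
  then have "(\<lambda>k. w (r k) - per (m 0) + per (m 0)) \<longlonglongrightarrow> w0 + per (m 0)" by (intro tendsto_intros)
  then have "(\<lambda>k. w (r k)) \<longlonglongrightarrow> w0 + per (m 0)" by simp
  then have "(\<lambda>k. \<phi> (w (r k))) \<longlonglongrightarrow> \<phi> (w0 + per (m 0))"
    by (intro isCont_tendsto_compose[OF isCont_branch[OF \<phi>]]) (simp_all add: r(3))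
  then have "Bseq (\<lambda>k. \<phi> (w (r k)))" by (rule convergent_imp_Bseq[OF convergentI])
  then obtain B where B: "\<And>k. norm (\<phi> (w (r k))) \<le> B" unfolding Bseq_def by blast
  obtain k :: nat where k: "B < real k" using reals_Archimedean2 by blast
  have "real k \<le> real (r k)" using seq_suble[OF r(1)] by simp
  then show False using k B[of k] w(3)[of "r k"] abs_Im_le_cmod[of "\<phi> (w (r k))"] by linarith
qed

text \<open>Finite order bounds |f| from above, hence Re (\<phi> t) from below in terms of ln t;
  integrating the derivative bound controls |\<phi> t| from above. Together the two estimates put
  the image of the real axis into a sector.\<close>

lemma branch_real_growth:
  assumes fo: "finite_order f" and \<phi>: "branch \<phi>" and x0: "2 * \<rho> \<le> x0" "\<rho> < x0" "1 \<le> x0"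
  obtains A K where "0 < A" "0 \<le> K"
    "\<And>t. x0 \<le> t \<Longrightarrow> ln t \<le> A * Re (\<phi> (of_real t)) + K"
    "\<And>t. x0 \<le> t \<Longrightarrow> norm (\<phi> (of_real t)) \<le> 96 * ln t + K"
proof -
  obtain A r where A: "0 < A" "1 \<le> r" "\<And>z. r \<le> norm z \<Longrightarrow> ln (ln (max (exp 1) (norm (f z)))) \<le> A * ln (norm z)"
    using finite_orderE[OF fo] by blast
  obtain B where B: "0 \<le> B" "\<And>z. norm z \<le> r \<Longrightarrow> norm (f z) \<le> B" using entire_bounded_on_cball[OF f_holo] by metis
  \<comment> \<open>Covers the range where \<open>exp (\<phi> t)\<close> is too small for the order
    estimate, and the initial value at x0.\<close>
  define K where "K = ln (1 + B) + norm (\<phi> (of_real x0))"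
  have K: "0 \<le> ln (1 + B)" using B by (intro ln_ge_zero) simp
  have tH: "of_real t \<in> H" if "x0 \<le> t" for t :: real using that x0 by (simp add: mem_H)
  have ftn: "norm (f (exp (\<phi> (of_real t)))) = exp t" if "x0 \<le> t" for t
    using branchD(2)[OF \<phi> tH[OF that]] by (simp add: F_def)
  show thesis
  proof (rule that[OF A(1), of K])
    show "0 \<le> K" using K by (simp add: K_def)
    fix t assume t: "x0 \<le> t"
    show "ln t \<le> A * Re (\<phi> (of_real t)) + K"
    proof (cases "r \<le> norm (exp (\<phi> (of_real t)))")
      case True
      have "max (exp 1) (norm (f (exp (\<phi> (of_real t))))) = exp t" using ftn[OF t] t x0 by simp
      then have "ln t \<le> A * Re (\<phi> (of_real t))" using A(3)[OF True] by simp
      then show ?thesis using K by (simp add: K_def add_nonneg_nonneg order_trans)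
    next
      case False
      then have "exp t \<le> B" using B(2)[of "exp (\<phi> (of_real t))"] ftn[OF t] by simp
      moreover have "t \<le> exp t" using exp_ge_add_one_self[of t] by linarith
      ultimately have "ln t \<le> ln (1 + B)" using t x0 by simp
      moreover have "0 \<le> A * Re (\<phi> (of_real t))" using A(1) branch_Re_pos[OF \<phi> tH[OF t]] by simp
      ultimately show ?thesis using norm_ge_zero[of "\<phi> (of_real x0)"] unfolding K_def by linarith
    qed
    show "norm (\<phi> (of_real t)) \<le> 96 * ln t + K"
    proof -
      have "norm (\<phi> (of_real t) - \<phi> (of_real x0)) \<le> 96 * ln t - 96 * ln x0" if "x0 < t"
      proof (rule differentiable_bound_general[OF that, of "\<lambda>t. \<phi> (of_real t)" "\<lambda>t. 96 * ln t"
            "\<lambda>s. deriv \<phi> (of_real s)" "\<lambda>s. 96 / s"])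
        show "continuous_on {x0..t} (\<lambda>t. \<phi> (complex_of_real t))"
          by (rule continuous_on_compose2[OF branchD(3)[OF \<phi>]]) (use tH in \<open>auto intro!: continuous_intros\<close>)
        show "continuous_on {x0..t} (\<lambda>t. 96 * ln t)" using x0 by (intro continuous_intros) auto
        fix s assume s: "x0 < s" "s < t"
        have sH: "complex_of_real s \<in> H" using s by (intro tH) simp
        have "(\<phi> has_field_derivative deriv \<phi> (of_real s)) (at (of_real s))"
          by (rule holomorphic_derivI[OF branchD(1)[OF \<phi>] open_H sH])
        then show "((\<lambda>t. \<phi> (complex_of_real t)) has_vector_derivative deriv \<phi> (complex_of_real s)) (at s)"
          by (rule has_vector_derivative_real_field)
        show "((\<lambda>t. 96 * ln t) has_vector_derivative 96 / s) (at s)"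
          using s x0 by (auto intro!: derivative_eq_intros simp: has_real_derivative_iff_has_vector_derivative[symmetric])
        have "norm (deriv \<phi> (of_real s)) \<le> 48 / (s - \<rho>)" using branch_deriv_bound[OF \<phi> sH] by simp
        \<comment> \<open>s - \<rho> \<ge> s / 2, because s > x0 \<ge> 2 \<rho>.\<close>
        also have "\<dots> \<le> 96 / s" using s x0 by (simp add: field_simps)
        finally show "norm (deriv \<phi> (of_real s)) \<le> 96 / s" .
      qed
      moreover have "0 \<le> ln x0" using x0 by (intro ln_ge_zero)
      moreover have "0 \<le> ln t" using x0 t by (intro ln_ge_zero) simp
      moreover have "norm (\<phi> (of_real t)) \<le> norm (\<phi> (of_real t) - \<phi> (of_real x0)) + norm (\<phi> (of_real x0))"
        by (metis norm_triangle_sub add.commute)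
      ultimately show ?thesis using t K by (cases "x0 = t") (auto simp: K_def)
    qed
  qed
qed

text \<open>The image \<gamma> of the real axis lies in a sector. A point of the tract to the right
  of \<gamma> 0 is joined to \<gamma> by a path P inside the tract, which cannot meet translates of
  \<gamma> by non-zero periods. So its start is at most a fixed period above some point of \<gamma>
  with the same real part and, by conjugation, at most that far below one. The remaining points are
  covered by \<open>branch_Im_bounded\<close>.\<close>

lemma finite_order_slope:
  assumes fo: "finite_order f" and \<phi>: "branch \<phi>" and x: "\<rho> < x"
  obtains C where "0 \<le> C" "\<And>\<omega>. x < Re \<omega> \<Longrightarrow> \<bar>Im (\<phi> \<omega>)\<bar> \<le> C * (1 + Re (\<phi> \<omega>))"
proof -
  define x0 where "x0 = max (max x (2 * \<rho>)) 1 + 1"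
  have x0: "2 * \<rho> \<le> x0" "\<rho> < x0" "1 \<le> x0" "x < x0" using x by (auto simp: x0_def)
  obtain A K where AK: "0 < A" "0 \<le> K" "\<And>t. x0 \<le> t \<Longrightarrow> ln t \<le> A * Re (\<phi> (of_real t)) + K"
    "\<And>t. x0 \<le> t \<Longrightarrow> norm (\<phi> (of_real t)) \<le> 96 * ln t + K"
    using branch_real_growth[OF fo \<phi> x0(1-3)] by blast
  define \<gamma> where "\<gamma> u = \<phi> (of_real (x0 + u))" for u :: real
  define y where "y = Re (\<gamma> 0)"
  obtain B where B: "0 \<le> B" "\<And>\<omega>. x \<le> Re \<omega> \<Longrightarrow> Re (\<phi> \<omega>) \<le> y \<Longrightarrow> \<bar>Im (\<phi> \<omega>)\<bar> \<le> B"
    using branch_Im_bounded[OF \<phi> x] by metis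
  obtain k :: nat where k: "B + \<bar>Im (\<gamma> 0)\<bar> < real k" using reals_Archimedean2 by blast
  \<comment> \<open>A period so large that all points of the tract with real part y = Re (\<gamma>
    0), whose imaginary parts are bounded by B, lie between \<gamma> 0 - i d and \<gamma> 0 + i
    d.\<close>
  define d where "d = 2 * pi * real k"
  have dk: "real k \<le> d"
  proof -
    have "real k * 1 \<le> real k * (2 * pi)" using pi_gt3 by (intro mult_left_mono) auto
    then show ?thesis by (simp add: d_def mult.commute)
  qed
  have kpos: "0 < real k" using k B(1) by linarith
  then have d: "0 < d" by (simp add: d_def)
  have dper: "\<i> * complex_of_real d = per (int k)" by (simp add: d_def per_def)
  have H1: "\<omega> \<in> H" if "x < Re \<omega>" for \<omega> using that x by (simp add: mem_H)
  \<comment> \<open>|\<gamma>| \<le> 96 ln t + K and ln t \<le> A Re \<gamma> + K, hence 97 = 96 +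
    1.\<close>
  have \<gamma>Im: "\<bar>Im (\<gamma> u)\<bar> \<le> 96 * A * Re (\<gamma> u) + 97 * K" if "0 \<le> u" for u
    using AK(3)[of "x0 + u"] AK(4)[of "x0 + u"] abs_Im_le_cmod[of "\<gamma> u"] that by (simp add: \<gamma>_def)
  have cont\<gamma>: "continuous_on {0..} \<gamma>"
    unfolding \<gamma>_def using x0
    by (intro continuous_on_compose2[OF branchD(3)[OF \<phi>]] continuous_intros) (auto simp: mem_H)
  have lim\<gamma>: "filterlim (\<lambda>u. Re (\<gamma> u)) at_top at_top"
  proof -
    have "filterlim (\<lambda>u::real. x0 + u) at_top at_top"
      by (rule filterlim_tendsto_add_at_top[OF tendsto_const filterlim_ident])
    then have "filterlim (\<lambda>u. ln (x0 + u)) at_top at_top" using filterlim_compose[OF ln_at_top] by blast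
    then have "filterlim (\<lambda>u. - K + ln (x0 + u)) at_top at_top"
      by (rule filterlim_tendsto_add_at_top[OF tendsto_const])
    then have "filterlim (\<lambda>u. (1 / A) * (- K + ln (x0 + u))) at_top at_top"
      by (rule filterlim_tendsto_pos_mult_at_top[OF tendsto_const, rotated]) (use AK(1) in simp)
    then show ?thesis
    proof (rule filterlim_at_top_mono)
      show "\<forall>\<^sub>F u in at_top. (1 / A) * (- K + ln (x0 + u)) \<le> Re (\<gamma> u)"
        using eventually_ge_at_top[of 0]
      proof eventually_elim
        case (elim u)
        then show ?case using AK(3)[of "x0 + u"] AK(1) by (simp add: \<gamma>_def field_simps)
      qed
    qed
  qed
  define C where "C = B + (96 * A + 97 * K + d)"
  have bound: "\<bar>Im (\<phi> \<alpha>)\<bar> \<le> C * (1 + Re (\<phi> \<alpha>))" if \<alpha>: "x < Re \<alpha>" for \<alpha>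
  proof -
    have Rp: "0 < Re (\<phi> \<alpha>)" by (rule branch_Re_pos[OF \<phi> H1[OF \<alpha>]])
    have C': "0 \<le> 96 * A + 97 * K + d" using AK d by simp
    show ?thesis
    proof (cases "Re (\<phi> \<alpha>) \<le> y")
      case True
      then have "\<bar>Im (\<phi> \<alpha>)\<bar> \<le> B" using B(2) \<alpha> by simp
      also have "\<dots> \<le> C * 1" using C' by (simp add: C_def)
      also have "\<dots> \<le> C * (1 + Re (\<phi> \<alpha>))" using Rp B(1) C' by (intro mult_left_mono) (auto simp: C_def)
      finally show ?thesis .
    next
      case False
      define p where "p s = (if s \<le> 1 then (1 - of_real s) * \<alpha> + of_real s * of_real x0 else of_real (x0 + (s - 1)))" for s :: real
      define P where "P s = \<phi> (p s)" for s
      have px: "x < Re (p s)" if "0 \<le> s" for s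
      proof (cases "s \<le> 1")
        case True
        have "x = (1 - s) * x + s * x" by (simp add: algebra_simps)
        also have "\<dots> < (1 - s) * Re \<alpha> + s * x0"
        proof (cases "s = 1")
          case False
          then have "(1 - s) * x < (1 - s) * Re \<alpha>" using True \<alpha> by (intro mult_strict_left_mono) auto
          moreover have "s * x \<le> s * x0" using that x0(4) by (intro mult_left_mono) auto
          ultimately show ?thesis by simp
        qed (use x0 in simp)
        finally show ?thesis using True by (simp add: p_def)
      qed (use x0 in \<open>simp add: p_def\<close>)
      have contp: "continuous_on {0..} p"
        unfolding p_def by (intro continuous_on_cases_le continuous_intros) auto
      have contP: "continuous_on {0..} P"
        unfolding P_def by (rule continuous_on_compose2[OF branchD(3)[OF \<phi>] contp]) (use px H1 in auto)
      have P0: "P 0 = \<phi> \<alpha>" by (simp add: P_def p_def)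
      have join: "P (1 + u) = \<gamma> u" if "0 \<le> u" for u
        using that by (cases "u = 0") (auto simp: P_def p_def \<gamma>_def)
      have PB: "\<bar>Im (P s)\<bar> \<le> B" if "0 \<le> s" "Re (P s) = y" for s
        using B(2)[of "p s"] px[OF that(1)] that(2) by (simp add: P_def)
      have sep: "P s \<noteq> \<gamma> u + per j" if "0 \<le> s" "0 \<le> u" "j \<noteq> 0" for s u j
      proof
        assume eq: "P s = \<gamma> u + per j"
        have "p s \<in> H" "of_real (x0 + u) \<in> H" using px[OF that(1)] H1 x0 that(2) by (auto simp: mem_H)
        then have "p s = of_real (x0 + u)" using branch_inj[OF \<phi>] eq by (simp add: P_def \<gamma>_def)
        then show False using eq that(3) by (simp add: P_def \<gamma>_def)
      qed
      have Im0: "\<bar>Im (P s)\<bar> < d - \<bar>Im (\<gamma> 0)\<bar>" if "0 \<le> s" "Re (P s) = y" for s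
        using PB[OF that] k dk by linarith
      have kz: "int k \<noteq> 0" "- int k \<noteq> 0" using kpos by auto
      have "\<exists>u\<ge>0. Re (\<gamma> u) = Re (P 0) \<and> Im (P 0) \<le> Im (\<gamma> u) + d"
      proof (rule curve_below_translate[OF contP cont\<gamma> lim\<gamma> _ _ zero_le_one join _ d])
        show "P s \<noteq> \<gamma> u + \<i> * d" if "0 \<le> s" "0 \<le> u" for s u using sep[OF that kz(1)] dper by simp
        show "Re (\<gamma> 0) < Re (P 0)" using False by (simp add: P0 y_def)
        show "Im (P s) < Im (\<gamma> 0) + d" if "0 \<le> s" "Re (P s) = Re (\<gamma> 0)" for s
          using Im0[of s] that by (simp add: y_def)
      qed
      moreover have "\<exists>u\<ge>0. Re (cnj (\<gamma> u)) = Re (cnj (P 0)) \<and> Im (cnj (P 0)) \<le> Im (cnj (\<gamma> u)) + d"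
      proof (rule curve_below_translate[where P = "\<lambda>s. cnj (P s)" and \<gamma> = "\<lambda>u. cnj (\<gamma> u)", OF _ _ _ _ _ zero_le_one _ _ d])
        show "cnj (P s) \<noteq> cnj (\<gamma> u) + \<i> * d" if "0 \<le> s" "0 \<le> u" for s u
        proof
          assume "cnj (P s) = cnj (\<gamma> u) + \<i> * d"
          then have "P s = \<gamma> u + per (- int k)"
            using dper by (auto simp: complex_eq_iff d_def)
          then show False using sep[OF that kz(2)] by blast
        qed
        show "Re (cnj (\<gamma> 0)) < Re (cnj (P 0))" using False by (simp add: P0 y_def)
        show "Im (cnj (P s)) < Im (cnj (\<gamma> 0)) + d" if "0 \<le> s" "Re (cnj (P s)) = Re (cnj (\<gamma> 0))" for s
          using Im0[of s] that by (simp add: y_def)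
      qed (use lim\<gamma> join in \<open>auto intro!: continuous_intros contP cont\<gamma>\<close>)
      ultimately obtain u u' where u: "0 \<le> u" "Re (\<gamma> u) = Re (P 0)" "Im (P 0) \<le> Im (\<gamma> u) + d"
        "0 \<le> u'" "Re (\<gamma> u') = Re (P 0)" "- Im (P 0) \<le> - Im (\<gamma> u') + d" by auto
      have "\<bar>Im (\<phi> \<alpha>)\<bar> \<le> 96 * A * Re (\<phi> \<alpha>) + 97 * K + d"
        using u \<gamma>Im[OF u(1)] \<gamma>Im[OF u(4)] by (simp add: P0)
      also have "\<dots> \<le> C * (1 + Re (\<phi> \<alpha>))"
      proof -
        have "0 \<le> B * (1 + Re (\<phi> \<alpha>))" "0 \<le> 96 * A" "0 \<le> (97 * K + d) * Re (\<phi> \<alpha>)"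
          using B(1) AK d Rp by auto
        then show ?thesis unfolding C_def by (simp add: algebra_simps)
      qed
      finally show ?thesis .
    qed
  qed
  show thesis by (rule that[of C]) (use bound B AK d in \<open>auto simp: C_def\<close>)
qed

end

section \<open>The sector condition for compositions\<close>

lemma lifts_above_mono: "lifts_above f R \<Longrightarrow> R \<le> R' \<Longrightarrow> lifts_above f R'"
  using lifts_above_comp[OF lifts_above_id[of R'], of f R R'] by simp

lemma class_B_not_pole: "h \<in> class_B \<Longrightarrow> \<not> filterlim h at_infinity at_infinity"
  using tendsto_infinity_imp_poly[of h] by (auto simp: class_B_def transcendental_entire_def)

lemma comp_not_pole:
  fixes u h :: "complex \<Rightarrow> complex"
  assumes u: "u holomorphic_on UNIV" and h: "\<not> filterlim h at_infinity at_infinity"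
  shows "\<not> filterlim (u \<circ> h) at_infinity at_infinity"
proof
  assume lim: "filterlim (u \<circ> h) at_infinity at_infinity"
  have "filterlim h at_infinity at_infinity"
    unfolding filterlim_at_infinity[OF order_refl]
  proof (intro allI impI)
    fix B :: real assume "0 < B"
    obtain K where K: "0 \<le> K" "\<And>z. norm z \<le> B \<Longrightarrow> norm (u z) \<le> K" using entire_bounded_on_cball[OF u] by metis
    have "\<forall>\<^sub>F z in at_infinity. K + 1 \<le> norm ((u \<circ> h) z)"
      using lim K(1) unfolding filterlim_at_infinity[OF order_refl] by auto
    then show "\<forall>\<^sub>F z in at_infinity. B \<le> norm (h z)"
    proof eventually_elim
      case (elim z)
      then show ?case using K(2)[of "h z"] by fastforce
    qed
  qed
  then show False using h by blast
qed

lemma foldr_comp_snoc: "foldr (\<circ>) (gs @ [h]) id = foldr (\<circ>) gs id \<circ> h"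
  by (induction gs) (simp_all add: o_assoc)

lemma class_B_hat_innermost:
  assumes "f \<in> class_B_hat"
  obtains u h Ru where "f = u \<circ> h" "h \<in> class_B" "finite_order h" "lifts_above u Ru"
proof -
  obtain gs where gs: "gs \<noteq> []" "\<forall>g\<in>set gs. g \<in> class_B \<and> finite_order g" "f = foldr (\<circ>) gs id"
    using assms unfolding class_B_hat_def by blast
  define xs h where "xs = butlast gs" and "h = last gs"
  have split: "gs = xs @ [h]" using gs(1) by (simp add: xs_def h_def)
  have "\<exists>R. lifts_above (foldr (\<circ>) xs id) R"
    by (rule foldr_lifts_above) (use gs(2) split in auto)
  then obtain Ru where "lifts_above (foldr (\<circ>) xs id) Ru" by blast
  moreover have "f = foldr (\<circ>) xs id \<circ> h" using gs(3) foldr_comp_snoc split by simp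
  moreover have "h \<in> class_B" "finite_order h" using gs(2) split by auto
  ultimately show thesis by (intro that)
qed

text \<open>The slope condition: a tract of \<open>f\<close> lies in a sector. For a composition it is inherited from
  the innermost function, because the tracts of \<open>f\<close> lie in tracts of the latter.\<close>

locale ray_map = log_map +
  assumes slope: "branch \<phi> \<Longrightarrow> \<exists>C\<ge>0. \<forall>\<omega>\<in>H. \<bar>Im (\<phi> \<omega>)\<bar> \<le> C * (1 + Re (\<phi> \<omega>))"

text \<open>For a branch \<phi> of f the map p = h \<circ> exp \<circ> \<phi> stays outside a large
  disc. With a logarithm \<phi>u of p one gets \<phi> = \<phi>h \<circ> \<phi>u for a branch \<phi>h
  of the innermost factor h, so values of \<phi> are values of \<phi>h and satisfy its sector
  estimate.\<close>

lemma class_B_hat_ray_map: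
  assumes "f \<in> class_B_hat"
  obtains R where "ray_map f R"
proof -
  obtain u h Ru where uh: "f = u \<circ> h" "h \<in> class_B" "finite_order h" "lifts_above u Ru"
    using class_B_hat_innermost[OF assms] by blast
  obtain Rh0 where Rh0: "lifts_above h Rh0" using class_B_lifts_above[OF uh(2)] by blast
  have hol: "u holomorphic_on UNIV" "h holomorphic_on UNIV" using lifts_aboveD(1) uh(4) Rh0 by blast+
  obtain B1 where B1: "\<And>z. norm z \<le> 1 \<Longrightarrow> norm (h z) \<le> B1" using entire_bounded_on_cball[OF hol(2)] by metis
  define Rh where "Rh = max (max Rh0 B1) 1"
  interpret h: log_map h Rh
  proof
    show "lifts_above h Rh" by (rule lifts_above_mono[OF Rh0]) (simp add: Rh_def)
    show "norm (h z) \<le> Rh" if "norm z \<le> 1" for z using B1[OF that] by (simp add: Rh_def)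
  qed (simp_all add: Rh_def class_B_not_pole uh)
  \<comment> \<open>The margin 1 puts \<phi>u into Re > ln (Rh + 1), strictly inside the half plane
    of h, where \<open>finite_order_slope\<close> applies.\<close>
  obtain Bu where Bu: "\<And>z. norm z \<le> Rh + 1 \<Longrightarrow> norm (u z) \<le> Bu" using entire_bounded_on_cball[OF hol(1)] by metis
  have holf: "f holomorphic_on UNIV"
    using holomorphic_on_compose[OF hol(2)] hol(1) holomorphic_on_subset uh(1) by blast
  obtain Bf where Bf: "\<And>z. norm z \<le> 1 \<Longrightarrow> norm (f z) \<le> Bf" using entire_bounded_on_cball[OF holf] by metis
  define R where "R = max (max Ru Bu) (max Bf 1)"
  have uR: "Rh + 1 < norm z" if "R < norm (u z)" for z
    using Bu[of z] that by (fastforce simp: R_def)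
  interpret f: log_map f R
  proof
    show "lifts_above f R" unfolding uh(1)
    proof (rule lifts_above_comp[OF uh(4) Rh0])
      show "Rh0 < norm z" if "R < norm (u z)" for z using uR[OF that] by (simp add: Rh_def)
    qed (simp add: R_def)
    show "norm (f z) \<le> R" if "norm z \<le> 1" for z using Bf[OF that] by (simp add: R_def)
    show "\<not> filterlim f at_infinity at_infinity"
      unfolding uh(1) by (rule comp_not_pole[OF hol(1) class_B_not_pole[OF uh(2)]])
  qed (simp add: R_def)
  have "ray_map f R"
  proof
    fix \<phi> assume \<phi>: "f.branch \<phi>"
    define p where "p \<omega> = h (exp (\<phi> \<omega>))" for \<omega>
    have up: "u (p \<omega>) = exp \<omega>" if "\<omega> \<in> f.H" for \<omega>
    proof -
      have "f (exp (\<phi> \<omega>)) = exp \<omega>" using f.branchD(2)[OF \<phi> that] by (simp only: f.F_def)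
      then show ?thesis by (simp add: p_def uh(1))
    qed
    have pn: "Rh + 1 < norm (p \<omega>)" if "\<omega> \<in> f.H" for \<omega>
      using uR[of "p \<omega>"] up[OF that] f.norm_exp_H[OF that] by simp
    have contp: "continuous_on f.H p"
      unfolding p_def
      by (intro continuous_on_compose2[OF holomorphic_on_imp_continuous_on[OF hol(2)]] continuous_intros f.branchD(3)[OF \<phi>]) auto
    have pnz: "p \<omega> \<noteq> 0" if "\<omega> \<in> f.H" for \<omega> using pn[OF that] h.R1 by auto
    obtain \<phi>u where \<phi>u: "continuous_on f.H \<phi>u" "\<And>\<omega>. \<omega> \<in> f.H \<Longrightarrow> p \<omega> = exp (\<phi>u \<omega>)"
      using continuous_logarithm_on_contractible[OF contp convex_imp_contractible[OF f.convex_H] pnz] by metis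
    have Re\<phi>u: "ln (Rh + 1) < Re (\<phi>u \<omega>)" if "\<omega> \<in> f.H" for \<omega>
    proof -
      have "Rh + 1 < exp (Re (\<phi>u \<omega>))" using pn[OF that] \<phi>u(2)[OF that] by simp
      moreover have "0 < Rh + 1" using h.R1 by simp
      ultimately show ?thesis by (metis exp_gt_zero ln_exp ln_less_cancel_iff)
    qed
    have x: "h.\<rho> < ln (Rh + 1)" using h.R1 by (simp add: h.\<rho>_def)
    define \<omega>0 where "\<omega>0 = complex_of_real (f.\<rho> + 1)"
    have \<omega>0: "\<omega>0 \<in> f.H" by (simp add: \<omega>0_def f.mem_H)
    have \<phi>uH: "\<phi>u \<omega> \<in> h.H" if "\<omega> \<in> f.H" for \<omega> using Re\<phi>u[OF that] x by (simp add: h.mem_H)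
    have F\<phi>: "h.F (\<phi> \<omega>) = exp (\<phi>u \<omega>)" if "\<omega> \<in> f.H" for \<omega>
      using \<phi>u(2)[OF that] by (simp add: h.F_def p_def)
    obtain \<phi>h where \<phi>h: "h.branch \<phi>h" "\<phi>h (\<phi>u \<omega>0) = \<phi> \<omega>0"
      using h.branch_exists[OF \<phi>uH[OF \<omega>0] F\<phi>[OF \<omega>0]] by blast
    have eq: "\<phi>h (\<phi>u \<omega>) = \<phi> \<omega>" if "\<omega> \<in> f.H" for \<omega>
      by (rule h.branch_lift[OF \<phi>h(1) f.connected_H f.branchD(3)[OF \<phi>] \<phi>u(1) \<phi>uH F\<phi> \<omega>0 \<phi>h(2) that])
    obtain C where C: "0 \<le> C" "\<And>\<omega>. ln (Rh + 1) < Re \<omega> \<Longrightarrow> \<bar>Im (\<phi>h \<omega>)\<bar> \<le> C * (1 + Re (\<phi>h \<omega>))"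
      using h.finite_order_slope[OF uh(3) \<phi>h(1) x] by blast
    have "\<bar>Im (\<phi> \<omega>)\<bar> \<le> C * (1 + Re (\<phi> \<omega>))" if "\<omega> \<in> f.H" for \<omega>
      using C(2)[OF Re\<phi>u[OF that]] by (simp add: eq[OF that])
    then show "\<exists>C\<ge>0. \<forall>\<omega>\<in>f.H. \<bar>Im (\<phi> \<omega>)\<bar> \<le> C * (1 + Re (\<phi> \<omega>))" using C(1) by blast
  qed
  then show thesis by (rule that)
qed

section \<open>Curves escaping through a fixed branch\<close>

text \<open>The k increments of r over consecutive steps of length (b - a) / k add up to 0, so they
  cannot all have the same sign, and the increment is continuous in its starting point.\<close>

lemma universal_chord:
  fixes r :: "real \<Rightarrow> real"
  assumes cont: "continuous_on {a..b} r" and eq: "r a = r b" and ab: "a < b" and k: "0 < k"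
  obtains c where "a \<le> c" "c + (b - a) / real k \<le> b" "r c = r (c + (b - a) / real k)"
proof (rule ccontr)
  assume H: "\<not> thesis"
  note key = that
  define \<delta> where "\<delta> = (b - a) / real k"
  have \<delta>: "0 < \<delta>" "a + real k * \<delta> = b" using ab k by (auto simp: \<delta>_def)
  have \<delta>le: "a \<le> b - \<delta>"
  proof -
    have "\<delta> * 1 \<le> \<delta> * real k" using \<delta>(1) k by (intro mult_left_mono) auto
    then show ?thesis using \<delta>(2) by (simp add: mult.commute)
  qed
  define D where "D c = r (c + \<delta>) - r c" for c
  have contD: "continuous_on {a..b - \<delta>} D"
    unfolding D_def using \<delta>(1)
    by (intro continuous_intros continuous_on_compose2[OF cont] continuous_on_subset[OF cont]) auto
  have nz: "D c \<noteq> 0" if "a \<le> c" "c \<le> b - \<delta>" for c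
  proof
    assume "D c = 0"
    then have "r c = r (c + \<delta>)" by (simp add: D_def)
    moreover have "c + \<delta> \<le> b" using that(2) by simp
    ultimately show False using H key[of c] that(1) unfolding \<delta>_def by blast
  qed
  have pts: "a \<le> a + real i * \<delta>" "a + real i * \<delta> \<le> b - \<delta>" if "i < k" for i
  proof -
    have "real (Suc i) * \<delta> \<le> real k * \<delta>" using that \<delta>(1) by (intro mult_right_mono) auto
    then show "a + real i * \<delta> \<le> b - \<delta>" using \<delta>(2) by (simp add: algebra_simps)
  qed (use \<delta>(1) in auto)
  have sum0: "(\<Sum>i<k. D (a + real i * \<delta>)) = 0"
  proof -
    have "(\<Sum>i<k. D (a + real i * \<delta>)) = (\<Sum>i<k. r (a + real (Suc i) * \<delta>) - r (a + real i * \<delta>))"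
      by (simp add: D_def algebra_simps)
    also have "\<dots> = r (a + real k * \<delta>) - r (a + real 0 * \<delta>)"
      by (rule sum_lessThan_telescope)
    finally show ?thesis using \<delta>(2) eq by simp
  qed
  have ne: "{..<k} \<noteq> {}" using k by auto
  show False
  proof (cases "\<forall>c\<in>{a..b - \<delta>}. 0 < D c")
    case True
    then have "0 < (\<Sum>i<k. D (a + real i * \<delta>))" using pts ne by (intro sum_pos) auto
    then show False using sum0 by simp
  next
    case False
    then obtain c where c: "a \<le> c" "c \<le> b - \<delta>" "D c < 0" using nz by (force simp: not_less order_less_le)
    have "D c' < 0" if c': "a \<le> c'" "c' \<le> b - \<delta>" for c'
    proof (rule ccontr)
      assume "\<not> D c' < 0"
      then have "0 < D c'" using nz[OF c'] by simp
      moreover have "connected (D ` {a..b - \<delta>})" by (intro connected_continuous_image contD) simp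
      ultimately have "0 \<in> D ` {a..b - \<delta>}"
        using connectedD_interval[of "D ` {a..b - \<delta>}" "D c" "D c'" 0] c c' by auto
      then show False using nz by auto
    qed
    then have "(\<Sum>i<k. D (a + real i * \<delta>)) < (\<Sum>i<k. 0)" using pts ne by (intro sum_strict_mono) auto
    then show False using sum0 by simp
  qed
qed

lemma closed_image_proper:
  fixes k :: "real \<Rightarrow> 'a::{real_normed_vector,heine_borel}"
  assumes cont: "continuous_on {b..} k" and lim: "filterlim (\<lambda>t. norm (k t)) at_top at_top"
    and U: "closed U" "U \<subseteq> {b..}"
  shows "closed (k ` U)"
proof (rule closed_sequential_limits[THEN iffD2], intro allI impI, elim conjE)
  fix x l assume x: "\<forall>n. x n \<in> k ` U" "x \<longlonglongrightarrow> l"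
  obtain T where T: "\<And>t. T \<le> t \<Longrightarrow> norm l + 1 \<le> norm (k t)"
    using lim unfolding filterlim_at_top eventually_at_top_linorder by blast
  have "compact (U \<inter> {b..max b T})" using U(1) by (simp add: closed_Int_compact)
  then have "compact (k ` (U \<inter> {b..max b T}))"
    by (intro compact_continuous_image continuous_on_subset[OF cont]) auto
  then have cl: "closed (k ` (U \<inter> {b..max b T}))" by (rule compact_imp_closed)
  have "\<forall>\<^sub>F n in sequentially. norm (x n) < norm l + 1"
    using order_tendstoD(2)[OF tendsto_norm[OF x(2)], of "norm l + 1"] by simp
  then have "\<forall>\<^sub>F n in sequentially. x n \<in> k ` (U \<inter> {b..max b T})"
  proof eventually_elim
    case (elim n)
    obtain t where t: "t \<in> U" "x n = k t" using x(1) by blast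
    then have "t < T" using T[of t] elim by fastforce
    then show ?case using t U(2) by auto
  qed
  then have "l \<in> k ` (U \<inter> {b..max b T})"
    using Lim_in_closed_set[OF cl _ sequentially_bot x(2)] by blast
  then show "l \<in> k ` U" by blast
qed

lemma closure_landing_curve:
  fixes g :: "real \<Rightarrow> 'a::{real_normed_vector,heine_borel}"
  assumes g: "continuous_on {0<..} g" "filterlim (\<lambda>t. norm (g t)) at_top at_top"
    and lim: "(g \<longlongrightarrow> z) (at_right 0)"
  shows "closure (g ` {0<..}) = insert z (g ` {0<..})"
proof (intro equalityI subsetI)
  fix l assume l: "l \<in> closure (g ` {0<..})"
  show "l \<in> insert z (g ` {0<..})"
  proof (cases "l = z")
    case False
    define e where "e = dist l z / 2"
    have e: "0 < e" using False by (simp add: e_def)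
    have "\<forall>\<^sub>F t in at_right 0. dist (g t) z < e" by (rule tendstoD[OF lim e])
    then obtain d where d: "0 < d" "\<And>t. 0 < t \<Longrightarrow> t < d \<Longrightarrow> dist (g t) z < e"
      unfolding eventually_at_right_field by blast
    have "g ` {0<..} \<subseteq> cball z e \<union> g ` {d..}"
    proof
      fix y assume "y \<in> g ` {0<..}"
      then obtain t where "0 < t" "y = g t" by auto
      then show "y \<in> cball z e \<union> g ` {d..}" using d(2)[of t] by (cases "t < d") (auto simp: dist_commute)
    qed
    moreover have "closed (g ` {d..})"
      by (rule closed_image_proper[OF continuous_on_subset[OF g(1)] g(2) closed_atLeast order_refl]) (use d(1) in auto)
    ultimately have "closure (g ` {0<..}) \<subseteq> cball z e \<union> g ` {d..}" by (intro closure_minimal) auto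
    then have "l \<in> cball z e \<union> g ` {d..}" using l by blast
    moreover have "l \<notin> cball z e" using e by (simp add: e_def dist_commute)
    ultimately show ?thesis using d(1) by fastforce
  qed simp
next
  fix l assume "l \<in> insert z (g ` {0<..})"
  moreover have "z \<in> closure (g ` {0<..})"
    unfolding closure_approachable
  proof (intro allI impI)
    fix e :: real assume "0 < e"
    then have "\<forall>\<^sub>F t in at_right 0. dist (g t) z < e" by (rule tendstoD[OF lim])
    then obtain d where d: "0 < d" "\<And>t. 0 < t \<Longrightarrow> t < d \<Longrightarrow> dist (g t) z < e"
      unfolding eventually_at_right_field by blast
    then show "\<exists>y\<in>g ` {0<..}. dist y z < e" by (intro bexI[of _ "g (d / 2)"]) auto
  qed
  ultimately show "l \<in> closure (g ` {0<..})" using closure_subset[of "g ` {0<..}"] by blast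
qed

text \<open>k is proper and injective, hence a closed embedding; its inverse recovers the parameter
  continuously.\<close>

lemma continuous_on_param:
  fixes k :: "real \<Rightarrow> 'a::{real_normed_vector,heine_borel}" and \<tau> :: "'b::topological_space \<Rightarrow> real"
  assumes cont: "continuous_on {b..} k" and lim: "filterlim (\<lambda>t. norm (k t)) at_top at_top"
    and inj: "inj_on k {b..}" and c: "continuous_on S c"
    and \<tau>: "\<And>x. x \<in> S \<Longrightarrow> b \<le> \<tau> x" "\<And>x. x \<in> S \<Longrightarrow> k (\<tau> x) = c x"
  shows "continuous_on S \<tau>"
proof -
  obtain g where g: "homeomorphism {b..} (k ` {b..}) k g"
  proof (rule homeomorphism_injective_closed_map[OF cont refl inj])
    fix U assume "closedin (top_of_set {b..}) U"
    then have "closed U" "U \<subseteq> {b..}" using closedin_closed_trans[OF _ closed_atLeast] closedin_imp_subset by blast+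
    then have "closed (k ` U)" by (rule closed_image_proper[OF cont lim])
    then show "closedin (top_of_set (k ` {b..})) (k ` U)"
      using \<open>U \<subseteq> {b..}\<close> by (intro closed_subset image_mono) auto
  qed
  have "continuous_on S (\<lambda>x. g (c x))"
    by (rule continuous_on_compose2[OF homeomorphism_cont2[OF g] c]) (use \<tau> in force)
  moreover have "g (c x) = \<tau> x" if "x \<in> S" for x
    using \<tau>[OF that] homeomorphism_apply1[OF g, of "\<tau> x"] by simp
  ultimately show ?thesis by (simp cong: continuous_on_cong)
qed

lemma filterlim_Re_imp_norm:
  fixes k :: "real \<Rightarrow> complex"
  assumes "filterlim (\<lambda>t. Re (k t)) at_top F"
  shows "filterlim (\<lambda>t. norm (k t)) at_top F"
  by (rule filterlim_at_top_mono[OF assms]) (simp add: complex_Re_le_cmod)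

lemma level_IVT:
  fixes k :: "real \<Rightarrow> complex"
  assumes "continuous_on {b..} k" "filterlim (\<lambda>t. Re (k t)) at_top at_top" "Re (k b) \<le> y"
  obtains s where "b \<le> s" "Re (k s) = y"
proof -
  obtain T where T: "\<And>t. T \<le> t \<Longrightarrow> y \<le> Re (k t)"
    using assms(2) unfolding filterlim_at_top eventually_at_top_linorder by blast
  have "\<exists>s. b \<le> s \<and> s \<le> max b T \<and> Re (k s) = y"
    by (rule IVT'[of "\<lambda>s. Re (k s)"])
       (use assms(3) T[of "max b T"] in \<open>auto intro!: continuous_intros continuous_on_subset[OF assms(1)]\<close>)
  then show thesis using that by blast
qed

section \<open>Towers: curves that follow one branch\<close>

context ray_map begin

text \<open>96 = 2 * 48: by \<open>branch_Lipschitz\<close> every branch halves distances on Re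
  \<ge> \<kappa>.\<close>

definition \<kappa> :: real where "\<kappa> = \<rho> + 96"

lemma \<kappa>_H: "\<kappa> < Re \<omega> \<Longrightarrow> \<omega> \<in> H" by (simp add: \<kappa>_def mem_H)

text \<open>\<open>G n\<close> stands for a logarithm of the n-th image of a curve, and the same
  \<phi> leads from every level back to the one before. The curve itself is left out, so that towers
  of different rays, and shifted or translated ones, can be compared.\<close>

definition tower :: "(complex \<Rightarrow> complex) \<Rightarrow> real \<Rightarrow> (nat \<Rightarrow> real \<Rightarrow> complex) \<Rightarrow> bool" where
  "tower \<phi> a G \<longleftrightarrow> branch \<phi> \<and> (\<forall>n. continuous_on {a..} (G n)) \<and>
     (\<forall>n t. a \<le> t \<longrightarrow> \<kappa> < Re (G n t) \<and> \<phi> (G (Suc n) t) = G n t) \<and>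
     (\<forall>n. filterlim (\<lambda>t. Re (G n t)) at_top at_top)"

lemma towerD:
  assumes "tower \<phi> a G"
  shows "branch \<phi>" "continuous_on {a..} (G n)" "a \<le> t \<Longrightarrow> \<kappa> < Re (G n t)" "a \<le> t \<Longrightarrow> G n t \<in> H"
    "a \<le> t \<Longrightarrow> \<phi> (G (Suc n) t) = G n t" "filterlim (\<lambda>t. Re (G n t)) at_top at_top"
    "filterlim (\<lambda>t. norm (G n t)) at_top at_top"
  using assms \<kappa>_H filterlim_Re_imp_norm unfolding tower_def by blast+

lemma tower_shift: "tower \<phi> a G \<Longrightarrow> tower \<phi> a (\<lambda>n. G (n + k))"
  unfolding tower_def by simp

lemma tower_restrict: "tower \<phi> a G \<Longrightarrow> a \<le> b \<Longrightarrow> tower \<phi> b G"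
  unfolding tower_def by (auto elim: continuous_on_subset)

lemma tower_cong:
  assumes "tower \<phi> a G" "branch \<psi>" "\<And>\<omega>. \<omega> \<in> H \<Longrightarrow> \<phi> \<omega> = \<psi> \<omega>"
  shows "tower \<psi> a G"
  using assms(1,2) assms(3)[OF towerD(4)[OF assms(1)]] unfolding tower_def by metis

lemma tower_contract:
  assumes G: "tower \<phi> a G" and K: "tower \<phi> b K" and "a \<le> t" "b \<le> s"
  shows "norm (G 0 t - K 0 s) \<le> norm (G n t - K n s) / 2 ^ n"
proof (induction n)
  case (Suc n)
  have "norm (G n t - K n s) \<le> 48 / 96 * norm (G (Suc n) t - K (Suc n) s)"
    using branch_Lipschitz[OF towerD(1)[OF G], of 96 "G (Suc n) t" "K (Suc n) s"]
      towerD(3)[OF G assms(3), of "Suc n"] towerD(3)[OF K assms(4), of "Suc n"]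
      towerD(5)[OF G assms(3), of n] towerD(5)[OF K assms(4), of n] by (simp add: \<kappa>_def)
  then have "norm (G n t - K n s) / 2 ^ n \<le> norm (G (Suc n) t - K (Suc n) s) / 2 ^ Suc n"
    by (simp add: field_simps)
  then show ?case using Suc by linarith
qed simp

text \<open>By the slope condition, points of equal real part in the same tract are at bounded hyperbolic
  distance in the half plane, hence at bounded distance after one pullback.\<close>

lemma tower_close:
  assumes G: "tower \<phi> a G" and K: "tower \<phi> b K"
  obtains D where "0 \<le> D" "\<And>n s t. a \<le> t \<Longrightarrow> b \<le> s \<Longrightarrow> Re (G (Suc n) t) = Re (K (Suc n) s) \<Longrightarrow>
     norm (G 0 t - K 0 s) \<le> D / 2 ^ n"
proof -
  obtain C where C: "0 \<le> C" "\<And>\<omega>. \<omega> \<in> H \<Longrightarrow> \<bar>Im (\<phi> \<omega>)\<bar> \<le> C * (1 + Re (\<phi> \<omega>))"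
    using slope[OF towerD(1)[OF G]] by blast
  \<comment> \<open>48 / \<delta> times 2 C (1 + Re x), where (1 + Re x) / \<delta> \<le> 2 + \<rho>
    since \<delta> \<ge> 1.\<close>
  define D where "D = 96 * C * (2 + \<rho>)"
  show thesis
  proof (rule that[of D])
    show "0 \<le> D" using C(1) \<rho>_nonneg by (simp add: D_def)
    fix n s t assume t: "a \<le> t" and s: "b \<le> s" and eq: "Re (G (Suc n) t) = Re (K (Suc n) s)"
    define x y where "x = G (Suc n) t" and "y = K (Suc n) s"
    define \<delta> where "\<delta> = Re x - \<rho>"
    have \<delta>: "96 < \<delta>" using towerD(3)[OF G t, of "Suc n"] by (simp add: \<delta>_def x_def \<kappa>_def)
    \<comment> \<open>x and y are themselves values of \<phi> at points of the next level, so the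
      slope condition applies to them.\<close>
    have Im: "\<bar>Im x\<bar> \<le> C * (1 + Re x)" "\<bar>Im y\<bar> \<le> C * (1 + Re x)"
      using C(2)[OF towerD(4)[OF G t, of "Suc (Suc n)"]] C(2)[OF towerD(4)[OF K s, of "Suc (Suc n)"]]
        towerD(5)[OF G t, of "Suc n"] towerD(5)[OF K s, of "Suc n"] eq by (simp_all add: x_def y_def)
    have "norm (x - y) = \<bar>Im x - Im y\<bar>"
      using eq by (simp add: cmod_def x_def y_def)
    also have "\<dots> \<le> 2 * C * (1 + Re x)" using Im by linarith
    finally have xy: "norm (x - y) \<le> 2 * C * (1 + Re x)" .
    have "norm (G n t - K n s) \<le> 48 / \<delta> * norm (x - y)"
      using branch_Lipschitz[OF towerD(1)[OF G], of \<delta> x y] \<delta> eq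
        towerD(5)[OF G t, of n] towerD(5)[OF K s, of n] by (simp add: \<delta>_def x_def y_def)
    also have "\<dots> \<le> 48 / \<delta> * (2 * C * (1 + Re x))" using xy \<delta> by (intro mult_left_mono) auto
    also have "\<dots> = 96 * C * ((1 + \<rho> + \<delta>) / \<delta>)" by (simp add: \<delta>_def)
    also have "\<dots> \<le> 96 * C * (2 + \<rho>)"
    proof (intro mult_left_mono)
      have "1 * (1 + \<rho>) \<le> \<delta> * (1 + \<rho>)" using \<delta> \<rho>_nonneg by (intro mult_right_mono) auto
      then have "1 + \<rho> + \<delta> \<le> (2 + \<rho>) * \<delta>" by (simp add: algebra_simps)
      then show "(1 + \<rho> + \<delta>) / \<delta> \<le> 2 + \<rho>" using \<delta> by (simp add: pos_divide_le_eq)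
    qed (use C in simp)
    finally have "norm (G n t - K n s) / 2 ^ n \<le> D / 2 ^ n" unfolding D_def by (intro divide_right_mono) auto
    then show "norm (G 0 t - K 0 s) \<le> D / 2 ^ n" using tower_contract[OF G K t s, of n] by linarith
  qed
qed

text \<open>When K n starts at s to the left of \<open>G n t\<close>, it reaches the level of that
  point further out, and the estimate of \<open>tower_close\<close> applies there. Arbitrarily large
  n suffice, hence the form of \<open>freq\<close>.\<close>

lemma tower_level_seq:
  assumes G: "tower \<phi> a G" and K: "tower \<phi> b K" and t: "a \<le> t" and s: "b \<le> s"
    and freq: "\<exists>\<^sub>F n in sequentially. Re (K n s) \<le> Re (G n t)" and D: "0 \<le> D"
    "\<And>n s t. a \<le> t \<Longrightarrow> b \<le> s \<Longrightarrow> Re (G (Suc n) t) = Re (K (Suc n) s) \<Longrightarrow> norm (G 0 t - K 0 s) \<le> D / 2 ^ n"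
  shows "\<exists>n\<ge>N. \<exists>s'\<ge>s. Re (K n s') = Re (G n t) \<and> norm (G 0 t - K 0 s') \<le> D / 2 ^ N"
proof -
  have "\<not> (\<forall>\<^sub>F n in sequentially. \<not> Re (K n s) \<le> Re (G n t))" using freq by (simp add: frequently_def)
  then obtain n where n: "Suc N \<le> n" "Re (K n s) \<le> Re (G n t)" unfolding eventually_sequentially by blast
  obtain m where m: "n = Suc m" "N \<le> m" using n(1) by (cases n) auto
  have K': "tower \<phi> s K" by (rule tower_restrict[OF K s])
  obtain s' where s': "s \<le> s'" "Re (K n s') = Re (G n t)"
    using level_IVT[OF towerD(2)[OF K'] towerD(6)[OF K'] n(2)] by blast
  have "norm (G 0 t - K 0 s') \<le> D / 2 ^ m" using D(2)[OF t, of s' m] s s' m by simp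
  also have "\<dots> \<le> D / 2 ^ N" using D(1) m(2) by (intro divide_left_mono power_increasing) auto
  finally show ?thesis using s' n(1) by (intro exI[of _ n] conjI exI[of _ s']) auto
qed

text \<open>The points found on K at equal levels approximate \<open>G 0 t\<close> arbitrarily well,
  and the image of \<open>K 0\<close> on {s..} is closed.\<close>

lemma tower_level:
  assumes G: "tower \<phi> a G" and K: "tower \<phi> b K" and t: "a \<le> t" and s: "b \<le> s"
    and freq: "\<exists>\<^sub>F n in sequentially. Re (K n s) \<le> Re (G n t)"
  shows "\<exists>s'\<ge>s. K 0 s' = G 0 t"
proof -
  obtain D where D: "0 \<le> D" "\<And>n s t. a \<le> t \<Longrightarrow> b \<le> s \<Longrightarrow> Re (G (Suc n) t) = Re (K (Suc n) s) \<Longrightarrow>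
     norm (G 0 t - K 0 s) \<le> D / 2 ^ n" using tower_close[OF G K] by blast
  have K': "tower \<phi> s K" by (rule tower_restrict[OF K s])
  have cl: "closed (K 0 ` {s..})"
    by (rule closed_image_proper[OF towerD(2,7)[OF K'] closed_atLeast order_refl])
  have "G 0 t \<in> K 0 ` {s..}"
    unfolding closed_approachable[OF cl, symmetric]
  proof (intro allI impI)
    fix e :: real assume e: "0 < e"
    have "(\<lambda>n. D * (1 / 2) ^ n) \<longlonglongrightarrow> D * 0" by (intro tendsto_intros LIMSEQ_realpow_zero) auto
    then have "\<forall>\<^sub>F n in sequentially. D * (1 / 2) ^ n < e" using e by (intro order_tendstoD(2)) auto
    then obtain N where N: "D * (1 / 2) ^ N < e" unfolding eventually_sequentially by blast
    obtain s' where s': "s \<le> s'" "norm (G 0 t - K 0 s') \<le> D / 2 ^ N"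
      using tower_level_seq[OF G K t s freq D, of N] by blast
    have "D / 2 ^ N = D * (1 / 2) ^ N" by (simp add: power_divide)
    then have "dist (K 0 s') (G 0 t) < e"
      using s'(2) N unfolding dist_norm norm_minus_commute[of "K 0 s'"] by linarith
    then show "\<exists>y\<in>K 0 ` {s..}. dist y (G 0 t) < e" using s'(1) by blast
  qed
  then show ?thesis by auto
qed

text \<open>Of the two starting points one is infinitely often not to the right of the other; either
  way \<open>tower_level\<close> produces a common point.\<close>

lemma tower_meet:
  assumes G: "tower \<phi> a G" and K: "tower \<phi> b K"
  obtains t s where "a \<le> t" "b \<le> s" "G 0 t = K 0 s"
proof (cases "\<exists>\<^sub>F n in sequentially. Re (K n b) \<le> Re (G n a)")
  case True
  then show ?thesis using tower_level[OF G K order_refl order_refl] that by fastforce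
next
  case False
  then have "\<forall>\<^sub>F n in sequentially. Re (G n a) \<le> Re (K n b)"
    unfolding not_frequently by eventually_elim simp
  then have "\<exists>\<^sub>F n in sequentially. Re (G n a) \<le> Re (K n b)"
    by (simp add: eventually_frequently)
  then show ?thesis using tower_level[OF K G order_refl order_refl] that by fastforce
qed

lemma tower_eq_all:
  assumes G: "tower \<phi> a G" and K: "tower \<phi> b K" and "a \<le> t" "b \<le> s" "G 0 t = K 0 s"
  shows "G n t = K n s"
proof (induction n)
  case (Suc n)
  have "\<phi> (G (Suc n) t) = \<phi> (K (Suc n) s) + per 0"
    using Suc towerD(5)[OF G assms(3)] towerD(5)[OF K assms(4)] by simp
  then show ?case by (rule branch_inj[OF towerD(1)[OF G] towerD(4)[OF G assms(3)] towerD(4)[OF K assms(4)]])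
qed (use assms in simp)

text \<open>Order by speed of escape: in place of a potential, the parameter order is recovered from
  the eventual comparison of the moduli of the images.\<close>

definition ordered :: "real \<Rightarrow> (nat \<Rightarrow> real \<Rightarrow> complex) \<Rightarrow> bool" where
  "ordered a G \<longleftrightarrow> (\<forall>t t'. a \<le> t \<longrightarrow> t < t' \<longrightarrow> (\<forall>\<^sub>F n in sequentially. Re (G n t) < Re (G n t')))"

text \<open>Otherwise the curve returns to the level of \<open>t\<close> infinitely often; by the universal chord theorem
  it then takes the same level at points of arbitrarily small prescribed parameter distance, and
  these have equal images in the limit.\<close>

lemma tower_ordered:
  assumes G: "tower \<phi> a G" and linj: "\<And>t. a \<le> t \<Longrightarrow> \<exists>e>0. inj_on (G 0) ({a..} \<inter> ball t e)"
  shows "ordered a G"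
  unfolding ordered_def
proof (intro allI impI, rule ccontr)
  fix t t' assume t: "a \<le> t" and tt': "t < t'"
    and "\<not> (\<forall>\<^sub>F n in sequentially. Re (G n t) < Re (G n t'))"
  then have freq: "\<exists>\<^sub>F n in sequentially. Re (G n t') \<le> Re (G n t)" by (simp add: not_eventually not_less)
  have t'a: "a \<le> t'" using t tt' by simp
  obtain D where D: "0 \<le> D" "\<And>n s t. a \<le> t \<Longrightarrow> a \<le> s \<Longrightarrow> Re (G (Suc n) t) = Re (G (Suc n) s) \<Longrightarrow>
     norm (G 0 t - G 0 s) \<le> D / 2 ^ n" using tower_close[OF G G] by blast
  have "\<exists>n s. N < n \<and> t' \<le> s \<and> Re (G n s) = Re (G n t) \<and> norm (G 0 t - G 0 s) \<le> D" for N
  proof -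
    obtain n s where "n \<ge> Suc N" "s \<ge> t'" "Re (G n s) = Re (G n t)" "norm (G 0 t - G 0 s) \<le> D / 2 ^ Suc N"
      using tower_level_seq[OF G G t t'a freq D, of "Suc N"] by blast
    moreover have "D / 2 ^ Suc N \<le> D / 1" using D(1) by (intro divide_left_mono one_le_power) auto
    ultimately show ?thesis by (intro exI[of _ n] exI[of _ s]) auto
  qed
  then obtain n s where ns: "\<And>N. N < n N" "\<And>N. t' \<le> s N" "\<And>N. Re (G (n N) (s N)) = Re (G (n N) t)"
    "\<And>N. norm (G 0 t - G 0 (s N)) \<le> D" by metis
  obtain T where T: "\<And>u. T \<le> u \<Longrightarrow> norm (G 0 t) + D + 1 \<le> norm (G 0 u)"
    using towerD(7)[OF G, of 0] unfolding filterlim_at_top eventually_at_top_linorder by blast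
  have sT: "s N \<le> T" for N
  proof (rule ccontr)
    assume "\<not> s N \<le> T"
    then have "norm (G 0 t) + D + 1 \<le> norm (G 0 (s N))" by (intro T) simp
    then show False using ns(4)[of N] norm_triangle_ineq2[of "G 0 (s N)" "G 0 t"] by (simp add: norm_minus_commute)
  qed
  have contG: "continuous_on {a..} (G 0)" by (rule towerD(2)[OF G])
  \<comment> \<open>For fixed j the universal chord theorem gives, at levels n N tending to
    infinity, two points of equal real part whose parameters differ by (s N - t) / (j + 1). Their
    images at level 0 get close, so they coincide in the limit; the limiting chord has positive
    length because s N \<ge> t' > t.\<close>
  have step: "\<exists>c \<delta>. t \<le> c \<and> c \<le> T \<and> 0 < \<delta> \<and> \<delta> \<le> (T - t) / real (Suc j) \<and> G 0 c = G 0 (c + \<delta>)" for j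
  proof -
    have "\<exists>c\<ge>t. c + (s N - t) / real (Suc j) \<le> s N \<and> Re (G (n N) c) = Re (G (n N) (c + (s N - t) / real (Suc j)))" for N
    proof -
      have "continuous_on {t..s N} (\<lambda>u. Re (G (n N) u))"
        by (intro continuous_intros continuous_on_subset[OF towerD(2)[OF G]]) (use t in auto)
      then show ?thesis
        using universal_chord[of t "s N" "\<lambda>u. Re (G (n N) u)" "Suc j"] ns(2,3)[of N] tt' by (metis less_le_trans zero_less_Suc)
    qed
    then obtain c where c: "\<And>N. t \<le> c N" "\<And>N. c N + (s N - t) / real (Suc j) \<le> s N"
      "\<And>N. Re (G (n N) (c N)) = Re (G (n N) (c N + (s N - t) / real (Suc j)))" by metis
    have spos: "0 < (s N - t) / real (Suc j)" for N using ns(2)[of N] tt' by simp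
    have cT: "c N \<le> T" for N using c(2)[of N] sT[of N] spos[of N] by linarith
    have inbox: "(c N, s N) \<in> {t..T} \<times> {t'..T}" for N using c(1) cT ns(2) sT by simp
    have "compact ({t..T} \<times> {t'..T})" by (intro compact_Times) auto
    then obtain l q where lq: "l \<in> {t..T} \<times> {t'..T}" "strict_mono q" "((\<lambda>N. (c N, s N)) \<circ> q) \<longlonglongrightarrow> l"
      using seq_compactE[OF compact_imp_seq_compact, of "{t..T} \<times> {t'..T}" "\<lambda>N. (c N, s N)"] inbox by blast
    obtain c' s' where l: "l = (c', s')" by force
    have lim: "(\<lambda>N. c (q N)) \<longlonglongrightarrow> c'" "(\<lambda>N. s (q N)) \<longlonglongrightarrow> s'"
      using tendsto_fst[OF lq(3)] tendsto_snd[OF lq(3)] by (simp_all add: o_def l)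
    define \<delta> where "\<delta> = (s' - t) / real (Suc j)"
    have c's': "t \<le> c'" "c' \<le> T" "t' \<le> s'" "s' \<le> T" using lq(1) l by auto
    have \<delta>: "0 < \<delta>" "\<delta> \<le> (T - t) / real (Suc j)"
      using c's' tt' by (auto simp: \<delta>_def intro!: divide_right_mono)
    have lim2: "(\<lambda>N. c (q N) + (s (q N) - t) / real (Suc j)) \<longlonglongrightarrow> c' + \<delta>"
      unfolding \<delta>_def by (intro tendsto_intros lim) simp
    have Glim: "(\<lambda>N. G 0 (u N)) \<longlonglongrightarrow> G 0 v" if "u \<longlonglongrightarrow> v" "\<And>N. a \<le> u N" "a \<le> v" for u v
      by (rule continuous_on_tendsto_compose[OF contG that(1)]) (use that in auto)
    have l1: "(\<lambda>N. G 0 (c (q N))) \<longlonglongrightarrow> G 0 c'" by (rule Glim[OF lim(1)]) (use c(1) c's' t in \<open>auto intro: order_trans\<close>)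
    have ca: "a \<le> c (q N) + (s (q N) - t) / real (Suc j)" for N using c(1)[of "q N"] spos[of "q N"] t by linarith
    have l2: "(\<lambda>N. G 0 (c (q N) + (s (q N) - t) / real (Suc j))) \<longlonglongrightarrow> G 0 (c' + \<delta>)"
      by (rule Glim[OF lim2 ca]) (use c's' \<delta> t in auto)
    have bnd: "norm (G 0 (c (q N)) - G 0 (c (q N) + (s (q N) - t) / real (Suc j))) \<le> D * (1 / 2) ^ N" for N
    proof -
      obtain m where m: "n (q N) = Suc m" "q N \<le> m" using ns(1)[of "q N"] by (cases "n (q N)") auto
      have "N \<le> m" using seq_suble[OF lq(2), of N] m(2) by simp
      have "norm (G 0 (c (q N)) - G 0 (c (q N) + (s (q N) - t) / real (Suc j))) \<le> D / 2 ^ m"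
        using c(3)[of "q N"] c(1)[of "q N"] t ca[of N] unfolding m(1) by (intro D(2)) auto
      also have "\<dots> \<le> D / 2 ^ N" using D(1) \<open>N \<le> m\<close> by (intro divide_left_mono power_increasing) auto
      finally show ?thesis by (simp add: power_divide)
    qed
    have "(\<lambda>N. D * (1 / 2) ^ N) \<longlonglongrightarrow> D * 0" by (intro tendsto_intros LIMSEQ_realpow_zero) auto
    then have lim0: "(\<lambda>N. D * (1 / 2) ^ N) \<longlonglongrightarrow> 0" by simp
    have "(\<lambda>N. G 0 (c (q N)) - G 0 (c (q N) + (s (q N) - t) / real (Suc j))) \<longlonglongrightarrow> 0"
      by (rule Lim_null_comparison[OF always_eventually lim0]) (rule allI, rule bnd)
    then have "G 0 c' - G 0 (c' + \<delta>) = 0" using tendsto_diff[OF l1 l2] LIMSEQ_unique by blast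
    then show ?thesis using c's' \<delta> by (intro exI[of _ c'] exI[of _ \<delta>]) auto
  qed
  then obtain c \<delta> where c: "\<And>j. t \<le> c j" "\<And>j. c j \<le> T" "\<And>j. 0 < \<delta> j" "\<And>j. \<delta> j \<le> (T - t) / real (Suc j)"
    "\<And>j. G 0 (c j) = G 0 (c j + \<delta> j)" by metis
  obtain c0 q where c0: "c0 \<in> {t..T}" "strict_mono q" "(c \<circ> q) \<longlonglongrightarrow> c0"
    using seq_compactE[OF compact_imp_seq_compact[OF compact_Icc], of c t T] c(1,2) by auto
  \<comment> \<open>Chords with equal end values and vanishing length accumulate at c0, against
    local injectivity there.\<close>
  obtain e where e: "0 < e" "inj_on (G 0) ({a..} \<inter> ball c0 e)" using linj[of c0] c0(1) t by auto
  have "(\<lambda>j. (T - t) / real (Suc j)) \<longlonglongrightarrow> 0"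
    using LIMSEQ_Suc[OF lim_const_over_n[of "T - t"]] by simp
  then have "\<delta> \<longlonglongrightarrow> 0"
    by (rule Lim_null_comparison[rotated]) (use c(3,4) in \<open>auto intro!: always_eventually simp: less_imp_le abs_of_pos\<close>)
  then have "(\<delta> \<circ> q) \<longlonglongrightarrow> 0" using LIMSEQ_subseq_LIMSEQ c0(2) by blast
  then have lim: "(\<lambda>j. c (q j) + \<delta> (q j)) \<longlonglongrightarrow> c0"
    using tendsto_add[OF c0(3), of "\<delta> \<circ> q" 0] by (simp add: o_def)
  have "\<forall>\<^sub>F j in sequentially. c (q j) + \<delta> (q j) \<in> ball c0 e" "\<forall>\<^sub>F j in sequentially. c (q j) \<in> ball c0 e"
    using topological_tendstoD[OF lim open_ball, of c0 e] topological_tendstoD[OF c0(3) open_ball, of c0 e] e(1)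
    by (simp_all add: o_def)
  then have "\<forall>\<^sub>F j in sequentially. c (q j) + \<delta> (q j) \<in> ball c0 e \<and> c (q j) \<in> ball c0 e" by (rule eventually_conj)
  then obtain j where j: "c (q j) + \<delta> (q j) \<in> ball c0 e" "c (q j) \<in> ball c0 e"
    unfolding eventually_sequentially by blast
  have "a \<le> c (q j)" using c(1)[of "q j"] t by linarith
  then have "c (q j) = c (q j) + \<delta> (q j)"
    using inj_onD[OF e(2) c(5)[of "q j"]] j c(3)[of "q j"] by simp
  then show False using c(3)[of "q j"] by simp
qed

lemma ordered_inj:
  assumes G: "tower \<phi> a G" and ord: "ordered a G"
  shows "inj_on (G 0) {a..}"
proof (rule linorder_inj_onI)
  fix t t' assume t: "t < t'" "t \<in> {a..}" "t' \<in> {a..}"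
  show "G 0 t \<noteq> G 0 t'"
  proof
    assume "G 0 t = G 0 t'"
    then have "G n t = G n t'" for n using tower_eq_all[OF G G, of t t' n] t by simp
    moreover have "\<forall>\<^sub>F n in sequentially. Re (G n t) < Re (G n t')" using ord t unfolding ordered_def by simp
    ultimately show False by simp
  qed
qed auto

lemma ordered_shift: "ordered a G \<Longrightarrow> ordered a (\<lambda>n. G (n + k))"
  unfolding ordered_def
proof (intro allI impI)
  fix t t' assume "\<forall>t t'. a \<le> t \<longrightarrow> t < t' \<longrightarrow> (\<forall>\<^sub>F n in sequentially. Re (G n t) < Re (G n t'))" "a \<le> t" "t < t'"
  then have "\<forall>\<^sub>F n in sequentially. Re (G n t) < Re (G n t')" by blast
  then show "\<forall>\<^sub>F n in sequentially. Re (G (n + k) t) < Re (G (n + k) t')"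
    by (rule eventually_sequentially_seg[THEN iffD2])
qed

lemma ordered_restrict: "ordered a G \<Longrightarrow> a \<le> b \<Longrightarrow> ordered b G"
  unfolding ordered_def by (meson order_trans)

text \<open>By \<open>freq\<close> every point of G lies on K, which defines \<tau>. It is
  continuous as a parameter of K, increasing because both orders are read off from the same real
  parts, and onto a tail because G leaves every bounded set.\<close>

lemma tower_reparam:
  assumes G: "tower \<phi> a G" and K: "tower \<phi> b K" and oG: "ordered a G" and oK: "ordered b K"
    and freq: "\<exists>\<^sub>F n in sequentially. Re (K n b) \<le> Re (G n a)"
  obtains \<tau> where "continuous_on {a..} \<tau>" "strict_mono_on {a..} \<tau>"
    "\<And>t. a \<le> t \<Longrightarrow> b \<le> \<tau> t" "\<And>t. a \<le> t \<Longrightarrow> K 0 (\<tau> t) = G 0 t" "\<tau> ` {a..} = {\<tau> a..}"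
proof -
  \<comment> \<open>\<open>freq\<close> is given at a; since G is ordered, it passes to all later
    t.\<close>
  have "\<exists>s\<ge>b. K 0 s = G 0 t" if t: "a \<le> t" for t
  proof (rule tower_level[OF G K t order_refl])
    show "\<exists>\<^sub>F n in sequentially. Re (K n b) \<le> Re (G n t)"
    proof (cases "a = t")
      case False
      then have "\<forall>\<^sub>F n in sequentially. Re (G n a) < Re (G n t)" using oG t unfolding ordered_def by simp
      then have "\<forall>\<^sub>F n in sequentially. Re (K n b) \<le> Re (G n a) \<longrightarrow> Re (K n b) \<le> Re (G n t)"
        by eventually_elim simp
      then show ?thesis by (rule frequently_mp[OF _ freq])
    qed (use freq in simp)
  qed
  then obtain \<tau> where \<tau>: "\<And>t. a \<le> t \<Longrightarrow> b \<le> \<tau> t" "\<And>t. a \<le> t \<Longrightarrow> K 0 (\<tau> t) = G 0 t" by metis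
  have cont: "continuous_on {a..} \<tau>"
    by (rule continuous_on_param[OF towerD(2,7)[OF K] ordered_inj[OF K oK] towerD(2)[OF G]]) (use \<tau> in auto)
  have mono: "\<tau> t < \<tau> t'" if "a \<le> t" "t < t'" for t t'
  proof (rule ccontr)
    assume n: "\<not> \<tau> t < \<tau> t'"
    have t': "a \<le> t'" using that by simp
    have eqs: "K n (\<tau> t) = G n t" "K n (\<tau> t') = G n t'" for n
      using tower_eq_all[OF K G \<tau>(1)[OF that(1)] that(1) \<tau>(2)[OF that(1)]]
        tower_eq_all[OF K G \<tau>(1)[OF t'] t' \<tau>(2)[OF t']] by blast+
    have ev: "\<forall>\<^sub>F n in sequentially. Re (G n t) < Re (G n t')" using oG that unfolding ordered_def by simp
    show False
    proof (cases "\<tau> t = \<tau> t'")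
      case True
      then have "G n t = G n t'" for n using eqs by metis
      then show False using ev by simp
    next
      case False
      then have "\<forall>\<^sub>F n in sequentially. Re (K n (\<tau> t')) < Re (K n (\<tau> t))"
        using oK n \<tau>(1)[OF t'] unfolding ordered_def by simp
      then have "\<forall>\<^sub>F n in sequentially. False" using ev unfolding eqs by eventually_elim simp
      then show False by simp
    qed
  qed
  have onto: "\<tau> ` {a..} = {\<tau> a..}"
  proof (intro equalityI subsetI)
    fix y assume "y \<in> \<tau> ` {a..}"
    then obtain t where "a \<le> t" "y = \<tau> t" by auto
    then show "y \<in> {\<tau> a..}" using mono[of a t] by (cases "a = t") auto
  next
    fix y assume y: "y \<in> {\<tau> a..}"
    have "compact (K 0 ` {b..y})" by (intro compact_continuous_image continuous_on_subset[OF towerD(2)[OF K]]) auto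
    then obtain B where B: "\<And>s. b \<le> s \<Longrightarrow> s \<le> y \<Longrightarrow> norm (K 0 s) \<le> B"
      using compact_imp_bounded by (fastforce simp: bounded_iff)
    obtain T where T: "\<And>u. T \<le> u \<Longrightarrow> B + 1 \<le> norm (G 0 u)"
      using towerD(7)[OF G, of 0] unfolding filterlim_at_top eventually_at_top_linorder by blast
    define t where "t = max a T"
    have t: "a \<le> t" "B + 1 \<le> norm (G 0 t)" using T[of t] by (auto simp: t_def)
    have "y \<le> \<tau> t" using B[OF \<tau>(1)[OF t(1)]] t(2) \<tau>(2)[OF t(1)] by fastforce
    then have "\<exists>u. a \<le> u \<and> u \<le> t \<and> \<tau> u = y"
      using y t(1) by (intro IVT' continuous_on_subset[OF cont]) auto
    then show "y \<in> \<tau> ` {a..}" by auto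
  qed
  show thesis by (rule that[OF cont _ \<tau> onto]) (auto intro!: strict_mono_onI mono)
qed

end

section \<open>Fixed rays\<close>

context ray_map begin

section \<open>Towers of escaping curves\<close>

lemma iter_holo: "(f ^^ n) holomorphic_on A"
proof (induction n arbitrary: A)
  case (Suc n)
  show ?case unfolding funpow.simps(2) by (rule holomorphic_on_compose[OF Suc f_holo])
qed (simp add: id_def)

lemma iter_deriv: "(\<And>m. deriv f ((f ^^ m) z) \<noteq> 0) \<Longrightarrow> deriv (f ^^ n) z \<noteq> 0"
proof (induction n)
  case (Suc n)
  have eq: "deriv (f \<circ> f ^^ n) z = deriv f ((f ^^ n) z) * deriv (f ^^ n) z"
    by (rule deriv_chain) (use f_holo[of UNIV] iter_holo[of n UNIV] in \<open>auto simp: holomorphic_on_imp_differentiable_at\<close>)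
  show ?case unfolding funpow.simps(2) eq using Suc by simp
qed (simp add: id_def)

lemma noncritical_iter_deriv:
  assumes "noncritical_curve f g" "0 < t"
  shows "deriv (f ^^ n) (g t) \<noteq> 0" "deriv (f ^^ n) (f (g t)) \<noteq> 0"
proof -
  have nc: "deriv f ((f ^^ m) (g t)) \<noteq> 0" for m
    using assms unfolding noncritical_curve_def critical_point_def by blast
  show "deriv (f ^^ n) (g t) \<noteq> 0" by (rule iter_deriv[OF nc])
  have "deriv f ((f ^^ m) (f (g t))) \<noteq> 0" for m using nc[of "Suc m"] by (simp add: funpow_swap1)
  then show "deriv (f ^^ n) (f (g t)) \<noteq> 0" by (rule iter_deriv)
qed

lemma escaping_curveD:
  assumes "escaping_curve f h"
  shows "continuous_on {0<..} h" "inj_on h {0<..}" "0 < t \<Longrightarrow> h t \<in> escaping_set f"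
    "filterlim (\<lambda>t. norm ((f ^^ n) (h t))) at_top at_top"
    "0 < b \<Longrightarrow> \<forall>\<^sub>F n in sequentially. \<forall>t\<ge>b. M \<le> norm ((f ^^ n) (h t))"
    "0 < b \<Longrightarrow> continuous_on {b..} h" "filterlim (\<lambda>t. norm (h t)) at_top at_top"
proof -
  show "continuous_on {0<..} h" "inj_on h {0<..}" "0 < t \<Longrightarrow> h t \<in> escaping_set f"
    and lim: "filterlim (\<lambda>t. norm ((f ^^ n) (h t))) at_top at_top" for n t
    using assms unfolding escaping_curve_def by auto
  show "0 < b \<Longrightarrow> \<forall>\<^sub>F n in sequentially. \<forall>t\<ge>b. M \<le> norm ((f ^^ n) (h t))"
    using assms unfolding escaping_curve_def by blast
  show "0 < b \<Longrightarrow> continuous_on {b..} h"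
    using \<open>continuous_on {0<..} h\<close> by (rule continuous_on_subset) auto
  show "filterlim (\<lambda>t. norm (h t)) at_top at_top" using lim[of 0] by simp
qed

lemma escaping_curve_large:
  assumes "escaping_curve f h" "0 < b"
  obtains N where "\<And>n t. N \<le> n \<Longrightarrow> b \<le> t \<Longrightarrow> exp \<kappa> < norm ((f ^^ n) (h t))"
proof -
  obtain N where N: "\<And>n. N \<le> n \<Longrightarrow> \<forall>t\<ge>b. exp \<kappa> + 1 \<le> norm ((f ^^ n) (h t))"
    using escaping_curveD(5)[OF assms] unfolding eventually_sequentially by blast
  show thesis
  proof (rule that[of N])
    fix n t assume "N \<le> n" "b \<le> t"
    then show "exp \<kappa> < norm ((f ^^ n) (h t))" using N[of n] by fastforce
  qed
qed

lemma lift_curve: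
  fixes c :: "real \<Rightarrow> complex"
  assumes c: "continuous_on S c" and S: "convex S" and big: "\<And>t. t \<in> S \<Longrightarrow> exp \<kappa> < norm (c t)"
    and t0: "t0 \<in> S" "exp w = c t0"
  obtains G where "continuous_on S G" "\<And>t. t \<in> S \<Longrightarrow> exp (G t) = c t" "G t0 = w" "\<And>t. t \<in> S \<Longrightarrow> \<kappa> < Re (G t)"
proof -
  have nz: "c t \<noteq> 0" if "t \<in> S" for t using big[OF that] exp_gt_zero[of \<kappa>] by (metis norm_zero less_asym)
  obtain L where L: "continuous_on S L" "\<And>t. t \<in> S \<Longrightarrow> c t = exp (L t)"
    using continuous_logarithm_on_contractible[OF c convex_imp_contractible[OF S] nz] by metis
  define G where "G t = L t + (w - L t0)" for t
  have eG: "exp (G t) = c t" if "t \<in> S" for t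
    using L(2)[OF that] L(2)[OF t0(1)] t0(2) by (simp add: G_def exp_add exp_diff)
  show thesis
  proof (rule that[of G])
    show "continuous_on S G" unfolding G_def by (intro continuous_intros L)
    show "\<kappa> < Re (G t)" if "t \<in> S" for t
    proof -
      have "exp \<kappa> < exp (Re (G t))" using big[OF that] unfolding eG[OF that, symmetric] by simp
      then show ?thesis by simp
    qed
  qed (use eG in \<open>auto simp: G_def\<close>)
qed

text \<open>The offset N allows for the iterates before the tail from a on has moved into |z| > exp
  \<kappa>, where logarithms with real part above \<kappa> exist.\<close>

definition over :: "nat \<Rightarrow> (real \<Rightarrow> complex) \<Rightarrow> real \<Rightarrow> (nat \<Rightarrow> real \<Rightarrow> complex) \<Rightarrow> bool" where
  "over N g a G \<longleftrightarrow> (\<forall>n t. a \<le> t \<longrightarrow> exp (G n t) = (f ^^ (N + n)) (g t))"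

lemma overD: "over N g a G \<Longrightarrow> a \<le> t \<Longrightarrow> exp (G n t) = (f ^^ (N + n)) (g t)"
  unfolding over_def by blast

lemma continuous_on_iter_curve:
  assumes "escaping_curve f h" "0 < b"
  shows "continuous_on {b..} (\<lambda>t. (f ^^ n) (h t))"
  by (rule continuous_on_compose2[OF holomorphic_on_imp_continuous_on[OF iter_holo] escaping_curveD(6)[OF assms]]) auto

lemma tower_overI:
  assumes h: "escaping_curve f h" and b: "0 < b" and \<phi>: "branch \<phi>"
    and cont: "\<And>n. continuous_on {b..} (G n)" and ov: "over N h b G"
    and Re: "\<And>n t. b \<le> t \<Longrightarrow> \<kappa> < Re (G n t)" and x: "b \<le> x" "\<And>n. \<phi> (G (Suc n) x) = G n x"
  shows "tower \<phi> b G"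
  unfolding tower_def
proof (intro conjI allI impI)
  show "\<phi> (G (Suc n) t) = G n t" if "b \<le> t" for n t
  proof (rule branch_lift[OF \<phi>, of "{b..}" "G n" "G (Suc n)" x])
    show "F (G n t) = exp (G (Suc n) t)" if "t \<in> {b..}" for t
      using overD[OF ov, of t n] overD[OF ov, of t "Suc n"] that by (simp add: F_def)
  qed (use cont Re x that \<kappa>_H in auto)
  show "filterlim (\<lambda>t. Re (G n t)) at_top at_top" for n
  proof -
    have "filterlim (\<lambda>t. ln (norm ((f ^^ (N + n)) (h t)))) at_top at_top"
      by (rule filterlim_compose[OF ln_at_top escaping_curveD(4)[OF h]])
    moreover have "\<forall>\<^sub>F t in at_top. ln (norm ((f ^^ (N + n)) (h t))) = Re (G n t)"
      using eventually_ge_at_top[of b]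
    proof eventually_elim
      case (elim t)
      then have "norm ((f ^^ (N + n)) (h t)) = exp (Re (G n t))" using overD[OF ov elim, of n, symmetric] by simp
      then show ?case by simp
    qed
    ultimately show ?thesis by (simp cong: filterlim_cong)
  qed
qed (use \<phi> cont Re in auto)

text \<open>At the common point h x = g y the logarithms for h are chosen equal to those for g. The
  tower relation for \<phi> then holds at x, hence everywhere: a curve through a point of a ray
  follows the branch of the ray.\<close>

lemma matched_tower:
  assumes h: "escaping_curve f h" and b: "0 < b" and x: "b \<le> x"
    and G: "tower \<phi> a G" "over N g a G" and y: "a \<le> y" "g y = h x"
    and N: "\<And>n t. N \<le> n \<Longrightarrow> b \<le> t \<Longrightarrow> exp \<kappa> < norm ((f ^^ n) (h t))"
  obtains K where "tower \<phi> b K" "over N h b K" "\<And>n. K n x = G n y"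
proof -
  have "\<exists>K. continuous_on {b..} K \<and> (\<forall>t\<ge>b. exp (K t) = (f ^^ (N + n)) (h t)) \<and> K x = G n y \<and> (\<forall>t\<ge>b. \<kappa> < Re (K t))" for n
  proof -
    have "exp (G n y) = (f ^^ (N + n)) (h x)" using overD[OF G(2) y(1), of n] y(2) by simp
    then obtain K where "continuous_on {b..} K" "\<And>t. t \<in> {b..} \<Longrightarrow> exp (K t) = (f ^^ (N + n)) (h t)" "K x = G n y"
      "\<And>t. t \<in> {b..} \<Longrightarrow> \<kappa> < Re (K t)"
      using lift_curve[OF continuous_on_iter_curve[OF h b, of "N + n"], of x "G n y"] x N by auto
    then show ?thesis by auto
  qed
  then obtain K where K: "\<And>n. continuous_on {b..} (K n)" "\<And>n t. b \<le> t \<Longrightarrow> exp (K n t) = (f ^^ (N + n)) (h t)"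
    "\<And>n. K n x = G n y" "\<And>n t. b \<le> t \<Longrightarrow> \<kappa> < Re (K n t)" by metis
  have ov: "over N h b K" using K(2) unfolding over_def by blast
  have "tower \<phi> b K"
    by (rule tower_overI[OF h b towerD(1)[OF G(1)] K(1) ov K(4) x]) (use K(3) towerD(5)[OF G(1) y(1)] in auto)
  then show thesis using ov K(3) by (rule that)
qed

text \<open>Normalising the logarithms by \<open>G\<^sub>n\<^sub>+\<^sub>1(t\<^sub>0) = G\<^sub>n(s\<^sub>0)\<close>, where \<open>f(g(t\<^sub>0)) = g(s\<^sub>0)\<close>, forces all
  branches along the orbit of the curve to coincide.\<close>

lemma self_tower:
  assumes g: "escaping_curve f g" and a: "0 < a" "a \<le> t0" "a \<le> s0" and fg: "f (g t0) = g s0"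
    and N: "\<And>n t. N \<le> n \<Longrightarrow> a \<le> t \<Longrightarrow> exp \<kappa> < norm ((f ^^ n) (g t))"
  obtains \<phi> G where "tower \<phi> a G" "over N g a G" "\<And>n. G (Suc n) t0 = G n s0"
proof -
  define P where "P n G \<longleftrightarrow> continuous_on {a..} G \<and> (\<forall>t\<ge>a. exp (G t) = (f ^^ (N + n)) (g t)) \<and> (\<forall>t\<ge>a. \<kappa> < Re (G t))"
    for n and G :: "real \<Rightarrow> complex"
  have ex: "\<exists>G. P n G \<and> G t0 = w" if w: "exp w = (f ^^ (N + n)) (g t0)" for n w
  proof -
    obtain G where "continuous_on {a..} G" "\<And>t. t \<in> {a..} \<Longrightarrow> exp (G t) = (f ^^ (N + n)) (g t)" "G t0 = w"
      "\<And>t. t \<in> {a..} \<Longrightarrow> \<kappa> < Re (G t)"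
      by (rule lift_curve[OF continuous_on_iter_curve[OF g a(1), of "N + n"], of t0 w]) (use a N w in auto)
    then show ?thesis unfolding P_def by auto
  qed
  \<comment> \<open>The prescribed value is a logarithm at the next level, since
    \<open>f ^^ (N + Suc n)\<close> at g t0 equals \<open>f ^^ (N + n)\<close> at g s0.\<close>
  have "\<exists>G. \<forall>n. P n (G n) \<and> G (Suc n) t0 = G n s0"
  proof (rule dependent_nat_choice)
    have "0 < exp \<kappa>" by simp
    then have "(f ^^ (N + 0)) (g t0) \<noteq> 0" using N[of N t0] a by (metis add.right_neutral less_asym norm_zero order_refl)
    then have "exp (Ln ((f ^^ (N + 0)) (g t0))) = (f ^^ (N + 0)) (g t0)" by (rule exp_Ln)
    then show "\<exists>G. P 0 G" using ex by blast
  next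
    fix G n assume "P n G"
    then have "exp (G s0) = (f ^^ (N + n)) (g s0)" using a unfolding P_def by blast
    then have "exp (G s0) = (f ^^ (N + Suc n)) (g t0)" by (simp add: fg[symmetric] funpow_swap1)
    then show "\<exists>G'. P (Suc n) G' \<and> G' t0 = G s0" by (rule ex)
  qed
  then obtain G where G: "\<And>n. P n (G n)" "\<And>n. G (Suc n) t0 = G n s0" by blast
  have P: "continuous_on {a..} (G n)" "a \<le> t \<Longrightarrow> exp (G n t) = (f ^^ (N + n)) (g t)" "a \<le> t \<Longrightarrow> \<kappa> < Re (G n t)" for n t
    using G(1) unfolding P_def by blast+
  have ov: "over N g a G" using P(2) unfolding over_def by blast
  have FG: "F (G n t) = exp (G (Suc n) t)" if "a \<le> t" for n t using P(2)[OF that] by (simp add: F_def)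
  have GH: "G n t \<in> H" if "a \<le> t" for n t using P(3)[OF that] \<kappa>_H by blast
  have br: "\<exists>\<phi>. branch \<phi> \<and> (\<forall>t\<ge>a. \<phi> (G (Suc n) t) = G n t)" for n
  proof -
    obtain \<phi> where \<phi>: "branch \<phi>" "\<phi> (G (Suc n) t0) = G n t0"
      using branch_exists[OF GH[OF a(2)] FG[OF a(2)]] by blast
    have "\<phi> (G (Suc n) t) = G n t" if "a \<le> t" for t
      by (rule branch_lift[OF \<phi>(1), of "{a..}" "G n" "G (Suc n)" t0]) (use P(1) GH FG a that \<phi>(2) in auto)
    then show ?thesis using \<phi>(1) by blast
  qed
  then obtain \<phi> where \<phi>: "\<And>n. branch (\<phi> n)" "\<And>n t. a \<le> t \<Longrightarrow> \<phi> n (G (Suc n) t) = G n t" by metis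
  \<comment> \<open>At \<open>G (Suc n) s0\<close> the branches with index n + 1 and n both take the
    value \<open>G n s0\<close>.\<close>
  have same: "\<phi> n \<omega> = \<phi> 0 \<omega>" if "\<omega> \<in> H" for n \<omega>
    using that
  proof (induction n arbitrary: \<omega>)
    case (Suc n)
    have "\<phi> (Suc n) (G (Suc n) s0) = \<phi> n (G (Suc n) s0)"
      using \<phi>(2)[OF a(2), of "Suc n"] \<phi>(2)[OF a(3), of n] G(2) by simp
    then show ?case using branch_unique[OF \<phi>(1) \<phi>(1) GH[OF a(3)]] Suc by metis
  qed simp
  have st: "\<phi> 0 (G (Suc n) t0) = G n t0" for n
    using same[OF GH[OF a(2), of "Suc n"], of n] \<phi>(2)[OF a(2), of n] by simp
  have "tower (\<phi> 0) a G"
    by (rule tower_overI[OF g a(1) \<phi>(1) P(1) ov P(3) a(2) st])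
  then show thesis using ov G(2) by (rule that)
qed

text \<open>Noncriticality makes \<open>f ^^ N\<close> locally injective along g, and g is
  injective; so \<open>G 0\<close> is locally injective, as \<open>tower_ordered\<close>
  demands.\<close>

lemma over_ordered:
  assumes g: "escaping_curve f g" "noncritical_curve f g" and a: "0 < a" and G: "tower \<phi> a G" "over N g a G"
  shows "ordered a G"
proof (rule tower_ordered[OF G(1)])
  fix t assume t: "a \<le> t"
  have "deriv (f ^^ N) (g t) \<noteq> 0" using noncritical_iter_deriv(1)[OF g(2)] a t by simp
  then obtain r where r: "0 < r" "inj_on (f ^^ N) (ball (g t) r)" using locally_injective_at[OF iter_holo] by blast
  obtain e where e: "0 < e" "\<And>u. u \<in> {a..} \<Longrightarrow> dist u t < e \<Longrightarrow> dist (g u) (g t) < r"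
    using escaping_curveD(6)[OF g(1) a] r(1) t unfolding continuous_on_iff by (metis atLeast_iff)
  have "inj_on (G 0) ({a..} \<inter> ball t e)"
  proof (rule inj_onI)
    fix u v assume uv: "u \<in> {a..} \<inter> ball t e" "v \<in> {a..} \<inter> ball t e" "G 0 u = G 0 v"
    then have "(f ^^ N) (g u) = (f ^^ N) (g v)"
      using overD[OF G(2), of u 0] overD[OF G(2), of v 0] by simp
    moreover have "g u \<in> ball (g t) r" "g v \<in> ball (g t) r"
      using uv e(2)[of u] e(2)[of v] by (simp_all add: dist_commute)
    ultimately have "g u = g v" using inj_onD[OF r(2)] by blast
    then show "u = v" using inj_onD[OF escaping_curveD(2)[OF g(1)]] uv a by auto
  qed
  then show "\<exists>e>0. inj_on (G 0) ({a..} \<inter> ball t e)" using e(1) by blast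
qed

text \<open>The towers compare \<open>f ^^ N\<close> along g and h only. Since g is noncritical, the
  equality at y is continued through \<open>f ^^ N\<close> by \<open>lift_unique\<close>, which
  gives g = h \<circ> \<tau>.\<close>

lemma nested_reparam:
  assumes g: "escaping_curve f g" "noncritical_curve f g" and h: "escaping_curve f h" "noncritical_curve f h"
    and ab: "0 < a" "0 < b" and G: "tower \<phi> a G" "over N g a G" and K: "tower \<phi> b K" "over N h b K"
    and y: "a \<le> y" "b \<le> x" "g y = h x" "G 0 y = K 0 x"
    and freq: "\<exists>\<^sub>F n in sequentially. Re (K n b) \<le> Re (G n a)"
  shows "g ` {a..} \<subseteq> h ` {b..}"
proof -
  obtain \<tau> where \<tau>: "continuous_on {a..} \<tau>" "\<And>t. a \<le> t \<Longrightarrow> b \<le> \<tau> t" "\<And>t. a \<le> t \<Longrightarrow> K 0 (\<tau> t) = G 0 t"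
    using tower_reparam[OF G(1) K(1) over_ordered[OF g ab(1) G] over_ordered[OF h ab(2) K] freq] by metis
  have \<tau>y: "\<tau> y = x"
    using inj_onD[OF ordered_inj[OF K(1) over_ordered[OF h ab(2) K]], of "\<tau> y" x] \<tau>(2,3)[OF y(1)] y by simp
  have "g t = h (\<tau> t)" if t: "a \<le> t" for t
  proof (rule lift_unique[OF iter_holo[of N], of "{a..}" g "\<lambda>t. h (\<tau> t)" y])
    show "continuous_on {a..} g" by (rule escaping_curveD(6)[OF g(1) ab(1)])
    show "continuous_on {a..} (\<lambda>t. h (\<tau> t))"
      by (rule continuous_on_compose2[OF escaping_curveD(6)[OF h(1) ab(2)] \<tau>(1)]) (use \<tau>(2) in auto)
    show "(f ^^ N) (g u) = (f ^^ N) (h (\<tau> u))" if "u \<in> {a..}" for u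
      using overD[OF G(2), of u 0] overD[OF K(2), of "\<tau> u" 0] \<tau>(2,3)[of u] that by simp
    show "deriv (f ^^ N) (g u) \<noteq> 0" if "u \<in> {a..}" for u
      using noncritical_iter_deriv(1)[OF g(2)] that ab(1) by simp
  qed (use y t \<tau>y in auto)
  then show ?thesis using \<tau>(2) by auto
qed

section \<open>Fixed rays: disjointness and dynamics\<close>

lemma fixed_rayE:
  assumes "fixed_ray f X"
  obtains g where "ray_param f g" "X = g ` {0<..}" "f ` (g ` {0<..}) \<subseteq> g ` {0<..}"
  using assms unfolding fixed_ray_def ray_def by blast

lemma ray_paramD:
  assumes "ray_param f g"
  shows "escaping_curve f g" "noncritical_curve f g"
    "escaping_curve f h \<Longrightarrow> noncritical_curve f h \<Longrightarrow> g ` {0<..} \<subseteq> h ` {0<..} \<Longrightarrow> h ` {0<..} = g ` {0<..}"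
  using assms unfolding ray_param_def by blast+

text \<open>The tower of g, matched at the common point, gives one of h over the same branch. For
  every pair of small cut-offs a and b one of the two tails lies in the other ray. Letting the
  cut-offs tend to 0 puts one ray inside the other, and maximality makes them equal.\<close>

lemma fixed_ray_meet_eq:
  assumes XY: "fixed_ray f X" "fixed_ray f Y" and meet: "X \<inter> Y \<noteq> {}"
  shows "X = Y"
proof -
  obtain g where g: "ray_param f g" "X = g ` {0<..}" "f ` (g ` {0<..}) \<subseteq> g ` {0<..}" using fixed_rayE[OF XY(1)] by blast
  obtain h where h: "ray_param f h" "Y = h ` {0<..}" using fixed_rayE[OF XY(2)] by blast
  obtain y x where yx: "0 < y" "0 < x" "g y = h x" using meet g(2) h(2) by auto
  obtain s0 where s0: "0 < s0" "f (g y) = g s0" using g(3) yx(1) by (auto simp: image_subset_iff)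
  note eg = ray_paramD(1,2)[OF g(1)] and eh = ray_paramD(1,2)[OF h(1)]
  have nest: "g ` {a..} \<subseteq> Y \<or> h ` {b..} \<subseteq> X" if ab: "0 < a" "a \<le> y" "a \<le> s0" "0 < b" "b \<le> x" for a b
  proof -
    obtain N1 where N1: "\<And>n t. N1 \<le> n \<Longrightarrow> a \<le> t \<Longrightarrow> exp \<kappa> < norm ((f ^^ n) (g t))"
      using escaping_curve_large[OF eg(1) ab(1)] by blast
    obtain N2 where N2: "\<And>n t. N2 \<le> n \<Longrightarrow> b \<le> t \<Longrightarrow> exp \<kappa> < norm ((f ^^ n) (h t))"
      using escaping_curve_large[OF eh(1) ab(4)] by blast
    define N where "N = max N1 N2"
    have NG: "exp \<kappa> < norm ((f ^^ n) (g t))" if "N \<le> n" "a \<le> t" for n t using N1[of n t] that by (simp add: N_def)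
    have NH: "exp \<kappa> < norm ((f ^^ n) (h t))" if "N \<le> n" "b \<le> t" for n t using N2[of n t] that by (simp add: N_def)
    obtain \<phi> G where G: "tower \<phi> a G" "over N g a G"
      using self_tower[OF eg(1) ab(1-3) s0(2) NG] by blast
    obtain K where K: "tower \<phi> b K" "over N h b K" "\<And>n. K n x = G n y"
      using matched_tower[OF eh(1) ab(4,5) G ab(2) yx(3) NH] by blast
    show ?thesis
    proof (cases "\<exists>\<^sub>F n in sequentially. Re (K n b) \<le> Re (G n a)")
      case True
      have "g ` {a..} \<subseteq> h ` {b..}"
        by (rule nested_reparam[OF eg eh ab(1,4) G K(1,2) ab(2,5) yx(3) K(3)[symmetric] True])
      then show ?thesis using ab(4) h(2) by fastforce
    next
      case False
      then have "\<forall>\<^sub>F n in sequentially. Re (G n a) \<le> Re (K n b)"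
        unfolding not_frequently by eventually_elim simp
      then have fr: "\<exists>\<^sub>F n in sequentially. Re (G n a) \<le> Re (K n b)"
        by (simp add: eventually_frequently)
      have "h ` {b..} \<subseteq> g ` {a..}"
        by (rule nested_reparam[OF eh eg ab(4,1) K(1,2) G ab(5,2) yx(3)[symmetric] K(3) fr])
      then show ?thesis using ab(1) g(2) by fastforce
    qed
  qed
  show ?thesis
  proof (cases "\<forall>a. 0 < a \<and> a \<le> y \<and> a \<le> s0 \<longrightarrow> g ` {a..} \<subseteq> Y")
    case True
    have "X \<subseteq> Y"
    proof
      fix z assume "z \<in> X"
      then obtain t where t: "0 < t" "z = g t" using g(2) by auto
      have "g ` {min t (min y s0)..} \<subseteq> Y" by (rule True[rule_format]) (use t yx(1) s0(1) in auto)
      then show "z \<in> Y" using t(2) by auto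
    qed
    then show ?thesis using ray_paramD(3)[OF g(1) eh] g(2) h(2) by blast
  next
    case False
    \<comment> \<open>One tail of g is not contained in Y, so for this a the second alternative of
      \<open>nest\<close> holds for all b.\<close>
    then obtain a where a: "0 < a" "a \<le> y" "a \<le> s0" "\<not> g ` {a..} \<subseteq> Y" by blast
    have "Y \<subseteq> X"
    proof
      fix z assume "z \<in> Y"
      then obtain t where t: "0 < t" "z = h t" using h(2) by auto
      have "g ` {a..} \<subseteq> Y \<or> h ` {min t x..} \<subseteq> X" by (rule nest[OF a(1-3)]) (use t yx(2) in auto)
      then have "h ` {min t x..} \<subseteq> X" using a(4) by blast
      then show "z \<in> X" using t(2) by auto
    qed
    then show ?thesis using ray_paramD(3)[OF h(1) eg] g(2) h(2) by blast
  qed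
qed

text \<open>The shifted tower n \<mapsto> G (n + 1) belongs to f \<circ> g and follows the same
  branch, so \<sigma> is a reparametrisation as in \<open>tower_reparam\<close>. It moves every
  point outwards: if \<sigma> t \<le> t, then g t would have preimages of all orders on the tail
  from t on, which escapes uniformly.\<close>

lemma fixed_ray_dynamics:
  assumes g: "escaping_curve f g" "noncritical_curve f g" and inv: "f ` (g ` {0<..}) \<subseteq> g ` {0<..}"
  obtains \<sigma> where "continuous_on {0<..} \<sigma>" "\<And>s t. 0 < s \<Longrightarrow> s < t \<Longrightarrow> \<sigma> s < \<sigma> t" "\<And>t. 0 < t \<Longrightarrow> t < \<sigma> t"
    "\<And>t. 0 < t \<Longrightarrow> f (g t) = g (\<sigma> t)" "\<And>t0. 0 < t0 \<Longrightarrow> \<sigma> ` {t0..} = {\<sigma> t0..}"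
proof -
  have "\<forall>t. \<exists>s. 0 < t \<longrightarrow> 0 < s \<and> f (g t) = g s" using inv by (auto simp: image_subset_iff)
  then obtain \<sigma> where \<sigma>: "\<And>t. 0 < t \<Longrightarrow> 0 < \<sigma> t" "\<And>t. 0 < t \<Longrightarrow> f (g t) = g (\<sigma> t)" by metis
  have loc: "continuous_on {t0..} \<sigma> \<and> strict_mono_on {t0..} \<sigma> \<and> \<sigma> ` {t0..} = {\<sigma> t0..}" if t0: "0 < t0" for t0
  proof -
    define a where "a = min t0 (\<sigma> t0)"
    have a: "0 < a" "a \<le> t0" "a \<le> \<sigma> t0" using t0 \<sigma>(1) by (auto simp: a_def)
    obtain N where N: "\<And>n t. N \<le> n \<Longrightarrow> a \<le> t \<Longrightarrow> exp \<kappa> < norm ((f ^^ n) (g t))"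
      using escaping_curve_large[OF g(1) a(1)] by blast
    obtain \<phi> G where G: "tower \<phi> a G" "over N g a G" "\<And>n. G (Suc n) t0 = G n (\<sigma> t0)"
      using self_tower[OF g(1) a \<sigma>(2)[OF t0] N] by blast
    note ord = over_ordered[OF g a(1) G(1,2)]
    have T1: "tower \<phi> t0 (\<lambda>n. G (n + 1))" by (intro tower_restrict[OF tower_shift[OF G(1)] a(2)])
    have T2: "tower \<phi> (\<sigma> t0) G" by (rule tower_restrict[OF G(1) a(3)])
    have o1: "ordered t0 (\<lambda>n. G (n + 1))" by (rule ordered_restrict[OF ordered_shift[OF ord] a(2)])
    have o2: "ordered (\<sigma> t0) G" by (rule ordered_restrict[OF ord a(3)])
    \<comment> \<open>With the normalisation from \<open>self_tower\<close> the two starting points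
      are equal at every level.\<close>
    have fr: "\<exists>\<^sub>F n in sequentially. Re (G n (\<sigma> t0)) \<le> Re (G (n + 1) t0)" by (simp add: G(3))
    obtain \<tau> where \<tau>: "continuous_on {t0..} \<tau>" "strict_mono_on {t0..} \<tau>" "\<And>t. t0 \<le> t \<Longrightarrow> \<sigma> t0 \<le> \<tau> t"
      "\<And>t. t0 \<le> t \<Longrightarrow> G 0 (\<tau> t) = G (0 + 1) t" "\<tau> ` {t0..} = {\<tau> t0..}"
      using tower_reparam[OF T1 T2 o1 o2 fr] by metis
    have \<tau>0: "\<tau> t0 = \<sigma> t0"
      using inj_onD[OF ordered_inj[OF T2 o2], of "\<tau> t0" "\<sigma> t0"] \<tau>(3,4)[OF order_refl] G(3)[of 0] by simp
    have eq: "f (g t) = g (\<tau> t)" if t: "t0 \<le> t" for t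
    proof (rule lift_unique[OF iter_holo[of N], of "{t0..}" "\<lambda>t. f (g t)" "\<lambda>t. g (\<tau> t)" t0])
      show "continuous_on {t0..} (\<lambda>t. f (g t))" using continuous_on_iter_curve[OF g(1) t0, of 1] by simp
      show "continuous_on {t0..} (\<lambda>t. g (\<tau> t))"
        by (rule continuous_on_compose2[OF escaping_curveD(6)[OF g(1) \<sigma>(1)[OF t0]] \<tau>(1)]) (use \<tau>(3) in auto)
      show "(f ^^ N) (f (g u)) = (f ^^ N) (g (\<tau> u))" if "u \<in> {t0..}" for u
      proof -
        have u: "t0 \<le> u" "a \<le> u" "a \<le> \<tau> u" using that \<tau>(3)[of u] a by auto
        have "(f ^^ N) (g (\<tau> u)) = exp (G 0 (\<tau> u))" using overD[OF G(2) u(3), of 0] by simp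
        also have "\<dots> = exp (G 1 u)" using \<tau>(4)[OF u(1)] by simp
        also have "\<dots> = (f ^^ N) (f (g u))" using overD[OF G(2) u(2), of 1] by (simp add: funpow_swap1)
        finally show ?thesis by simp
      qed
      show "deriv (f ^^ N) (f (g u)) \<noteq> 0" if "u \<in> {t0..}" for u
        using noncritical_iter_deriv(2)[OF g(2)] that t0 by simp
    qed (use \<tau>0 \<sigma>(2)[OF t0] t in auto)
    have \<tau>\<sigma>: "\<tau> t = \<sigma> t" if "t0 \<le> t" for t
    proof (rule inj_onD[OF escaping_curveD(2)[OF g(1)]])
      show "g (\<tau> t) = g (\<sigma> t)" using eq[OF that] \<sigma>(2)[of t] that t0 by simp
      show "\<tau> t \<in> {0<..}" using \<tau>(3)[OF that] \<sigma>(1)[OF t0] by simp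
      show "\<sigma> t \<in> {0<..}" using \<sigma>(1)[of t] that t0 by simp
    qed
    have "continuous_on {t0..} \<sigma>" using \<tau>(1) continuous_on_cong[of "{t0..}" "{t0..}" \<tau> \<sigma>] \<tau>\<sigma> by simp
    then show ?thesis using \<tau>(2,5) \<tau>\<sigma>
      by (simp add: strict_mono_on_def image_cong[of "{t0..}" _ \<tau> \<sigma>])
  qed
  have up: "t < \<sigma> t" if t: "0 < t" for t
  proof (rule ccontr)
    assume "\<not> t < \<sigma> t"
    then have le: "\<sigma> t \<le> t" by simp
    have ret: "\<exists>u\<ge>t. (f ^^ n) (g u) = g t" for n
    proof (induction n)
      case (Suc n)
      then obtain u where u: "t \<le> u" "(f ^^ n) (g u) = g t" by blast
      then have "u \<in> \<sigma> ` {t..}" using loc[OF t] le by simp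
      then obtain v where "t \<le> v" "u = \<sigma> v" by auto
      then show ?case using u(2) \<sigma>(2)[of v] t by (intro exI[of _ v]) (simp add: funpow_swap1)
    qed auto
    have "\<forall>\<^sub>F n in sequentially. \<forall>u\<ge>t. norm (g t) + 1 \<le> norm ((f ^^ n) (g u))"
      by (rule escaping_curveD(5)[OF g(1) t])
    then obtain n where n: "\<forall>u\<ge>t. norm (g t) + 1 \<le> norm ((f ^^ n) (g u))"
      unfolding eventually_sequentially by blast
    obtain u where "t \<le> u" "(f ^^ n) (g u) = g t" using ret by blast
    then show False using n by fastforce
  qed
  have "continuous_on {0<..} \<sigma>"
    unfolding continuous_on_eq_continuous_at[OF open_greaterThan]
  proof
    fix t :: real assume t: "t \<in> {0<..}"
    have "continuous_on {t / 2<..} \<sigma>" using loc[of "t / 2"] t by (auto elim: continuous_on_subset)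
    moreover have "t \<in> {t / 2<..}" using t by simp
    ultimately show "isCont \<sigma> t" using continuous_on_eq_continuous_at[OF open_greaterThan] by blast
  qed
  moreover have "\<sigma> s < \<sigma> t" if "0 < s" "s < t" for s t
    using loc[OF that(1)] that(2) unfolding strict_mono_on_def by simp
  moreover have "\<sigma> ` {t0..} = {\<sigma> t0..}" if "0 < t0" for t0 using loc[OF that] by blast
  ultimately show thesis using up \<sigma>(2) by (intro that) blast+
qed


section \<open>Rays and tails far from the origin, and their landing\<close>

text \<open>Where g itself is far from the origin, one lift G suffices: f acts on it through
  \<sigma>, and the higher levels of its tower are G \<circ> \<open>\<sigma> ^^ n\<close>
  (\<open>tower_of_region\<close>).\<close>

lemma branch_region:
  fixes g :: "real \<Rightarrow> complex"
  assumes g: "continuous_on S g" and S: "convex S" and big: "\<And>t. t \<in> S \<Longrightarrow> exp \<kappa> < norm (g t)"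
    and \<sigma>: "continuous_on S \<sigma>" "\<And>t. t \<in> S \<Longrightarrow> \<sigma> t \<in> S" "\<And>t. t \<in> S \<Longrightarrow> f (g t) = g (\<sigma> t)"
    and t0: "t0 \<in> S" "exp w = g t0"
  obtains \<phi> G where "branch \<phi>" "continuous_on S G" "\<And>t. t \<in> S \<Longrightarrow> exp (G t) = g t" "G t0 = w"
    "\<And>t. t \<in> S \<Longrightarrow> \<kappa> < Re (G t)" "\<And>t. t \<in> S \<Longrightarrow> \<phi> (G (\<sigma> t)) = G t"
proof -
  obtain G where G: "continuous_on S G" "\<And>t. t \<in> S \<Longrightarrow> exp (G t) = g t" "G t0 = w" "\<And>t. t \<in> S \<Longrightarrow> \<kappa> < Re (G t)"
    by (rule lift_curve[OF g S big t0]) (assumption, rule that)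
  have FG: "F (G t) = exp (G (\<sigma> t))" if "t \<in> S" for t
    using G(2)[OF that] G(2)[OF \<sigma>(2)[OF that]] \<sigma>(3)[OF that] by (simp add: F_def)
  have GH: "G (\<sigma> t) \<in> H" if "t \<in> S" for t using G(4)[OF \<sigma>(2)[OF that]] \<kappa>_H by blast
  obtain \<phi> where \<phi>: "branch \<phi>" "\<phi> (G (\<sigma> t0)) = G t0"
    using branch_exists[OF GH[OF t0(1)] FG[OF t0(1)]] by blast
  have contG\<sigma>: "continuous_on S (\<lambda>t. G (\<sigma> t))"
    by (rule continuous_on_compose2[OF G(1) \<sigma>(1)]) (use \<sigma>(2) in auto)
  have eq: "\<phi> (G (\<sigma> t)) = G t" if "t \<in> S" for t
    by (rule branch_lift[OF \<phi>(1) convex_connected[OF S] G(1) contG\<sigma> GH FG t0(1) \<phi>(2) that])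
  show thesis by (rule that[OF \<phi>(1) G(1) G(2) G(3) G(4) eq])
qed

lemma tower_of_region:
  assumes g: "escaping_curve f g" and a: "0 < a" and \<phi>: "branch \<phi>"
    and \<sigma>: "continuous_on {a..} \<sigma>" "\<And>t. a \<le> t \<Longrightarrow> a \<le> \<sigma> t" "\<And>t. a \<le> t \<Longrightarrow> f (g t) = g (\<sigma> t)"
    and G: "continuous_on {a..} G" "\<And>t. a \<le> t \<Longrightarrow> exp (G t) = g t" "\<And>t. a \<le> t \<Longrightarrow> \<kappa> < Re (G t)"
      "\<And>t. a \<le> t \<Longrightarrow> \<phi> (G (\<sigma> t)) = G t"
  shows "tower \<phi> a (\<lambda>n t. G ((\<sigma> ^^ n) t))"
proof -
  have in_a: "a \<le> (\<sigma> ^^ n) t" if "a \<le> t" for n t using that \<sigma>(2) by (induction n) auto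
  have cont\<sigma>: "continuous_on {a..} (\<sigma> ^^ n)" for n
  proof (induction n)
    case (Suc n)
    have "continuous_on {a..} (\<lambda>t. \<sigma> ((\<sigma> ^^ n) t))"
      by (rule continuous_on_compose2[OF \<sigma>(1) Suc]) (use in_a in auto)
    then show ?case by (simp add: o_def)
  qed (simp add: id_def)
  have iter: "(f ^^ n) (g t) = g ((\<sigma> ^^ n) t)" if "a \<le> t" for n t
    using that \<sigma>(3) in_a by (induction n) auto
  show ?thesis
  proof (rule tower_overI[OF g a \<phi>, of _ 0 a])
    show "continuous_on {a..} (\<lambda>t. G ((\<sigma> ^^ n) t))" for n
      by (rule continuous_on_compose2[OF G(1) cont\<sigma>]) (use in_a in auto)
    show "over 0 g a (\<lambda>n t. G ((\<sigma> ^^ n) t))" unfolding over_def using G(2)[OF in_a] iter by simp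
    show "\<phi> (G ((\<sigma> ^^ Suc n) a)) = G ((\<sigma> ^^ n) a)" for n using G(4)[OF in_a[of a n]] by simp
  qed (use G(3) in_a in auto)
qed

lemma escaping_not_fixed: "z \<in> escaping_set f \<Longrightarrow> f z \<noteq> z"
proof
  assume z: "z \<in> escaping_set f" "f z = z"
  have "(f ^^ n) z = z" for n using z(2) by (induction n) auto
  then have "filterlim (\<lambda>n::nat. z) at_infinity sequentially" using z(1) by (simp add: escaping_set_def)
  then have "\<forall>\<^sub>F n::nat in sequentially. norm z + 1 \<le> norm z"
    unfolding filterlim_at_infinity[OF order_refl] by (metis add_nonneg_pos norm_ge_zero zero_less_one)
  then show False by simp
qed

text \<open>Maximality of the ray makes \<open>\<sigma>\<close> surjective, because \<open>exp \<circ> \<phi> \<circ> G\<close> extends the ray.\<close>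

lemma far_ray_surj:
  assumes g: "ray_param f g"
    and \<sigma>: "\<And>t. 0 < t \<Longrightarrow> t < \<sigma> t" "\<And>t. 0 < t \<Longrightarrow> f (g t) = g (\<sigma> t)" "\<And>t0. 0 < t0 \<Longrightarrow> \<sigma> ` {t0..} = {\<sigma> t0..}"
    and \<phi>: "branch \<phi>" and G: "continuous_on {0<..} G" "\<And>t. 0 < t \<Longrightarrow> exp (G t) = g t" "\<And>t. 0 < t \<Longrightarrow> \<kappa> < Re (G t)"
      "\<And>t. 0 < t \<Longrightarrow> \<phi> (G (\<sigma> t)) = G t"
    and s: "0 < s"
  shows "\<exists>t>0. \<sigma> t = s"
proof -
  note eg = ray_paramD(1,2)[OF g]
  \<comment> \<open>f \<circ> k = g transfers properties (a), (b) and (c) from g to the positive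
    iterates of k; the curve k itself is handled by k \<circ> \<sigma> = g and by |f (k t)| >
    R.\<close>
  define k where "k t = exp (\<phi> (G t))" for t
  have GH: "G t \<in> H" if "0 < t" for t using G(3)[OF that] \<kappa>_H by blast
  have \<sigma>pos: "0 < \<sigma> t" if "0 < t" for t using \<sigma>(1)[OF that] that by simp
  have fk: "f (k t) = g t" if "0 < t" for t
    using branchD(2)[OF \<phi> GH[OF that]] G(2)[OF that] by (simp add: k_def F_def)
  have k\<sigma>: "k (\<sigma> t) = g t" if "0 < t" for t using G(2,4)[OF that] by (simp add: k_def)
  have inj: "t = t'" if "0 < t" "0 < t'" "k t = k t'" for t t'
    using fk[OF that(1)] fk[OF that(2)] that inj_onD[OF escaping_curveD(2)[OF eg(1)]] by (metis greaterThan_iff)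
  have fSk: "(f ^^ Suc n) (k t) = (f ^^ n) (g t)" if "0 < t" for n t
    using fk[OF that] by (simp add: funpow_swap1)
  have esc: "escaping_curve f k"
    unfolding escaping_curve_def
  proof (intro conjI allI impI)
    show "continuous_on {0<..} k" unfolding k_def
      by (intro continuous_intros continuous_on_compose2[OF branchD(3)[OF \<phi>] G(1)]) (use GH in auto)
    show "inj_on k {0<..}" using inj by (auto intro!: inj_onI)
    show "k ` {0<..} \<subseteq> escaping_set f"
    proof
      fix w assume "w \<in> k ` {0<..}"
      then obtain t where t: "t \<in> {0<..}" "w = k t" by blast
      have "filterlim (\<lambda>n. (f ^^ n) (g t)) at_infinity sequentially"
        using escaping_curveD(3)[OF eg(1)] t by (simp add: escaping_set_def)
      then have "filterlim (\<lambda>n. (f ^^ Suc n) (k t)) at_infinity sequentially" using fSk t by simp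
      then have "filterlim (\<lambda>n. (f ^^ n) (k t)) at_infinity sequentially" 
        by (rule filterlim_sequentially_Suc[of "\<lambda>n. (f ^^ n) (k t)", THEN iffD1])
      then show "w \<in> escaping_set f" using t(2) by (simp add: escaping_set_def)
    qed
    show "filterlim (\<lambda>t. norm ((f ^^ n) (k t))) at_top at_top" for n
    proof (cases n)
      case 0
      have "filterlim (\<lambda>t. norm (k t)) at_top at_top"
        unfolding filterlim_at_top eventually_at_top_linorder
      proof
        fix B
        obtain T where T: "\<And>t. T \<le> t \<Longrightarrow> B \<le> norm (g t)"
          using escaping_curveD(7)[OF eg(1)] unfolding filterlim_at_top eventually_at_top_linorder by blast
        define T' where "T' = max T 1"
        have "B \<le> norm (k u)" if "\<sigma> T' \<le> u" for u
        proof -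
          have "u \<in> \<sigma> ` {T'..}" using \<sigma>(3)[of T'] that by (simp add: T'_def)
          then obtain t where t: "T' \<le> t" "u = \<sigma> t" by auto
          then have "k u = g t" using k\<sigma>[of t] by (simp add: T'_def)
          then show ?thesis using T[of t] t(1) by (simp add: T'_def)
        qed
        then show "\<exists>N. \<forall>u\<ge>N. B \<le> norm (k u)" by blast
      qed
      then show ?thesis using 0 by simp
    next
      case (Suc m)
      have "\<forall>\<^sub>F t in at_top. norm ((f ^^ m) (g t)) = norm ((f ^^ n) (k t))"
        using eventually_gt_at_top[of 0] by eventually_elim (use fSk Suc in simp)
      then show ?thesis using escaping_curveD(4)[OF eg(1), of m] by (simp cong: filterlim_cong)
    qed
    show "\<forall>\<^sub>F n in sequentially. \<forall>t\<ge>t0. M \<le> norm ((f ^^ n) (k t))" if "0 < t0" for t0 M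
    proof -
      have "\<forall>\<^sub>F n in sequentially. \<forall>t\<ge>t0. M \<le> norm ((f ^^ n) (g t))" by (rule escaping_curveD(5)[OF eg(1) that])
      then have "\<forall>\<^sub>F n in sequentially. \<forall>t\<ge>t0. M \<le> norm ((f ^^ Suc n) (k t))"
      proof eventually_elim
        case (elim n)
        then show ?case using fSk that by (metis less_le_trans)
      qed
      then show ?thesis
        by (rule eventually_sequentially_Suc[of "\<lambda>n. \<forall>t\<ge>t0. M \<le> norm ((f ^^ n) (k t))", THEN iffD1])
    qed
  qed
  have nc: "noncritical_curve f k"
    unfolding noncritical_curve_def critical_point_def
  proof (intro allI impI)
    fix t :: real and n assume t: "0 < t"
    show "deriv f ((f ^^ n) (k t)) \<noteq> 0"
    proof (cases n)
      case 0
      have "R < norm (f (k t))" using norm_exp_H[OF GH[OF t]] fk[OF t] G(2)[OF t] by simp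
      then show ?thesis using lifts_aboveD(2)[OF lifts] 0 by simp
    next
      case (Suc m)
      then show ?thesis using fSk[OF t, of m] eg(2) t unfolding noncritical_curve_def critical_point_def by metis
    qed
  qed
  have "g ` {0<..} \<subseteq> k ` {0<..}"
  proof
    fix z assume "z \<in> g ` {0<..}"
    then obtain t where "0 < t" "z = g t" by auto
    then show "z \<in> k ` {0<..}" using k\<sigma>[of t] \<sigma>pos[of t] by (metis greaterThan_iff imageI)
  qed
  then have "k ` {0<..} = g ` {0<..}" by (rule ray_paramD(3)[OF g esc nc])
  then obtain t where t: "0 < t" "k s = g t" using s by (metis greaterThan_iff imageE imageI)
  then have "k s = k (\<sigma> t)" using k\<sigma> by simp
  then have "s = \<sigma> t" by (rule inj[OF s \<sigma>pos[OF t(1)]])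
  then show ?thesis using t(1) by blast
qed

text \<open>The backward orbit t n of 1 under \<sigma> decreases to 0, since \<sigma> has no fixed
  point. Each backward step halves distances between values of G on the fundamental interval
  [t (n + 1), t n]; so G has a limit, which \<phi> fixes by continuity.\<close>

lemma far_ray_converges:
  fixes \<sigma> :: "real \<Rightarrow> real" and G :: "real \<Rightarrow> complex"
  assumes \<sigma>: "continuous_on {0<..} \<sigma>" "\<And>s t. 0 < s \<Longrightarrow> s < t \<Longrightarrow> \<sigma> s < \<sigma> t" "\<And>t. 0 < t \<Longrightarrow> t < \<sigma> t"
    "\<And>s. 0 < s \<Longrightarrow> \<exists>t>0. \<sigma> t = s"
    and \<phi>: "branch \<phi>" and G: "continuous_on {0<..} G" "\<And>t. 0 < t \<Longrightarrow> \<kappa> < Re (G t)" "\<And>t. 0 < t \<Longrightarrow> \<phi> (G (\<sigma> t)) = G t"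
  obtains \<zeta> where "(G \<longlongrightarrow> \<zeta>) (at_right 0)" "\<kappa> \<le> Re \<zeta>" "\<phi> \<zeta> = \<zeta>"
proof -
  have "\<forall>s. \<exists>t. 0 < s \<longrightarrow> 0 < t \<and> \<sigma> t = s" using \<sigma>(4) by blast
  then obtain \<tau> where \<tau>: "\<And>s. 0 < s \<Longrightarrow> 0 < \<tau> s" "\<And>s. 0 < s \<Longrightarrow> \<sigma> (\<tau> s) = s" by metis
  define t where "t n = (\<tau> ^^ n) 1" for n
  have t0: "t 0 = 1" and tS: "t (Suc n) = \<tau> (t n)" for n by (simp_all add: t_def)
  have tpos: "0 < t n" for n by (induction n) (simp_all add: t0 tS \<tau>)
  have \<sigma>t: "\<sigma> (t (Suc n)) = t n" for n using \<tau>(2)[OF tpos] by (simp add: tS)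
  have dec: "t (Suc n) < t n" for n using \<sigma>(3)[OF tpos[of "Suc n"]] by (simp add: \<sigma>t)
  have "decseq t" using dec by (intro decseq_SucI) (simp add: less_imp_le)
  then obtain l where l: "t \<longlonglongrightarrow> l" "\<And>n. l \<le> t n"
    using decseq_convergent[of t 0] tpos by (metis less_imp_le)
  have l0: "l = 0"
  proof (rule ccontr)
    assume "l \<noteq> 0"
    moreover have "0 \<le> l" by (rule LIMSEQ_le_const[OF l(1)]) (use tpos in \<open>auto intro: less_imp_le\<close>)
    ultimately have lp: "0 < l" by simp
    have "isCont \<sigma> l" using \<sigma>(1) lp continuous_on_eq_continuous_at[OF open_greaterThan] by blast
    then have "(\<lambda>n. \<sigma> (t (Suc n))) \<longlonglongrightarrow> \<sigma> l" using LIMSEQ_Suc[OF l(1)] by (rule isCont_tendsto_compose)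
    then have "t \<longlonglongrightarrow> \<sigma> l" by (simp add: \<sigma>t)
    then have "l = \<sigma> l" by (rule LIMSEQ_unique[OF l(1)])
    then show False using \<sigma>(3)[OF lp] by linarith
  qed
  have contr: "norm (G s - G s') \<le> norm (G (\<sigma> s) - G (\<sigma> s')) / 2" if "0 < s" "0 < s'" for s s'
  proof -
    have p: "0 < \<sigma> s" "0 < \<sigma> s'" using \<sigma>(3)[OF that(1)] \<sigma>(3)[OF that(2)] that by auto
    have "norm (\<phi> (G (\<sigma> s)) - \<phi> (G (\<sigma> s'))) \<le> 48 / 96 * norm (G (\<sigma> s) - G (\<sigma> s'))"
      by (rule branch_Lipschitz[OF \<phi>]) (use G(2)[OF p(1)] G(2)[OF p(2)] in \<open>auto simp: \<kappa>_def\<close>)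
    then show ?thesis using G(3) that by simp
  qed
  have "compact (G ` {t 1..1})"
    by (intro compact_continuous_image continuous_on_subset[OF G(1)]) (use tpos[of 1] in auto)
  then obtain B where B: "\<And>s. t 1 \<le> s \<Longrightarrow> s \<le> 1 \<Longrightarrow> norm (G s) \<le> B"
    using compact_imp_bounded by (fastforce simp: bounded_iff)
  have B0: "0 \<le> B" using B[of 1] dec[of 0] by (simp add: t0 order_trans[OF norm_ge_zero])
  have lev: "norm (G s - G (t n)) \<le> 2 * B / 2 ^ n" if "t (Suc n) \<le> s" "s \<le> t n" for s n
    using that
  proof (induction n arbitrary: s)
    case 0
    then have "norm (G s) \<le> B" "norm (G (t 0)) \<le> B" using B[of s] B[of 1] dec[of 0] by (simp_all add: t0)
    then show ?case using norm_triangle_ineq4[of "G s" "G (t 0)"] by simp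
  next
    case (Suc n)
    have s: "0 < s" using Suc.prems tpos[of "Suc (Suc n)"] by linarith
    have mono: "\<sigma> u \<le> \<sigma> v" if "0 < u" "u \<le> v" for u v using \<sigma>(2)[OF that(1), of v] that(2) by (cases "u = v") auto
    have "t (Suc n) \<le> \<sigma> s" "\<sigma> s \<le> t n"
      using mono[OF tpos Suc.prems(1)] mono[OF s Suc.prems(2)] by (simp_all add: \<sigma>t)
    then have "norm (G (\<sigma> s) - G (t n)) \<le> 2 * B / 2 ^ n" by (rule Suc.IH)
    moreover have "norm (G s - G (t (Suc n))) \<le> norm (G (\<sigma> s) - G (t n)) / 2"
      using contr[OF s tpos[of "Suc n"]] by (simp add: \<sigma>t)
    ultimately show ?case by simp
  qed
  have "summable (\<lambda>n. G (t (Suc n)) - G (t n))"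
  proof (rule summable_comparison_test)
    show "\<exists>N. \<forall>n\<ge>N. norm (G (t (Suc n)) - G (t n)) \<le> 2 * B * (1 / 2) ^ n"
      using lev[OF order_refl less_imp_le[OF dec]] by (intro exI[of _ 0] allI impI) (simp add: power_divide)
    show "summable (\<lambda>n. 2 * B * (1 / 2) ^ n :: real)" by (intro summable_mult summable_geometric) simp
  qed
  then have "convergent (\<lambda>n. \<Sum>i<n. G (t (Suc i)) - G (t i))" by (simp add: summable_iff_convergent)
  then have "convergent (\<lambda>n. G (t n) - G (t 0))" by (simp only: sum_lessThan_telescope[of "\<lambda>i. G (t i)"])
  then obtain \<zeta>0 where "(\<lambda>n. G (t n) - G (t 0)) \<longlonglongrightarrow> \<zeta>0" unfolding convergent_def by blast
  then have "(\<lambda>n. G (t n) - G (t 0) + G (t 0)) \<longlonglongrightarrow> \<zeta>0 + G (t 0)" by (intro tendsto_intros)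
  then obtain \<zeta> where \<zeta>: "(\<lambda>n. G (t n)) \<longlonglongrightarrow> \<zeta>" by simp
  have ex: "\<exists>n\<ge>N. t (Suc n) \<le> s \<and> s \<le> t n" if "0 < s" "s \<le> t N" for s N
  proof -
    have "\<forall>\<^sub>F n in sequentially. t n < s" using order_tendstoD(2)[OF l(1), of s] l0 that(1) by simp
    then obtain n where n: "t n < s" unfolding eventually_sequentially by blast
    \<comment> \<open>With the first index m such that t m < s, the point s lies in the fundamental
      interval [t m, t (m - 1)].\<close>
    define m where "m = (LEAST n. t n < s)"
    have m1: "t m < s" unfolding m_def by (rule LeastI[of "\<lambda>n. t n < s", OF n])
    have m2: "s \<le> t k" if "k < m" for k
      using not_less_Least[of k "\<lambda>n. t n < s"] that unfolding m_def by (simp add: not_less)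
    have "N < m"
    proof (rule ccontr)
      assume "\<not> N < m"
      then have "t N \<le> t m" using \<open>decseq t\<close> by (simp add: decseq_def)
      then show False using m1 \<open>s \<le> t N\<close> by linarith
    qed
    then obtain k where "m = Suc k" "N \<le> k" by (cases m) auto
    then show ?thesis using m1 m2[of k] by (intro exI[of _ k]) simp
  qed
  have lim: "(G \<longlongrightarrow> \<zeta>) (at_right 0)"
  proof (rule tendstoI)
    fix e :: real assume e: "0 < e"
    have "\<forall>\<^sub>F n in sequentially. dist (G (t n)) \<zeta> < e / 2" using tendstoD[OF \<zeta>, of "e / 2"] e by simp
    moreover have "(\<lambda>n. 2 * B * (1 / 2) ^ n) \<longlonglongrightarrow> 2 * B * 0" by (intro tendsto_intros LIMSEQ_realpow_zero) auto
    then have "\<forall>\<^sub>F n in sequentially. 2 * B * (1 / 2) ^ n < e / 2" using e by (intro order_tendstoD(2)) auto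
    ultimately have "\<forall>\<^sub>F n in sequentially. dist (G (t n)) \<zeta> < e / 2 \<and> 2 * B * (1 / 2) ^ n < e / 2" by (rule eventually_conj)
    then obtain N where N: "\<And>n. N \<le> n \<Longrightarrow> dist (G (t n)) \<zeta> < e / 2 \<and> 2 * B * (1 / 2) ^ n < e / 2"
      unfolding eventually_sequentially by blast
    have "dist (G s) \<zeta> < e" if s: "0 < s" "s < t N" for s
    proof -
      obtain n where n: "N \<le> n" "t (Suc n) \<le> s" "s \<le> t n" using ex[of s N] s by auto
      have "dist (G s) (G (t n)) < e / 2" using lev[OF n(2,3)] N[OF n(1)] by (simp add: dist_norm power_divide)
      then show ?thesis using N[OF n(1)] dist_triangle[of "G s" \<zeta> "G (t n)"] by simp
    qed
    then show "\<forall>\<^sub>F s in at_right 0. dist (G s) \<zeta> < e"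
      unfolding eventually_at_right_field using tpos[of N] by blast
  qed
  have Re\<zeta>: "\<kappa> \<le> Re \<zeta>"
    by (rule tendsto_lowerbound[OF tendsto_Re[OF \<zeta>]]) (use G(2) tpos in \<open>auto intro!: always_eventually less_imp_le\<close>)
  have \<zeta>H: "\<zeta> \<in> H" using Re\<zeta> by (simp add: mem_H \<kappa>_def)
  have "(\<lambda>n. \<phi> (G (t n))) \<longlonglongrightarrow> \<phi> \<zeta>" by (rule isCont_tendsto_compose[OF isCont_branch[OF \<phi> \<zeta>H] \<zeta>])
  moreover have "\<phi> (G (t n)) = G (t (Suc n))" for n using G(3)[OF tpos[of "Suc n"]] by (simp add: \<sigma>t)
  ultimately have "(\<lambda>n. G (t (Suc n))) \<longlonglongrightarrow> \<phi> \<zeta>" by simp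
  then have "\<phi> \<zeta> = \<zeta>" by (rule LIMSEQ_unique[OF _ LIMSEQ_Suc[OF \<zeta>]])
  then show thesis using that[OF lim Re\<zeta>] by blast
qed

text \<open>Differentiating \<open>F (\<phi> \<omega>) = exp \<omega>\<close> at the fixed point
  gives f' \<phi>' = 1, and |\<phi>'| \<le> 48 / 96 there.\<close>

lemma branch_fixed_point_repelling:
  assumes \<phi>: "branch \<phi>" and \<zeta>: "\<kappa> \<le> Re \<zeta>" "\<phi> \<zeta> = \<zeta>"
  shows "repelling_fixed_point f (exp \<zeta>)"
proof -
  have \<zeta>H: "\<zeta> \<in> H" using \<zeta>(1) by (simp add: mem_H \<kappa>_def)
  have fp: "f (exp \<zeta>) = exp \<zeta>" using branchD(2)[OF \<phi> \<zeta>H] \<zeta>(2) by (simp add: F_def)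
  have d\<phi>: "(\<phi> has_field_derivative deriv \<phi> \<zeta>) (at \<zeta>)" by (rule holomorphic_derivI[OF branchD(1)[OF \<phi>] open_H \<zeta>H])
  have dF: "(F has_field_derivative deriv F \<zeta>) (at \<zeta>)" by (rule holomorphic_derivI[OF F_holo open_UNIV UNIV_I])
  have "((\<lambda>\<omega>. F (\<phi> \<omega>)) has_field_derivative deriv F \<zeta> * deriv \<phi> \<zeta>) (at \<zeta>)"
    using DERIV_chain2[of F "deriv F \<zeta>" \<phi> \<zeta>] dF d\<phi> \<zeta>(2) by simp
  moreover have "\<forall>\<^sub>F \<omega> in nhds \<zeta>. F (\<phi> \<omega>) = exp \<omega>"
    unfolding eventually_nhds using open_H \<zeta>H branchD(2)[OF \<phi>] by blast
  ultimately have "(exp has_field_derivative deriv F \<zeta> * deriv \<phi> \<zeta>) (at \<zeta>)"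
    using DERIV_cong_ev[OF refl, of "\<lambda>\<omega>. F (\<phi> \<omega>)" exp \<zeta>] by blast
  then have "deriv F \<zeta> * deriv \<phi> \<zeta> = exp \<zeta>" using DERIV_unique[OF _ DERIV_exp] by blast
  then have "deriv f (exp \<zeta>) * deriv \<phi> \<zeta> * exp \<zeta> = 1 * exp \<zeta>" by (simp add: deriv_F mult_ac)
  then have "deriv f (exp \<zeta>) * deriv \<phi> \<zeta> = 1" by (metis exp_not_eq_zero mult_right_cancel)
  then have n1: "norm (deriv f (exp \<zeta>)) * norm (deriv \<phi> \<zeta>) = 1" by (metis norm_mult norm_one)
  have "norm (deriv \<phi> \<zeta>) \<le> 48 / (Re \<zeta> - \<rho>)" by (rule branch_deriv_bound[OF \<phi> \<zeta>H])
  also have "\<dots> \<le> 48 / 96" using \<zeta>(1) by (intro divide_left_mono) (auto simp: \<kappa>_def)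
  finally have "norm (deriv \<phi> \<zeta>) \<le> 1 / 2" by simp
  then have "norm (deriv f (exp \<zeta>)) * norm (deriv \<phi> \<zeta>) \<le> norm (deriv f (exp \<zeta>)) * (1 / 2)" by (intro mult_left_mono) auto
  then have "1 < norm (deriv f (exp \<zeta>))" using n1 by simp
  then show ?thesis using fp by (simp add: repelling_fixed_point_def)
qed

text \<open>The levels of the noncritical curve \<open>g\<close> control those of \<open>h\<close>, which may pass through critical points.\<close>

lemma curve_through_ray_point:
  assumes g: "escaping_curve f g" "noncritical_curve f g" and fg: "f (g y) = g s0" "0 < y" "0 < s0"
    and h: "escaping_curve f h" and x: "0 < x" "h x = g y"
  obtains e where "0 < e" "\<And>s. \<bar>s - x\<bar> < e \<Longrightarrow> h s \<in> g ` {0<..}"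
proof -
  define a b where "a = min y s0 / 2" and "b = x / 2"
  have a: "0 < a" "a < y" "a \<le> y" "a \<le> s0" and b: "0 < b" "b < x" using fg x by (auto simp: a_def b_def)
  obtain N1 where N1: "\<And>n t. N1 \<le> n \<Longrightarrow> a \<le> t \<Longrightarrow> exp \<kappa> < norm ((f ^^ n) (g t))"
    using escaping_curve_large[OF g(1) a(1)] by blast
  obtain N2 where N2: "\<And>n t. N2 \<le> n \<Longrightarrow> b \<le> t \<Longrightarrow> exp \<kappa> < norm ((f ^^ n) (h t))"
    using escaping_curve_large[OF h b(1)] by blast
  define N where "N = max N1 N2"
  have NG: "exp \<kappa> < norm ((f ^^ n) (g t))" if "N \<le> n" "a \<le> t" for n t using N1[of n t] that by (simp add: N_def)
  have NH: "exp \<kappa> < norm ((f ^^ n) (h t))" if "N \<le> n" "b \<le> t" for n t using N2[of n t] that by (simp add: N_def)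
  obtain \<phi> G where G: "tower \<phi> a G" "over N g a G"
    using self_tower[OF g(1) a(1,3,4) fg(1) NG] by blast
  obtain K where K: "tower \<phi> b K" "over N h b K" "\<And>n. K n x = G n y"
    using matched_tower[OF h b(1) less_imp_le[OF b(2)] G a(3) x(2)[symmetric] NH] by blast
  have ord: "ordered a G" by (rule over_ordered[OF g a(1) G])
  note injG = ordered_inj[OF G(1) ord]
  \<comment> \<open>Distance at level 0 between the cut-off point of the ray and the common point.
    For s near x the point \<open>K 0 s\<close> is within d / 2 of the latter, so it stays away from
    the former.\<close>
  define d where "d = norm (G 0 a - G 0 y)"
  have d: "0 < d" using inj_onD[OF injG, of a y] a by (auto simp: d_def)
  have "continuous_on {b<..} (K 0)" by (rule continuous_on_subset[OF towerD(2)[OF K(1)]]) auto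
  then have "isCont (K 0) x" using b(2) continuous_on_eq_continuous_at[OF open_greaterThan] by blast
  then have "\<forall>\<^sub>F s in at x. dist (K 0 s) (K 0 x) < d / 2" using d by (intro tendstoD) (auto simp: isCont_def)
  then obtain e' where e': "0 < e'" "\<And>s. s \<noteq> x \<Longrightarrow> dist s x < e' \<Longrightarrow> dist (K 0 s) (K 0 x) < d / 2"
    unfolding eventually_at by auto
  define e where "e = min e' (x - b)"
  have e: "0 < e" using e'(1) b by (simp add: e_def)
  have near: "norm (K 0 s - K 0 x) < d / 2" if "\<bar>s - x\<bar> < e" for s
    using e'(2)[of s] that d by (cases "s = x") (auto simp: e_def dist_norm)
  have sb: "b < s" if "\<bar>s - x\<bar> < e" for s using that by (auto simp: e_def)
  obtain D where D: "0 \<le> D" "\<And>n s t. a \<le> t \<Longrightarrow> b \<le> s \<Longrightarrow> Re (G (Suc n) t) = Re (K (Suc n) s) \<Longrightarrow>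
     norm (G 0 t - K 0 s) \<le> D / 2 ^ n" using tower_close[OF G(1) K(1)] by blast
  \<comment> \<open>If \<open>K n s\<close> were eventually left of \<open>G n a\<close>, then,
    \<open>K n x\<close> = \<open>G n y\<close> being to the right of it, K n would cross the level
    of \<open>G n a\<close> at some u between s and x. By \<open>tower_close\<close> the point
    \<open>K 0 u\<close> is within d / 2 of \<open>G 0 a\<close>, contrary to the choice of
    e.\<close>
  have freq: "\<exists>\<^sub>F n in sequentially. Re (G n a) \<le> Re (K n s)" if s: "\<bar>s - x\<bar> < e" for s
  proof (rule ccontr)
    assume "\<not> ?thesis"
    then have "\<forall>\<^sub>F n in sequentially. \<not> Re (G n a) \<le> Re (K n s)" by (simp add: not_frequently)
    moreover have "\<forall>\<^sub>F n in sequentially. Re (G n a) < Re (G n y)" using ord a unfolding ordered_def by simp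
    moreover have "(\<lambda>n. D * (1 / 2) ^ n) \<longlonglongrightarrow> D * 0" by (intro tendsto_intros LIMSEQ_realpow_zero) auto
    then have "\<forall>\<^sub>F n in sequentially. D * (1 / 2) ^ n < d / 2" using d by (intro order_tendstoD(2)) auto
    ultimately have "\<forall>\<^sub>F n in sequentially. Re (K n s) < Re (G n a) \<and> Re (G n a) < Re (K n x) \<and> D * (1 / 2) ^ n < d / 2"
      by eventually_elim (simp add: K(3))
    then obtain m where m: "\<And>n. m \<le> n \<Longrightarrow> Re (K n s) < Re (G n a) \<and> Re (G n a) < Re (K n x) \<and> D * (1 / 2) ^ n < d / 2"
      unfolding eventually_sequentially by blast
    have lev: "Re (K (Suc m) s) < Re (G (Suc m) a)" "Re (G (Suc m) a) < Re (K (Suc m) x)" "D * (1 / 2) ^ m < d / 2"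
      using m[of "Suc m"] m[of m] by auto
    have cont: "continuous_on (closed_segment s x) (\<lambda>u. Re (K (Suc m) u))"
      by (intro continuous_intros continuous_on_subset[OF towerD(2)[OF K(1)]])
         (use sb[OF s] b(2) in \<open>auto simp: closed_segment_eq_real_ivl split: if_splits\<close>)
    have "connected ((\<lambda>u. Re (K (Suc m) u)) ` closed_segment s x)" by (intro connected_continuous_image cont connected_segment)
    then have "Re (G (Suc m) a) \<in> (\<lambda>u. Re (K (Suc m) u)) ` closed_segment s x"
      using connectedD_interval[of _ "Re (K (Suc m) s)" "Re (K (Suc m) x)" "Re (G (Suc m) a)"] lev by auto
    then obtain u where u: "u \<in> closed_segment s x" "Re (G (Suc m) a) = Re (K (Suc m) u)" by auto
    have ux: "\<bar>u - x\<bar> < e" using u(1) s by (auto simp: closed_segment_eq_real_ivl split: if_splits)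
    have "norm (G 0 a - K 0 u) \<le> D / 2 ^ m" using D(2)[OF order_refl _ u(2)] sb[OF ux] by simp
    moreover have "D / 2 ^ m = D * (1 / 2) ^ m" by (simp add: power_divide)
    ultimately have "norm (G 0 a - K 0 u) < d / 2" using lev(3) by linarith
    moreover have "norm (K 0 u - G 0 y) < d / 2" using near[OF ux] K(3) by simp
    ultimately show False using norm_triangle_ineq[of "G 0 a - K 0 u" "K 0 u - G 0 y"] by (simp add: d_def)
  qed
  define S where "S = {x - e<..<x + e}"
  have S: "\<bar>s - x\<bar> < e" if "s \<in> S" for s using that by (auto simp: S_def)
  have "\<exists>t\<ge>a. G 0 t = K 0 s" if "s \<in> S" for s
    using tower_level[OF K(1) G(1) less_imp_le[OF sb[OF S[OF that]]] order_refl freq[OF S[OF that]]] .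
  then obtain \<tau> where \<tau>: "\<And>s. s \<in> S \<Longrightarrow> a \<le> \<tau> s" "\<And>s. s \<in> S \<Longrightarrow> G 0 (\<tau> s) = K 0 s" by metis
  have contK: "continuous_on S (K 0)"
    by (rule continuous_on_subset[OF towerD(2)[OF K(1)]]) (use sb[OF S] in \<open>auto intro: less_imp_le\<close>)
  have cont\<tau>: "continuous_on S \<tau>"
    by (rule continuous_on_param[OF towerD(2,7)[OF G(1)] injG contK]) (use \<tau> in auto)
  have xS: "x \<in> S" using e by (simp add: S_def)
  have \<tau>x: "\<tau> x = y" using inj_onD[OF injG, of "\<tau> x" y] \<tau>[OF xS] K(3)[of 0] a by simp
  have eq: "g (\<tau> s) = h s" if s: "s \<in> S" for s
  proof (rule lift_unique[OF iter_holo[of N], of S "\<lambda>s. g (\<tau> s)" h x])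
    show "connected S" by (simp add: S_def)
    show "continuous_on S (\<lambda>s. g (\<tau> s))"
      by (rule continuous_on_compose2[OF escaping_curveD(6)[OF g(1) a(1)] cont\<tau>]) (use \<tau>(1) in auto)
    show "continuous_on S h"
      by (rule continuous_on_subset[OF escaping_curveD(6)[OF h b(1)]]) (use sb[OF S] in \<open>auto intro: less_imp_le\<close>)
    show "(f ^^ N) (g (\<tau> u)) = (f ^^ N) (h u)" if "u \<in> S" for u
      using overD[OF G(2) \<tau>(1)[OF that], of 0] overD[OF K(2) less_imp_le[OF sb[OF S[OF that]]], of 0] \<tau>(2)[OF that] by simp
    show "deriv (f ^^ N) (g (\<tau> u)) \<noteq> 0" if "u \<in> S" for u
      using noncritical_iter_deriv(1)[OF g(2)] \<tau>(1)[OF that] a(1) by simp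
  qed (use xS \<tau>x x(2) s in auto)
  show thesis
  proof (rule that[OF e])
    fix s assume "\<bar>s - x\<bar> < e"
    then have "s \<in> S" by (auto simp: S_def)
    then show "h s \<in> g ` {0<..}" using eq[of s] \<tau>(1)[of s] a(1) by (metis greaterThan_iff imageI less_le_trans)
  qed
qed

text \<open>The parameters at which a longer curve h runs on the ray form a clopen set: closed
  because the closure of the ray adds only z, which does not escape, and open by
  \<open>curve_through_ray_point\<close>. So h never leaves the ray.\<close>

lemma landing_not_broken:
  assumes g: "ray_param f g" "f ` (g ` {0<..}) \<subseteq> g ` {0<..}"
    and cl: "closure (g ` {0<..}) = insert z (g ` {0<..})" and z: "z \<notin> escaping_set f"
  shows "\<not> broken f (g ` {0<..})"
proof
  assume "broken f (g ` {0<..})"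
  then obtain h where h: "escaping_curve f h" "g ` {0<..} \<subset> h ` {0<..}" unfolding broken_def by blast
  note eg = ray_paramD(1,2)[OF g(1)]
  define J where "J = {0<..} \<inter> h -` (g ` {0<..})"
  have "J = {0<..} \<inter> h -` closure (g ` {0<..})"
    using escaping_curveD(3)[OF h(1)] z unfolding J_def cl by auto
  then have "closedin (top_of_set {0<..}) J"
    using continuous_closedin_preimage[OF escaping_curveD(1)[OF h(1)] closed_closure] by simp
  moreover have "openin (top_of_set {0<..}) J"
  proof (rule open_subset)
    show "open J"
      unfolding open_dist
    proof
      fix x assume "x \<in> J"
      then obtain y where y: "0 < x" "0 < y" "h x = g y" by (auto simp: J_def)
      obtain s0 where s0: "0 < s0" "f (g y) = g s0" using g(2) y(2) by (auto simp: image_subset_iff)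
      obtain e where e: "0 < e" "\<And>s. \<bar>s - x\<bar> < e \<Longrightarrow> h s \<in> g ` {0<..}"
        using curve_through_ray_point[OF eg s0(2) y(2) s0(1) h(1) y(1,3)] by blast
      show "\<exists>e>0. \<forall>s. dist s x < e \<longrightarrow> s \<in> J"
      proof (intro exI[of _ "min e x"] conjI allI impI)
        fix s assume "dist s x < min e x"
        then have "\<bar>s - x\<bar> < e" "0 < s" by (auto simp: dist_norm)
        then show "s \<in> J" using e(2) by (simp add: J_def)
      qed (use e y in simp)
    qed
  qed (simp add: J_def)
  ultimately have "J = {} \<or> J = {0<..}"
    using connected_clopen[of "{0::real<..}"] by (simp add: convex_connected)
  moreover have "J \<noteq> {}"
  proof -
    have "g 1 \<in> g ` {0<..}" by simp
    then have "g 1 \<in> h ` {0<..}" using h(2) by blast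
    then obtain x where "0 < x" "g 1 = h x" by auto
    then have "x \<in> J" using \<open>g 1 \<in> g ` {0<..}\<close> by (simp add: J_def)
    then show ?thesis by blast
  qed
  ultimately have "J = {0<..}" by blast
  then have "h ` {0<..} \<subseteq> g ` {0<..}" by (auto simp: J_def)
  then show False using h(2) by blast
qed

lemma far_ray_lands:
  assumes Rf: "fixed_ray f X" and far: "X \<inter> cball 0 (exp \<kappa>) = {}"
  obtains \<zeta> \<phi> g G where "lands_at f X (exp \<zeta>)" "repelling_fixed_point f (exp \<zeta>)" "branch \<phi>" "\<zeta> \<in> H" "\<phi> \<zeta> = \<zeta>"
    "X = g ` {0<..}" "tower \<phi> 1 G" "\<And>t. 1 \<le> t \<Longrightarrow> exp (G 0 t) = g t"
proof -
  obtain g where g: "ray_param f g" "X = g ` {0<..}" "f ` (g ` {0<..}) \<subseteq> g ` {0<..}" using fixed_rayE[OF Rf] by blast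
  note eg = ray_paramD(1,2)[OF g(1)]
  obtain \<sigma> where \<sigma>: "continuous_on {0<..} \<sigma>" "\<And>s t. 0 < s \<Longrightarrow> s < t \<Longrightarrow> \<sigma> s < \<sigma> t" "\<And>t. 0 < t \<Longrightarrow> t < \<sigma> t"
    "\<And>t. 0 < t \<Longrightarrow> f (g t) = g (\<sigma> t)" "\<And>t0. 0 < t0 \<Longrightarrow> \<sigma> ` {t0..} = {\<sigma> t0..}"
    using fixed_ray_dynamics[OF eg g(3)] by blast
  have big: "exp \<kappa> < norm (g t)" if "0 < t" for t
    using far that unfolding g(2) by (force simp: not_le[symmetric])
  have \<sigma>pos: "0 < \<sigma> t" if "0 < t" for t using \<sigma>(3)[OF that] that by simp
  have "g 1 \<noteq> 0" using big[of 1] exp_gt_zero[of \<kappa>] by (metis less_asym norm_zero zero_less_one)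
  then have Ln: "exp (Ln (g 1)) = g 1" by (rule exp_Ln)
  obtain \<phi> G where G: "branch \<phi>" "continuous_on {0<..} G" "\<And>t. t \<in> {0<..} \<Longrightarrow> exp (G t) = g t"
    "\<And>t. t \<in> {0<..} \<Longrightarrow> \<kappa> < Re (G t)" "\<And>t. t \<in> {0<..} \<Longrightarrow> \<phi> (G (\<sigma> t)) = G t"
    by (rule branch_region[OF escaping_curveD(1)[OF eg(1)] _ _ \<sigma>(1) _ _ _ Ln]) (use big \<sigma>pos \<sigma>(4) in auto)
  have surj: "\<exists>t>0. \<sigma> t = s" if "0 < s" for s
    by (rule far_ray_surj[OF g(1) \<sigma>(3,4,5) G(1,2) _ _ _ that]) (use G in auto)
  obtain \<zeta> where \<zeta>: "(G \<longlongrightarrow> \<zeta>) (at_right 0)" "\<kappa> \<le> Re \<zeta>" "\<phi> \<zeta> = \<zeta>"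
    by (rule far_ray_converges[OF \<sigma>(1,2,3) surj G(1,2)]) (use G in auto)
  have rep: "repelling_fixed_point f (exp \<zeta>)" by (rule branch_fixed_point_repelling[OF G(1) \<zeta>(2,3)])
  have "((\<lambda>t. exp (G t)) \<longlongrightarrow> exp \<zeta>) (at_right 0)" by (rule tendsto_exp[OF \<zeta>(1)])
  moreover have "\<forall>\<^sub>F t in at_right 0. exp (G t) = g t"
    unfolding eventually_at_right_field using G(3) by (intro exI[of _ 1]) simp
  ultimately have lim: "(g \<longlongrightarrow> exp \<zeta>) (at_right 0)" by (rule Lim_transform_eventually)
  have "exp \<zeta> \<notin> escaping_set f" using escaping_not_fixed[of "exp \<zeta>"] rep by (auto simp: repelling_fixed_point_def)
  then have nb: "\<not> broken f X" unfolding g(2)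
    by (rule landing_not_broken[OF g(1,3) closure_landing_curve[OF escaping_curveD(1,7)[OF eg(1)] lim]])
  have land: "lands_at f X (exp \<zeta>)" unfolding lands_at_def using nb g(1,2) lim by blast
  have tow: "tower \<phi> 1 (\<lambda>n t. G ((\<sigma> ^^ n) t))"
  proof (rule tower_of_region[OF eg(1) zero_less_one G(1)])
    show "continuous_on {1..} \<sigma>" "continuous_on {1..} G" by (auto intro: continuous_on_subset[OF \<sigma>(1)] continuous_on_subset[OF G(2)])
    show "1 \<le> \<sigma> t" if "1 \<le> t" for t using \<sigma>(3)[of t] that by simp
  qed (use \<sigma>(4) G(3-5) in auto)
  have \<zeta>H: "\<zeta> \<in> H" using \<zeta>(2) by (simp add: mem_H \<kappa>_def)
  show thesis by (rule that[OF land rep G(1) \<zeta>H \<zeta>(3) g(2) tow]) (use G(3) in simp)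
qed

lemma tower_translate:
  assumes "tower \<phi> a G"
  shows "tower (\<lambda>\<omega>. \<phi> (\<omega> - per j) + per j) a (\<lambda>n t. G n t + per j)"
proof -
  have "filterlim (\<lambda>t. Re (G n t + per j)) at_top at_top" for n using towerD(6)[OF assms, of n] by simp
  then show ?thesis
    using assms branch_shift[of \<phi> j j] unfolding tower_def by (auto intro!: continuous_intros)
qed

text \<open>Equal landing points have logarithms that differ by a period. After translating the
  second tower by it, both branches fix \<zeta>, hence coincide; so the towers meet, and fixed rays
  that meet are equal.\<close>

lemma far_rays_distinct_landing:
  assumes X: "fixed_ray f X" "X \<inter> cball 0 (exp \<kappa>) = {}" and Y: "fixed_ray f Y" "Y \<inter> cball 0 (exp \<kappa>) = {}"
  obtains z w where "lands_at f X z" "repelling_fixed_point f z" "lands_at f Y w" "repelling_fixed_point f w" "z = w \<longrightarrow> X = Y"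
proof -
  obtain \<zeta> \<phi> g G where 1: "lands_at f X (exp \<zeta>)" "repelling_fixed_point f (exp \<zeta>)" "branch \<phi>" "\<zeta> \<in> H" "\<phi> \<zeta> = \<zeta>"
    "X = g ` {0<..}" "tower \<phi> 1 G" "\<And>t. 1 \<le> t \<Longrightarrow> exp (G 0 t) = g t" using far_ray_lands[OF X] by blast
  obtain \<xi> \<psi> h K where 2: "lands_at f Y (exp \<xi>)" "repelling_fixed_point f (exp \<xi>)" "branch \<psi>" "\<xi> \<in> H" "\<psi> \<xi> = \<xi>"
    "Y = h ` {0<..}" "tower \<psi> 1 K" "\<And>t. 1 \<le> t \<Longrightarrow> exp (K 0 t) = h t" using far_ray_lands[OF Y] by blast
  have "X = Y" if eq: "exp \<zeta> = exp \<xi>"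
  proof -
    obtain j where j: "\<zeta> = \<xi> + per j" using exp_eq_perE[OF eq] by blast
    define \<psi>' where "\<psi>' \<omega> = \<psi> (\<omega> - per j) + per j" for \<omega>
    have br: "branch \<psi>'" unfolding \<psi>'_def by (rule branch_shift[OF 2(3)])
    have T: "tower \<psi>' 1 (\<lambda>n t. K n t + per j)" unfolding \<psi>'_def by (rule tower_translate[OF 2(7)])
    have "\<psi>' \<zeta> = \<phi> \<zeta>" using 1(5) 2(5) j by (simp add: \<psi>'_def)
    then have "\<psi>' \<omega> = \<phi> \<omega>" if "\<omega> \<in> H" for \<omega> using branch_unique[OF br 1(3,4) _ that] by blast
    then have T': "tower \<phi> 1 (\<lambda>n t. K n t + per j)" by (rule tower_cong[OF T 1(3)])
    obtain t s where ts: "1 \<le> t" "1 \<le> s" "G 0 t = K 0 s + per j" using tower_meet[OF 1(7) T'] by blast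
    then have "g t = h s" using 1(8)[OF ts(1)] 2(8)[OF ts(2)] by simp
    moreover have "g t \<in> X" "h s \<in> Y" using ts(1,2) unfolding 1(6) 2(6) by (intro imageI; simp)+
    ultimately have "X \<inter> Y \<noteq> {}" by auto
    then show ?thesis by (rule fixed_ray_meet_eq[OF X(1) Y(1)])
  qed
  then show thesis using that[OF 1(1,2) 2(1,2)] by blast
qed

text \<open>The rays are cut at their last visit to a circle; by compactness of branches and the slope
  condition, only finitely many inverse branches occur, and each determines the ray.\<close>

lemma finite_fixed_rays_meeting_ball: "finite {X. fixed_ray f X \<and> X \<inter> cball 0 r0 \<noteq> {}}"
proof (rule ccontr)
  assume inf: "infinite {X. fixed_ray f X \<and> X \<inter> cball 0 r0 \<noteq> {}}"
  define r where "r = max r0 (exp \<kappa> + 1)"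
  have "exp \<kappa> + 1 \<le> r" and rr0: "r0 \<le> r" by (simp_all add: r_def)
  then have r: "exp \<kappa> < r" "0 < r" "r0 \<le> r" using exp_gt_zero[of \<kappa>] by linarith+
  obtain X :: "nat \<Rightarrow> complex set" where X: "inj X" "range X \<subseteq> {X. fixed_ray f X \<and> X \<inter> cball 0 r0 \<noteq> {}}"
    using infinite_countable_subset[OF inf] by blast
  \<comment> \<open>Data of the k-th ray, cut at its last parameter a with |g a| = r; from a on,
    logarithms and the branch \<phi> exist. The bound \<pi> normalises the choice of the
    logarithm.\<close>
  define W where "W k \<phi> G g a \<sigma> \<longleftrightarrow> X k = g ` {0<..} \<and> 0 < a \<and> norm (g a) = r \<and> branch \<phi> \<and>
      (\<forall>t\<ge>a. exp (G t) = g t \<and> \<kappa> < Re (G t) \<and> \<phi> (G (\<sigma> t)) = G t \<and> a \<le> \<sigma> t \<and> f (g t) = g (\<sigma> t)) \<and> r \<le> norm (g (\<sigma> a)) \<and>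
      \<bar>Im (G a)\<bar> \<le> pi \<and> tower \<phi> a (\<lambda>n t. G ((\<sigma> ^^ n) t))"
    for k \<phi> and G g :: "real \<Rightarrow> complex" and a and \<sigma> :: "real \<Rightarrow> real"
  have "\<exists>\<phi> G g a \<sigma>. W k \<phi> G g a \<sigma>" for k
  proof -
    have Xk: "fixed_ray f (X k)" "X k \<inter> cball 0 r0 \<noteq> {}" using X(2) by auto
    obtain g where g: "ray_param f g" "X k = g ` {0<..}" "f ` (g ` {0<..}) \<subseteq> g ` {0<..}" using fixed_rayE[OF Xk(1)] by blast
    note eg = ray_paramD(1,2)[OF g(1)]
    obtain \<sigma> where \<sigma>: "continuous_on {0<..} \<sigma>" "\<And>t. 0 < t \<Longrightarrow> t < \<sigma> t" "\<And>t. 0 < t \<Longrightarrow> f (g t) = g (\<sigma> t)"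
      using fixed_ray_dynamics[OF eg g(3)] by metis
    obtain u where u: "0 < u" "norm (g u) \<le> r" using Xk(2) r(3) unfolding g(2) by fastforce
    obtain T where T: "\<And>t. T \<le> t \<Longrightarrow> r + 1 \<le> norm (g t)"
      using escaping_curveD(7)[OF eg(1)] unfolding filterlim_at_top eventually_at_top_linorder by blast
    define V where "V = {u..max u T} \<inter> (\<lambda>t. norm (g t)) -` {..r}"
    have contn: "continuous_on {u..max u T} (\<lambda>t. norm (g t))"
      by (intro continuous_intros continuous_on_subset[OF escaping_curveD(6)[OF eg(1) u(1)]]) auto
    have "closed V" unfolding V_def by (rule continuous_closed_preimage[OF contn]) auto
    moreover have "bounded V" by (rule bounded_subset[of "{u..max u T}"]) (auto simp: V_def)
    ultimately have "compact V" by (simp add: compact_eq_bounded_closed)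
    moreover have "u \<in> V" using u by (simp add: V_def)
    ultimately obtain a where a: "a \<in> V" "\<And>t. t \<in> V \<Longrightarrow> t \<le> a"
      using continuous_attains_sup[of V "\<lambda>t. t"] continuous_on_id by (metis empty_iff)
    have a0: "0 < a" "u \<le> a" "norm (g a) \<le> r" using a(1) u(1) by (auto simp: V_def)
    have after: "r < norm (g t)" if "a < t" for t
    proof (rule ccontr)
      assume "\<not> r < norm (g t)"
      then have le: "norm (g t) \<le> r" by simp
      then have "t < T" using T[of t] by fastforce
      then have "t \<in> V" using le that a0(2) by (simp add: V_def)
      then show False using a(2) that by fastforce
    qed
    have "r \<le> norm (g a)"
    proof (rule ccontr)
      assume "\<not> r \<le> norm (g a)"
      then have lt: "norm (g a) < r" by simp
      have "T \<le> max a T + 1" by simp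
      then have "norm (g a) \<le> r" "r \<le> norm (g (max a T + 1))" using lt T[of "max a T + 1"] by linarith+
      then have "\<exists>x\<ge>a. x \<le> max a T + 1 \<and> norm (g x) = r"
        by (intro IVT' continuous_intros continuous_on_subset[OF escaping_curveD(6)[OF eg(1) a0(1)]]) auto
      then obtain x where "a \<le> x" "norm (g x) = r" by blast
      then show False using after[of x] lt by (cases "a = x") auto
    qed
    then have na: "norm (g a) = r" using a0(3) by simp
    have ge: "r \<le> norm (g t)" if "a \<le> t" for t using after[of t] na that by (cases "a = t") auto
    have big: "exp \<kappa> < norm (g t)" if "a \<le> t" for t using ge[OF that] r(1) by simp
    have \<sigma>a: "a \<le> \<sigma> t" if "a \<le> t" for t using \<sigma>(2)[of t] that a0(1) by simp
    have "g a \<noteq> 0" using na r(2) by auto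
    then have Ln: "exp (Ln (g a)) = g a" by (rule exp_Ln)
    have cont\<sigma>: "continuous_on {a..} \<sigma>" by (rule continuous_on_subset[OF \<sigma>(1)]) (use a0 in auto)
    obtain \<phi> G where G: "branch \<phi>" "continuous_on {a..} G" "\<And>t. t \<in> {a..} \<Longrightarrow> exp (G t) = g t" "G a = Ln (g a)"
      "\<And>t. t \<in> {a..} \<Longrightarrow> \<kappa> < Re (G t)" "\<And>t. t \<in> {a..} \<Longrightarrow> \<phi> (G (\<sigma> t)) = G t"
      by (rule branch_region[OF escaping_curveD(6)[OF eg(1) a0(1)] _ _ cont\<sigma> _ _ _ Ln]) (use big \<sigma>a \<sigma>(3) a0 in auto)
    have tow: "tower \<phi> a (\<lambda>n t. G ((\<sigma> ^^ n) t))"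
      by (rule tower_of_region[OF eg(1) a0(1) G(1) cont\<sigma> \<sigma>a _ G(2)]) (use \<sigma>(3) a0 G in auto)
    have "\<bar>Im (G a)\<bar> \<le> pi" using mpi_less_Im_Ln[of "g a"] Im_Ln_le_pi[of "g a"] \<open>g a \<noteq> 0\<close> G(4) by simp
    then show ?thesis unfolding W_def
      by (intro exI[of _ \<phi>] exI[of _ G] exI[of _ g] exI[of _ a] exI[of _ \<sigma>])
         (use g(2) a0 na G \<sigma>a \<sigma>(3) ge[OF \<sigma>a] tow in auto)
  qed
  then obtain \<phi> G g a \<sigma> where W: "\<And>k. W k (\<phi> k) (G k) (g k) (a k) (\<sigma> k)" by metis
  have P: "\<And>k. X k = g k ` {0<..}" "\<And>k. 0 < a k" "\<And>k. norm (g k (a k)) = r" "\<And>k. branch (\<phi> k)"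
      "\<And>k. \<forall>t\<ge>a k. exp (G k t) = g k t \<and> \<kappa> < Re (G k t) \<and> \<phi> k (G k (\<sigma> k t)) = G k t \<and> a k \<le> \<sigma> k t \<and> f (g k t) = g k (\<sigma> k t)"
      "\<And>k. r \<le> norm (g k (\<sigma> k (a k)))" "\<And>k. \<bar>Im (G k (a k))\<bar> \<le> pi" "\<And>k. tower (\<phi> k) (a k) (\<lambda>n t. G k ((\<sigma> k ^^ n) t))"
    using W unfolding W_def by blast+
  note Q = P(5)[rule_format]
  define w where "w k = G k (\<sigma> k (a k))" for k
  have \<sigma>a: "a k \<le> \<sigma> k (a k)" for k using Q[of k "a k"] by simp
  have nw: "exp (w k) = f (g k (a k))" for k using Q[of k "a k"] Q[OF \<sigma>a[of k]] by (simp add: w_def)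
  have Rew: "ln r \<le> Re (w k)" for k
  proof -
    have "r \<le> exp (Re (w k))" using P(6)[of k] Q[OF \<sigma>a[of k]] by (simp add: w_def norm_exp_eq_Re[symmetric])
    then show ?thesis using r(2) by (metis exp_gt_zero ln_exp ln_le_cancel_iff)
  qed
  have \<rho>r: "\<rho> < ln r"
  proof -
    have "\<kappa> < ln r" using r(1,2) by (metis exp_less_cancel_iff exp_ln)
    then show ?thesis by (simp add: \<kappa>_def)
  qed
  have wa: "\<phi> k (w k) = G k (a k)" for k using Q[of k "a k"] by (simp add: w_def)
  have ReG: "Re (G k (a k)) = ln r" for k
  proof -
    have "exp (Re (G k (a k))) = r" using P(3)[of k] Q[of k "a k"] by (simp add: norm_exp_eq_Re[symmetric])
    then show ?thesis using ln_exp by metis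
  qed
  \<comment> \<open>\<phi> k maps w k to \<open>G k (a k)\<close>, a normalised logarithm of a point
    of modulus r: this is the bound that \<open>branch_compactness\<close> requires.\<close>
  have bd: "norm (\<phi> k (w k)) \<le> \<bar>ln r\<bar> + pi" for k
    using cmod_le[of "G k (a k)"] ReG[of k] P(7)[of k] by (simp add: wa)
  obtain q \<psi> m w0 where q: "strict_mono q" "branch \<psi>" "w0 \<in> H"
    "\<And>k \<omega>. \<omega> \<in> H \<Longrightarrow> \<phi> (q k) \<omega> = \<psi> (\<omega> - per (m k))" "(\<lambda>k. w (q k) - per (m k)) \<longlonglongrightarrow> w0"
    by (rule branch_compactness[of \<phi> "ln r" w, OF P(4) Rew \<rho>r bd]) blast
  obtain C where C: "0 \<le> C" "\<And>\<omega>. \<omega> \<in> H \<Longrightarrow> \<bar>Im (\<psi> \<omega>)\<bar> \<le> C * (1 + Re (\<psi> \<omega>))" using slope[OF q(2)] by blast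
  obtain M where M: "0 \<le> M" "\<And>z. norm z \<le> r \<Longrightarrow> norm (f z) \<le> M" using entire_bounded_on_cball[OF f_holo] by metis
  \<comment> \<open>w is a value of \<psi>, so the slope condition bounds its imaginary part in
    terms of its real part, which M controls. Since w - per m converges, the integers m are bounded,
    and two of the rays share their branch.\<close>
  have Imw: "\<bar>Im (w (q k))\<bar> \<le> C * (1 + ln (M + 1))" for k
  proof -
    define \<nu> where "\<nu> = G (q k) (\<sigma> (q k) (\<sigma> (q k) (a (q k))))"
    have s2: "a (q k) \<le> \<sigma> (q k) (\<sigma> (q k) (a (q k)))" using Q[OF \<sigma>a[of "q k"]] by simp
    have "\<nu> \<in> H" using Q[OF s2] \<kappa>_H by (simp add: \<nu>_def)
    moreover have "\<phi> (q k) \<nu> = w (q k)" using Q[OF \<sigma>a[of "q k"]] by (simp add: \<nu>_def w_def)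
    ultimately have wv: "w (q k) = \<psi> (\<nu> - per (m k))" "\<nu> - per (m k) \<in> H" using q(4) by auto
    have "exp (Re (w (q k))) \<le> M"
      using M(2)[of "g (q k) (a (q k))"] P(3)[of "q k"] nw[of "q k", symmetric] by simp
    then have "Re (w (q k)) \<le> ln (M + 1)" using M(1) by (subst ln_ge_iff) auto
    then have "C * (1 + Re (w (q k))) \<le> C * (1 + ln (M + 1))" using C(1) by (intro mult_left_mono) auto
    then show ?thesis using C(2)[OF wv(2)] wv(1) by simp
  qed
  have "Bseq (\<lambda>k. w (q k) - per (m k))" by (rule convergent_imp_Bseq[OF convergentI[OF q(5)]])
  then obtain B where B: "\<And>k. norm (w (q k) - per (m k)) \<le> B" unfolding Bseq_def by blast
  have mb: "\<bar>m k\<bar> \<le> \<lceil>B + C * (1 + ln (M + 1))\<rceil>" for k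
  proof -
    have "\<bar>Im (w (q k) - per (m k))\<bar> \<le> B" using abs_Im_le_cmod[of "w (q k) - per (m k)"] B[of k] by linarith
    then have "\<bar>2 * pi * of_int (m k)\<bar> \<le> B + C * (1 + ln (M + 1))" using Imw[of k] by simp
    moreover have "\<bar>real_of_int (m k)\<bar> * 1 \<le> \<bar>real_of_int (m k)\<bar> * (2 * pi)" using pi_gt3 by (intro mult_left_mono) auto
    ultimately have "\<bar>real_of_int (m k)\<bar> \<le> B + C * (1 + ln (M + 1))" by (simp add: abs_mult mult_ac)
    then show ?thesis by (metis ceiling_mono ceiling_of_int of_int_abs)
  qed
  have "finite (range m)"
  proof (rule finite_subset)
    have "m k \<in> {- \<lceil>B + C * (1 + ln (M + 1))\<rceil>..\<lceil>B + C * (1 + ln (M + 1))\<rceil>}" for k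
      using mb[of k] by (simp add: abs_le_iff)
    then show "range m \<subseteq> {- \<lceil>B + C * (1 + ln (M + 1))\<rceil>..\<lceil>B + C * (1 + ln (M + 1))\<rceil>}" by blast
  qed simp
  then have "\<not> inj m" using finite_imageD[of m UNIV] by auto
  then obtain k l where kl: "m k = m l" "k \<noteq> l" by (auto simp: inj_def)
  have "tower (\<phi> (q k)) (a (q l)) (\<lambda>n t. G (q l) ((\<sigma> (q l) ^^ n) t))"
    by (rule tower_cong[OF P(8)[of "q l"] P(4)[of "q k"]]) (use q(4) kl(1) in simp)
  then obtain t s where ts: "a (q k) \<le> t" "a (q l) \<le> s" "G (q k) ((\<sigma> (q k) ^^ 0) t) = G (q l) ((\<sigma> (q l) ^^ 0) s)"
    using tower_meet[OF P(8)[of "q k"]] by blast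
  then have "g (q k) t = g (q l) s" using Q[OF ts(1)] Q[OF ts(2)] by simp
  moreover have "0 < t" "0 < s" using ts(1,2) P(2)[of "q k"] P(2)[of "q l"] by linarith+
  then have "g (q k) t \<in> X (q k)" "g (q l) s \<in> X (q l)" unfolding P(1) by (intro imageI; simp)+
  ultimately have "X (q k) \<inter> X (q l) \<noteq> {}" by auto
  then have "X (q k) = X (q l)" using fixed_ray_meet_eq[of "X (q k)" "X (q l)"] X(2) by blast
  then have "q k = q l" using X(1) by (simp add: inj_def)
  then show False using kl(2) strict_mono_eq[OF q(1)] by simp
qed

end

section \<open>Complements of stars of rays\<close>

text \<open>Stars are made compact by the inversion \<open>w \<mapsto> 1/(w - c)\<close>, which turns their rays into arcs
  from a common point to \<open>0\<close>.\<close>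

definition landing_curve :: "complex \<Rightarrow> complex set \<Rightarrow> bool" where
  "landing_curve z X \<longleftrightarrow> z \<notin> X \<and> (\<exists>g. X = g ` {0<..} \<and> continuous_on {0::real<..} g \<and> inj_on g {0<..} \<and>
     filterlim (\<lambda>t. norm (g t)) at_top at_top \<and> (g \<longlongrightarrow> z) (at_right 0))"

definition inversion :: "complex \<Rightarrow> complex \<Rightarrow> complex" where
  "inversion c w = inverse (w - c)"

lemma inversion_nonzero: "w \<noteq> c \<Longrightarrow> inversion c w \<noteq> 0"
  by (simp add: inversion_def)

lemma inversion_eq_iff: "inversion c v = inversion c w \<longleftrightarrow> v = w"
  by (simp add: inversion_def)

lemma inversion_inverse: "v \<noteq> 0 \<Longrightarrow> inversion c (c + inverse v) = v"
  by (simp add: inversion_def)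

lemma inversion_arc:
  assumes X: "landing_curve z X" and c: "c \<notin> insert z X"
  obtains \<alpha> where "arc \<alpha>" "pathstart \<alpha> = inversion c z" "pathfinish \<alpha> = 0"
    "path_image \<alpha> = insert 0 (inversion c ` insert z X)"
proof -
  obtain g :: "real \<Rightarrow> complex" where g: "X = g ` {0<..}" "continuous_on {0<..} g" "inj_on g {0<..}"
    "filterlim (\<lambda>t. norm (g t)) at_top at_top" "(g \<longlongrightarrow> z) (at_right 0)" and z: "z \<notin> X"
    using X unfolding landing_curve_def by blast
  define k where "k t = (if t \<le> 0 then z else g t)" for t :: real
  have contk: "continuous_on {0..} k"
    unfolding continuous_on_eq_continuous_within
  proof
    fix t :: real assume "t \<in> {0..}"
    show "continuous (at t within {0..}) k"
    proof (cases "t = 0")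
      case True
      have "(k \<longlongrightarrow> z) (at_right 0)"
        by (rule Lim_transform_eventually[OF g(5)]) (auto simp: eventually_at_right_field k_def intro!: exI[of _ 1])
      then show ?thesis using True by (simp add: continuous_within at_within_Ici_at_right k_def)
    next
      case False
      then have t: "0 < t" using \<open>t \<in> {0..}\<close> by simp
      have "isCont g t" using g(2) t continuous_on_eq_continuous_at[OF open_greaterThan] by blast
      moreover have "\<forall>\<^sub>F u in nhds t. k u = g u"
        unfolding eventually_nhds using t by (intro exI[of _ "{0<..}"]) (auto simp: k_def)
      ultimately have "isCont k t" using isCont_cong[of k g t] by blast
      then show ?thesis by (rule continuous_at_imp_continuous_at_within)
    qed
  qed
  have injk: "inj_on k {0..}"
  proof (rule inj_onI)
    fix s t :: real assume st: "s \<in> {0..}" "t \<in> {0..}" "k s = k t"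
    show "s = t"
    proof (cases "0 < s \<and> 0 < t")
      case True
      then show ?thesis using st(3) inj_onD[OF g(3), of s t] by (simp add: k_def)
    next
      case False
      then show ?thesis using st z g(1) by (force simp: k_def split: if_splits)
    qed
  qed
  have imk: "k ` {0..} = insert z X"
  proof -
    have "{0::real..} = insert 0 {0<..}" by auto
    then have "k ` {0..} = insert (k 0) (k ` {0<..})" by simp
    also have "k ` {0<..} = X" unfolding g(1) by (rule image_cong) (auto simp: k_def)
    finally show ?thesis by (simp add: k_def)
  qed
  \<comment> \<open>t / (1 - t) carries [0, 1) to [0, \<infinity>), and the value 0 at t = 1 is the
    image of infinity.\<close>
  define \<alpha> where "\<alpha> t = (if t = 1 then 0 else inversion c (k (t / (1 - t))))" for t :: real
  have kc: "k u \<noteq> c" if "0 \<le> u" for u using imk c that by auto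
  have cont1: "continuous_on {0..<1} (\<lambda>t. inversion c (k (t / (1 - t))))"
    unfolding inversion_def
    by (intro continuous_intros continuous_on_compose2[OF contk]) (use kc in auto)
  have "continuous_on {0..1} \<alpha>"
    unfolding continuous_on_eq_continuous_within
  proof
    fix t :: real assume t: "t \<in> {0..1}"
    show "continuous (at t within {0..1}) \<alpha>"
    proof (cases "t = 1")
      case True
      have "(\<alpha> \<longlongrightarrow> 0) (at 1 within {0..1})"
      proof (rule tendstoI)
        fix e :: real assume e: "0 < e"
        obtain T where T: "\<And>u. T \<le> u \<Longrightarrow> norm c + 1 / e + 1 \<le> norm (g u)"
          using g(4) unfolding filterlim_at_top eventually_at_top_linorder by blast
        \<comment> \<open>1 - s < d gives s / (1 - s) = 1 / (1 - s) - 1 > max T 0 + 1, beyond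
          T.\<close>
        define d where "d = 1 / (max T 0 + 2)"
        have d: "0 < d" "d < 1" by (auto simp: d_def)
        have "dist (\<alpha> s) 0 < e" if s: "s \<in> {0..1}" "s \<noteq> 1" "dist s 1 < d" for s
        proof -
          have s1: "0 < 1 - s" "1 - s < d" using s by (auto simp: dist_norm)
          have "1 < d / (1 - s)" using s1 by simp
          have inv: "1 / d < 1 / (1 - s)" using s1 by (intro divide_strict_left_mono) auto
          have "s / (1 - s) = 1 / (1 - s) - 1" using s1 by (simp add: field_simps)
          then have u: "max T 0 + 1 < s / (1 - s)" using inv by (simp add: d_def)
          then have "norm c + 1 / e + 1 \<le> norm (g (s / (1 - s)))" by (intro T) linarith
          moreover have "0 < s / (1 - s)" using u by linarith
          then have "k (s / (1 - s)) = g (s / (1 - s))" by (simp only: k_def not_le[symmetric] if_False)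
          ultimately have "1 / e < norm (k (s / (1 - s)) - c)"
            using norm_triangle_ineq2[of "k (s / (1 - s))" c] by simp
          then have "inverse (norm (k (s / (1 - s)) - c)) < inverse (1 / e)"
            using e by (intro less_imp_inverse_less) auto
          then show ?thesis using s(2) by (simp add: \<alpha>_def inversion_def norm_inverse)
        qed
        then show "\<forall>\<^sub>F s in at 1 within {0..1}. dist (\<alpha> s) 0 < e"
          unfolding eventually_at using d(1) by blast
      qed
      then show ?thesis using True by (simp add: continuous_within \<alpha>_def)
    next
      case False
      then have t': "t \<in> {0..<1}" using t by auto
      have "continuous (at t within {0..<1}) (\<lambda>t. inversion c (k (t / (1 - t))))"
        using cont1 t' continuous_on_eq_continuous_within by blast
      moreover have "at t within {0..1} = at t within {0..<1}"
        by (rule at_within_nhd[of t "{..<1}"]) (use t' in auto)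
      moreover have "\<forall>\<^sub>F s in at t within {0..<1}. inversion c (k (s / (1 - s))) = \<alpha> s"
        unfolding eventually_at_filter by (auto simp: \<alpha>_def intro!: always_eventually)
      ultimately show ?thesis
        using t' Lim_transform_eventually[of "\<lambda>t. inversion c (k (t / (1 - t)))"]
        by (auto simp: continuous_within \<alpha>_def)
    qed
  qed
  moreover have "inj_on \<alpha> {0..1}"
  proof (rule inj_onI)
    fix s t assume st: "s \<in> {0..1}" "t \<in> {0..1}" "\<alpha> s = \<alpha> t"
    have pos: "0 \<le> u / (1 - u)" if "u \<in> {0..1}" for u :: real using that by auto
    have nz: "\<alpha> u \<noteq> 0" if "u \<in> {0..1}" "u \<noteq> 1" for u
      using inversion_nonzero[OF kc[OF pos[OF that(1)]]] that by (simp add: \<alpha>_def)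
    show "s = t"
    proof (cases "s = 1 \<or> t = 1")
      case True
      then show ?thesis using nz[OF st(1)] nz[OF st(2)] st(3) by (auto simp: \<alpha>_def split: if_splits)
    next
      case False
      then have "k (s / (1 - s)) = k (t / (1 - t))" using st(3) by (simp add: \<alpha>_def inversion_eq_iff)
      then have "s / (1 - s) = t / (1 - t)" using inj_onD[OF injk] pos[OF st(1)] pos[OF st(2)] by auto
      then show ?thesis using False by (simp add: field_simps)
    qed
  qed
  ultimately have "arc \<alpha>" by (simp add: arc_def path_def)
  moreover have "path_image \<alpha> = insert 0 (inversion c ` insert z X)"
  proof -
    have int: "{0..1::real} = insert 1 {0..<1}" by auto
    have "path_image \<alpha> = insert (\<alpha> 1) (\<alpha> ` {0..<1})" unfolding path_image_def int by (rule image_insert)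
    also have "\<alpha> 1 = 0" by (simp add: \<alpha>_def)
    also have "\<alpha> ` {0..<1} = inversion c ` k ` {0..}"
    proof (intro equalityI subsetI)
      fix v assume "v \<in> \<alpha> ` {0..<1}"
      then obtain t where "0 \<le> t" "t < 1" "v = inversion c (k (t / (1 - t)))" by (auto simp: \<alpha>_def)
      then show "v \<in> inversion c ` k ` {0..}" by auto
    next
      fix v assume "v \<in> inversion c ` k ` {0..}"
      then obtain u where u: "0 \<le> u" "v = inversion c (k u)" by auto
      have "(u / (1 + u)) / (1 - u / (1 + u)) = u" using u(1) by (simp add: field_simps)
      then have "v = \<alpha> (u / (1 + u))" using u by (simp add: \<alpha>_def)
      then show "v \<in> \<alpha> ` {0..<1}" using u(1) by auto
    qed
    finally show ?thesis by (simp add: imk)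
  qed
  ultimately show thesis by (intro that) (auto simp: pathstart_def pathfinish_def \<alpha>_def k_def)
qed

text \<open>The centre c goes to infinity and 0 comes from infinity. The loss of c is harmless
  because deleting a point from a connected open set in the plane keeps it connected; 0 belongs to
  the removed set on the image side.\<close>

lemma connected_component_inversion:
  assumes S: "closed S" and c: "c \<notin> S" and ab: "a \<noteq> c" "b \<noteq> c"
  shows "connected_component (- S) a b \<longleftrightarrow>
    connected_component (- insert 0 (inversion c ` S)) (inversion c a) (inversion c b)"
proof
  assume ab': "connected_component (- S) a b"
  define U where "U = connected_component_set (- S) a"
  have U: "open U" "connected U" "a \<in> U" "b \<in> U" "U \<subseteq> - S"
    using open_connected_component[OF open_Compl[OF S]] ab' connected_component_in[OF ab']
      connected_component_subset[of "- S" a] unfolding U_def by auto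
  have "connected (U - {c})" by (rule connected_open_delete[OF U(1,2)]) simp
  then have "connected (inversion c ` (U - {c}))"
    by (rule connected_continuous_image[rotated]) (auto simp: inversion_def intro!: continuous_intros)
  moreover have "inversion c ` (U - {c}) \<subseteq> - insert 0 (inversion c ` S)"
    using U(5) inversion_nonzero by (auto simp: inversion_eq_iff)
  ultimately show "connected_component (- insert 0 (inversion c ` S)) (inversion c a) (inversion c b)"
    unfolding connected_component_def using U(3,4) ab by blast
next
  assume "connected_component (- insert 0 (inversion c ` S)) (inversion c a) (inversion c b)"
  then obtain T where T: "connected T" "T \<subseteq> - insert 0 (inversion c ` S)" "inversion c a \<in> T" "inversion c b \<in> T"
    unfolding connected_component_def by blast
  have "connected ((\<lambda>v. c + inverse v) ` T)"
    by (intro connected_continuous_image T(1) continuous_intros) (use T(2) in auto)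
  moreover have "(\<lambda>v. c + inverse v) ` T \<subseteq> - S"
  proof
    fix w assume "w \<in> (\<lambda>v. c + inverse v) ` T"
    then obtain v where v: "v \<in> T" "w = c + inverse v" by blast
    then have "inversion c w = v" using T(2) inversion_inverse by auto
    then show "w \<in> - S" using v(1) T(2) by auto
  qed
  moreover have "a = c + inverse (inversion c a)" "b = c + inverse (inversion c b)" by (simp_all add: inversion_def)
  ultimately show "connected_component (- S) a b"
    unfolding connected_component_def using T(3,4) by (metis imageI)
qed

text \<open>Induction with Janiszewski's theorem: the new arc A x is added together with an arc A y
  already present. The union of the old arcs meets A x \<union> A y exactly in A y, which is
  connected, and the pair does not separate a from b by \<open>pairs\<close>.\<close>

lemma separation_by_arcs:
  fixes A :: "'i \<Rightarrow> complex set"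
  assumes J: "finite J" "J \<noteq> {}"
    and arcs: "\<And>X. X \<in> J \<Longrightarrow> \<exists>\<alpha>. arc \<alpha> \<and> path_image \<alpha> = A X"
    and I: "I \<noteq> {}" "\<And>X. X \<in> J \<Longrightarrow> I \<subseteq> A X" "\<And>X Y. X \<in> J \<Longrightarrow> Y \<in> J \<Longrightarrow> X \<noteq> Y \<Longrightarrow> A X \<inter> A Y = I"
    and ab: "a \<notin> (\<Union>X\<in>J. A X)" "b \<notin> (\<Union>X\<in>J. A X)"
    and pairs: "\<And>X Y. X \<in> J \<Longrightarrow> Y \<in> J \<Longrightarrow> X \<noteq> Y \<Longrightarrow> connected_component (- (A X \<union> A Y)) a b"
  shows "connected_component (- (\<Union>X\<in>J. A X)) a b"
  using J arcs I(2,3) ab pairs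
proof (induction rule: finite_ne_induct)
  case (singleton X)
  obtain \<alpha> where \<alpha>: "arc \<alpha>" "path_image \<alpha> = A X" using singleton.prems(1)[of X] by blast
  have "connected (- A X)" using connected_arc_complement[OF \<alpha>(1)] \<alpha>(2) by simp
  then show ?case using singleton.prems(4,5) by (auto simp: connected_iff_connected_component)
next
  case (insert x F)
  obtain y where y: "y \<in> F" using insert.hyps by blast
  have xy: "x \<noteq> y" using y insert.hyps by blast
  have cpt: "compact (A X)" if "X \<in> insert x F" for X
    using insert.prems(1)[OF that] compact_arc_image by metis
  have "compact (\<Union>X\<in>F. A X)" using insert.hyps(1) cpt by (intro compact_UN) auto
  moreover have "closed (A x \<union> A y)" using cpt y by (intro closed_Un compact_imp_closed) auto
  moreover have "connected ((\<Union>X\<in>F. A X) \<inter> (A x \<union> A y))"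
  proof -
    have "A X \<inter> A x = I" if "X \<in> F" for X
      using insert.prems(3)[of X x] that insert.hyps by blast
    moreover have "I \<subseteq> A y" using insert.prems(2) y by blast
    ultimately have "(\<Union>X\<in>F. A X) \<inter> (A x \<union> A y) = A y" using y by blast
    moreover have "connected (A y)" using insert.prems(1)[of y] y connected_arc_image by (metis insertI2)
    ultimately show ?thesis by simp
  qed
  moreover have "connected_component (- (\<Union>X\<in>F. A X)) a b"
    by (rule insert.IH) (use insert.prems in auto)
  moreover have "connected_component (- (A x \<union> A y)) a b" using insert.prems(6) xy y by blast
  ultimately have "connected_component (- ((\<Union>X\<in>F. A X) \<union> (A x \<union> A y))) a b" by (rule Janiszewski)
  moreover have "(\<Union>X\<in>F. A X) \<union> (A x \<union> A y) = (\<Union>X\<in>insert x F. A X)" using y by blast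
  ultimately show ?case by simp
qed

lemma closed_landing_curve: "landing_curve z X \<Longrightarrow> closed (insert z X)"
  unfolding landing_curve_def using closure_landing_curve by (metis closed_closure)

lemma star_separation:
  assumes J: "finite J" "J \<noteq> {}" and lc: "\<And>X. X \<in> J \<Longrightarrow> landing_curve z X"
    and disj: "\<And>X Y. X \<in> J \<Longrightarrow> Y \<in> J \<Longrightarrow> X \<noteq> Y \<Longrightarrow> X \<inter> Y = {}"
    and ab: "a \<notin> insert z (\<Union>J)" "b \<notin> insert z (\<Union>J)"
    and sep: "\<not> connected_component (- insert z (\<Union>J)) a b"
  obtains X Y where "X \<in> J" "Y \<in> J" "X \<noteq> Y" "\<not> connected_component (- (X \<union> {z} \<union> Y)) a b"
proof (rule ccontr)
  assume H: "\<not> thesis"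
  then have pairs: "connected_component (- (X \<union> {z} \<union> Y)) a b" if "X \<in> J" "Y \<in> J" "X \<noteq> Y" for X Y
    using that H \<open>\<And>Y X. X \<in> J \<Longrightarrow> Y \<in> J \<Longrightarrow> X \<noteq> Y \<Longrightarrow> \<not> connected_component (- (X \<union> {z} \<union> Y)) a b \<Longrightarrow> thesis\<close> by blast
  have star: "insert z (\<Union>J) = (\<Union>X\<in>J. insert z X)" using J(2) by auto
  have clos: "closed (insert z (\<Union>J))" unfolding star using J(1) closed_landing_curve[OF lc] by (intro closed_UN) auto
  have "open (- insert z (\<Union>J))" using clos by (simp add: open_Compl)
  then obtain e where e: "0 < e" "ball a e \<subseteq> - insert z (\<Union>J)" using ab(1) open_contains_ball by blast
  have "infinite (ball a e)" using finite_imp_not_open[of "ball a e"] e(1) by auto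
  then have "infinite (ball a e - {a, b})" by simp
  then have "ball a e - {a, b} \<noteq> {}" using finite.emptyI by metis
  \<comment> \<open>The centre of inversion has to lie off the star and differ from a and b; a disc
    about a off the star has infinitely many points to choose from.\<close>
  then obtain c where c: "c \<in> ball a e" "c \<noteq> a" "c \<noteq> b" by blast
  then have cS: "c \<notin> insert z (\<Union>J)" using e(2) by blast
  define A where "A X = insert 0 (inversion c ` insert z X)" for X
  have UA: "(\<Union>X\<in>J. A X) = insert 0 (inversion c ` insert z (\<Union>J))" using J(2) by (auto simp: A_def)
  have AA: "A X \<union> A Y = insert 0 (inversion c ` (X \<union> {z} \<union> Y))" for X Y by (auto simp: A_def)
  have arcs: "\<exists>\<alpha>. arc \<alpha> \<and> path_image \<alpha> = A X" if "X \<in> J" for X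
    using inversion_arc[OF lc[OF that], of c] cS that unfolding A_def by (metis UnionI insert_iff)
  have notin: "inversion c w \<notin> (\<Union>X\<in>J. A X)" if "w \<notin> insert z (\<Union>J)" "w \<noteq> c" for w
    unfolding UA using that inversion_nonzero by (auto simp: inversion_eq_iff)
  have "connected_component (- (\<Union>X\<in>J. A X)) (inversion c a) (inversion c b)"
  proof (rule separation_by_arcs[where A = A and I = "{0, inversion c z}", OF J arcs])
    show "A X \<inter> A Y = {0, inversion c z}" if XY: "X \<in> J" "Y \<in> J" "X \<noteq> Y" for X Y
    proof -
      have "insert z X \<inter> insert z Y = {z}" using disj[OF XY] by auto
      moreover have "inj_on (inversion c) (insert z X \<union> insert z Y)" by (auto intro!: inj_onI simp: inversion_eq_iff)
      ultimately have "inversion c ` insert z X \<inter> inversion c ` insert z Y = {inversion c z}"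
        by (metis image_empty image_insert inj_on_image_Int sup_ge1 sup_ge2)
      then show ?thesis unfolding A_def by blast
    qed
    show "connected_component (- (A X \<union> A Y)) (inversion c a) (inversion c b)" if XY: "X \<in> J" "Y \<in> J" "X \<noteq> Y" for X Y
    proof -
      have eq: "X \<union> {z} \<union> Y = insert z X \<union> insert z Y" by auto
      have "closed (X \<union> {z} \<union> Y)"
        unfolding eq by (intro closed_Un closed_landing_curve lc XY)
      moreover have "c \<notin> X \<union> {z} \<union> Y" using cS XY by auto
      ultimately show ?thesis
        using connected_component_inversion[of "X \<union> {z} \<union> Y" c a b] pairs[OF XY] c(2,3) AA by auto
    qed
  qed (use notin[OF ab(1)] notin[OF ab(2)] c in \<open>auto simp: A_def\<close>)
  then show False using connected_component_inversion[OF clos cS, of a b] c(2,3) sep UA by simp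
qed

lemma finite_components_cover:
  assumes "finite \<C>" "S = \<Union>\<C>" "\<And>C. C \<in> \<C> \<Longrightarrow> connected C"
  shows "finite (components S)"
proof (rule finite_subset)
  show "components S \<subseteq> (\<lambda>C. connected_component_set S (SOME p. p \<in> C)) ` \<C>"
  proof
    fix D assume "D \<in> components S"
    then obtain p where p: "p \<in> S" "D = connected_component_set S p" by (auto simp: components_def)
    then obtain C where C: "C \<in> \<C>" "p \<in> C" using assms(2) by blast
    define q where "q = (SOME p. p \<in> C)"
    have q: "q \<in> C" using C(2) unfolding q_def by (rule someI)
    have "connected_component S p q"
      unfolding connected_component_def using C q assms(2) assms(3)[OF C(1)] by blast
    then have "D = connected_component_set S q" using p(2) connected_component_eq by fastforce
    then show "D \<in> (\<lambda>C. connected_component_set S (SOME p. p \<in> C)) ` \<C>" using C(1) by (auto simp: q_def)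
  qed
qed (use assms(1) in simp)

text \<open>Inversion turns the pair together with infinity into a Jordan curve. Pulling back its
  inside and outside, and adding the centre c that the inversion omits, covers the complement by
  three connected sets.\<close>

lemma finite_components_ray_pair:
  assumes X: "landing_curve z X" and Y: "landing_curve z Y" and disj: "X \<inter> Y = {}"
  shows "finite (components (- (X \<union> {z} \<union> Y)))"
proof (cases "X \<union> {z} \<union> Y = UNIV")
  case True
  then show ?thesis by simp
next
  case False
  then obtain c where c: "c \<notin> X \<union> {z} \<union> Y" by blast
  obtain \<alpha> where \<alpha>: "arc \<alpha>" "pathstart \<alpha> = inversion c z" "pathfinish \<alpha> = 0"
    "path_image \<alpha> = insert 0 (inversion c ` insert z X)" using inversion_arc[OF X, of c] c by auto
  obtain \<beta> where \<beta>: "arc \<beta>" "pathstart \<beta> = inversion c z" "pathfinish \<beta> = 0"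
    "path_image \<beta> = insert 0 (inversion c ` insert z Y)" using inversion_arc[OF Y, of c] c by auto
  define \<gamma> where "\<gamma> = \<alpha> +++ reversepath \<beta>"
  have "insert z X \<inter> insert z Y = {z}" using disj by auto
  moreover have "inj_on (inversion c) (insert z X \<union> insert z Y)" by (auto intro!: inj_onI simp: inversion_eq_iff)
  ultimately have "inversion c ` insert z X \<inter> inversion c ` insert z Y = {inversion c z}"
    by (metis image_empty image_insert inj_on_image_Int sup_ge1 sup_ge2)
  then have int: "path_image \<alpha> \<inter> path_image (reversepath \<beta>) \<subseteq> {pathstart \<alpha>, pathstart (reversepath \<beta>)}"
    using \<alpha> \<beta> by auto
  have "simple_path \<gamma>" unfolding \<gamma>_def
    by (rule simple_path_join_loop[OF \<alpha>(1) arc_reversepath[OF \<beta>(1)] _ _ int]) (use \<alpha> \<beta> in auto)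
  moreover have "pathfinish \<gamma> = pathstart \<gamma>" using \<alpha> \<beta> by (simp add: \<gamma>_def)
  ultimately have J: "connected (inside (path_image \<gamma>))" "connected (outside (path_image \<gamma>))"
    "inside (path_image \<gamma>) \<union> outside (path_image \<gamma>) = - path_image \<gamma>"
    using Jordan_inside_outside by blast+
  have pim: "path_image \<gamma> = insert 0 (inversion c ` (X \<union> {z} \<union> Y))"
    using \<alpha> \<beta> by (auto simp: \<gamma>_def path_image_join)
  define \<iota> where "\<iota> v = c + inverse v" for v
  have cov: "- (X \<union> {z} \<union> Y) = \<Union>{{c}, \<iota> ` inside (path_image \<gamma>), \<iota> ` outside (path_image \<gamma>)}"
  proof -
    have "- (X \<union> {z} \<union> Y) = insert c (\<iota> ` (- path_image \<gamma>))"
    proof (intro equalityI subsetI)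
      fix w assume w: "w \<in> - (X \<union> {z} \<union> Y)"
      show "w \<in> insert c (\<iota> ` (- path_image \<gamma>))"
      proof (cases "w = c")
        case False
        then have "inversion c w \<in> - path_image \<gamma>"
          unfolding pim using w inversion_nonzero by (auto simp: inversion_eq_iff)
        moreover have "w = \<iota> (inversion c w)" by (simp add: \<iota>_def inversion_def)
        ultimately show ?thesis by blast
      qed simp
    next
      fix w assume "w \<in> insert c (\<iota> ` (- path_image \<gamma>))"
      then consider "w = c" | v where "v \<in> - path_image \<gamma>" "w = \<iota> v" by blast
      then show "w \<in> - (X \<union> {z} \<union> Y)"
      proof cases
        case (2 v)
        then have "v \<noteq> 0" unfolding pim by auto
        then have "inversion c w = v" using 2(2) inversion_inverse by (simp add: \<iota>_def)
        then show ?thesis using 2(1) unfolding pim by auto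
      qed (use c in simp)
    qed
    also have "\<dots> = insert c (\<iota> ` inside (path_image \<gamma>) \<union> \<iota> ` outside (path_image \<gamma>))"
      unfolding J(3)[symmetric] image_Un ..
    finally show ?thesis by (rule trans) simp
  qed
  have nz: "0 \<notin> inside (path_image \<gamma>)" "0 \<notin> outside (path_image \<gamma>)"
  proof -
    have "0 \<in> path_image \<gamma>" unfolding pim by blast
    then show "0 \<notin> inside (path_image \<gamma>)" "0 \<notin> outside (path_image \<gamma>)" using J(3) by blast+
  qed
  have "connected C" if "C \<in> {{c}, \<iota> ` inside (path_image \<gamma>), \<iota> ` outside (path_image \<gamma>)}" for C
    using that J(1,2) nz unfolding \<iota>_def
    by (auto intro!: connected_continuous_image continuous_intros)
  then show ?thesis by (intro finite_components_cover[OF _ cov]) auto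
qed

lemma closed_locally_finite_Union:
  fixes \<F> :: "complex set set"
  assumes cl: "\<And>S. S \<in> \<F> \<Longrightarrow> closed S" and fin: "\<And>r. finite {S \<in> \<F>. S \<inter> cball 0 r \<noteq> {}}"
  shows "closed (\<Union>\<F>)"
proof (rule closed_sequential_limits[THEN iffD2], intro allI impI, elim conjE)
  fix x l assume x: "\<forall>n. x n \<in> \<Union>\<F>" "x \<longlonglongrightarrow> l"
  define \<G> where "\<G> = {S \<in> \<F>. S \<inter> cball 0 (norm l + 1) \<noteq> {}}"
  have "closed (\<Union>\<G>)" using fin cl unfolding \<G>_def by (intro closed_Union) auto
  moreover have "\<forall>\<^sub>F n in sequentially. x n \<in> \<Union>\<G>"
    using order_tendstoD(2)[OF tendsto_norm[OF x(2)], of "norm l + 1", simplified]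
  proof eventually_elim
    case (elim n)
    obtain S where S: "S \<in> \<F>" "x n \<in> S" using x(1) by blast
    then have "x n \<in> S \<inter> cball 0 (norm l + 1)" using elim by simp
    then show ?case using S unfolding \<G>_def by blast
  qed
  ultimately have "l \<in> \<Union>\<G>" using Lim_in_closed_set[OF _ _ sequentially_bot x(2)] by blast
  then show "l \<in> \<Union>\<F>" by (auto simp: \<G>_def)
qed

section \<open>Fixed rays landing together, and basic regions\<close>

context ray_map begin

lemma lands_atE:
  assumes "lands_at f X z"
  obtains g where "ray_param f g" "X = g ` {0<..}" "(g \<longlongrightarrow> z) (at_right 0)" "closure X = insert z X"
proof -
  obtain g where g: "ray_param f g" "X = g ` {0<..}" "(g \<longlongrightarrow> z) (at_right 0)"
    using assms unfolding lands_at_def by blast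
  then show thesis
    using that closure_landing_curve[OF escaping_curveD(1,7)[OF ray_paramD(1)[OF g(1)]] g(3)] by simp
qed

lemma fixed_ray_escapes: "fixed_ray f X \<Longrightarrow> z \<in> X \<Longrightarrow> z \<in> escaping_set f"
  using fixed_rayE ray_paramD(1) escaping_curveD(3) by (metis greaterThan_iff imageE)

text \<open>\<open>lands_at\<close> quantifies over parametrisations, but the closure of X, which
  consists of X and the landing point, does not depend on them.\<close>

lemma landing_point_unique:
  assumes "lands_at f X z" "lands_at f X w" "z \<notin> X"
  shows "w = z"
proof -
  have "insert z X = insert w X" using lands_atE[OF assms(1)] lands_atE[OF assms(2)] by metis
  then have "z \<in> insert w X" by (metis insertI1)
  then show ?thesis using assms(3) by simp
qed

lemma repelling_not_on_fixed_ray: "repelling_fixed_point f z \<Longrightarrow> fixed_ray f X \<Longrightarrow> z \<notin> X"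
  using fixed_ray_escapes escaping_not_fixed unfolding repelling_fixed_point_def by blast

section \<open>Rays that do not land alone, and ray pairs\<close>

definition bad_rays :: "complex set set" where
  "bad_rays = {X. fixed_ray f X \<and> \<not> (\<exists>z. lands_alone_at f X z \<and> repelling_fixed_point f z)}"

text \<open>Far rays land at different repelling points, so a bad far ray shares its landing point
  with a ray in B0. A ray in B0 has at most one repelling landing point, whence Z is finite, and
  each point of Z receives at most one far ray.\<close>

lemma finite_bad_rays: "finite bad_rays"
proof -
  define B0 where "B0 = {X. fixed_ray f X \<and> X \<inter> cball 0 (exp \<kappa>) \<noteq> {}}"
  have B0: "finite B0" unfolding B0_def by (rule finite_fixed_rays_meeting_ball)
  define Z where "Z = (\<Union>Y\<in>B0. {z. repelling_fixed_point f z \<and> lands_at f Y z})"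
  have "finite {z. repelling_fixed_point f z \<and> lands_at f Y z}" if "Y \<in> B0" for Y
  proof (cases "{z. repelling_fixed_point f z \<and> lands_at f Y z} = {}")
    case False
    then obtain z where z: "repelling_fixed_point f z" "lands_at f Y z" by blast
    have "z \<notin> Y" by (rule repelling_not_on_fixed_ray[OF z(1)]) (use that in \<open>simp add: B0_def\<close>)
    then have "{z. repelling_fixed_point f z \<and> lands_at f Y z} \<subseteq> {z}" using landing_point_unique[OF z(2)] by blast
    then show ?thesis by (rule finite_subset) simp
  qed (metis finite.emptyI)
  then have Z: "finite Z" unfolding Z_def using B0 by blast
  define S where "S = {X. fixed_ray f X \<and> X \<notin> B0 \<and> (\<exists>z\<in>Z. lands_at f X z)}"
  have far: "X \<inter> cball 0 (exp \<kappa>) = {}" if "fixed_ray f X" "X \<notin> B0" for X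
    using that by (auto simp: B0_def)
  have same: "X = Y" if X: "fixed_ray f X" "X \<notin> B0" "lands_at f X z" and Y: "fixed_ray f Y" "Y \<notin> B0" "lands_at f Y z" for X Y z
  proof -
    obtain z1 w1 where zw: "lands_at f X z1" "repelling_fixed_point f z1" "lands_at f Y w1" "repelling_fixed_point f w1"
      "z1 = w1 \<longrightarrow> X = Y"
      using far_rays_distinct_landing[OF X(1) far[OF X(1,2)] Y(1) far[OF Y(1,2)]] by blast
    have "z = z1" by (rule landing_point_unique[OF zw(1) X(3) repelling_not_on_fixed_ray[OF zw(2) X(1)]])
    moreover have "z = w1" by (rule landing_point_unique[OF zw(3) Y(3) repelling_not_on_fixed_ray[OF zw(4) Y(1)]])
    ultimately show ?thesis using zw(5) by blast
  qed
  have "finite S"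
  proof (rule inj_on_finite[of "\<lambda>X. SOME z. z \<in> Z \<and> lands_at f X z" S Z])
    have some: "(SOME z. z \<in> Z \<and> lands_at f X z) \<in> Z \<and> lands_at f X (SOME z. z \<in> Z \<and> lands_at f X z)" if "X \<in> S" for X
      by (rule someI_ex[of "\<lambda>z. z \<in> Z \<and> lands_at f X z"]) (use that in \<open>auto simp: S_def\<close>)
    show "inj_on (\<lambda>X. SOME z. z \<in> Z \<and> lands_at f X z) S"
    proof (rule inj_onI)
      fix X Y assume XY: "X \<in> S" "Y \<in> S" "(SOME z. z \<in> Z \<and> lands_at f X z) = (SOME z. z \<in> Z \<and> lands_at f Y z)"
      show "X = Y"
        by (rule same[of X "SOME z. z \<in> Z \<and> lands_at f X z"])
           (use some[OF XY(1)] some[OF XY(2)] XY in \<open>auto simp: S_def\<close>)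
    qed
    show "(\<lambda>X. SOME z. z \<in> Z \<and> lands_at f X z) ` S \<subseteq> Z" using some by blast
  qed (rule Z)
  moreover have "bad_rays \<subseteq> B0 \<union> S"
  proof
    fix X assume X: "X \<in> bad_rays"
    show "X \<in> B0 \<union> S"
    proof (cases "X \<in> B0")
      case False
      have fX: "fixed_ray f X" using X by (simp add: bad_rays_def)
      obtain z where z: "lands_at f X z" "repelling_fixed_point f z"
        using far_rays_distinct_landing[OF fX far[OF fX False] fX far[OF fX False]] by blast
      then have "\<not> lands_alone_at f X z" using X by (auto simp: bad_rays_def)
      then obtain Y where Y: "fixed_ray f Y" "Y \<noteq> X" "lands_at f Y z" using z(1) by (auto simp: lands_alone_at_def)
      have "Y \<in> B0" using same[OF fX False z(1) Y(1) _ Y(3)] Y(2) by blast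
      then have "z \<in> Z" using z(2) Y(3) by (auto simp: Z_def)
      then show ?thesis using fX False z(1) by (auto simp: S_def)
    qed simp
  qed
  ultimately show ?thesis using B0 by (meson finite_UnI finite_subset)
qed

text \<open>Let s be the limit of \<sigma> t as t tends to 0. If s = 0, then z is a fixed point and
  does not escape. If s > 0, then f z = g s lies on both rays, so X = Y and z = g y with \<sigma> y
  = s; but \<sigma> t \<ge> s for small t < y, although \<sigma> is strictly increasing.\<close>

lemma landing_point_not_on_ray:
  assumes X: "fixed_ray f X" "lands_at f X z" and Y: "fixed_ray f Y"
  shows "z \<notin> Y"
proof
  assume zY: "z \<in> Y"
  obtain g where g: "ray_param f g" "X = g ` {0<..}" "(g \<longlongrightarrow> z) (at_right 0)" using lands_atE[OF X(2)] by blast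
  have inv: "f ` (g ` {0<..}) \<subseteq> g ` {0<..}" using X(1) g(2) by (simp add: fixed_ray_def)
  note eg = ray_paramD(1,2)[OF g(1)]
  obtain \<sigma> where \<sigma>: "continuous_on {0<..} \<sigma>" "\<And>s t. 0 < s \<Longrightarrow> s < t \<Longrightarrow> \<sigma> s < \<sigma> t" "\<And>t. 0 < t \<Longrightarrow> t < \<sigma> t"
    "\<And>t. 0 < t \<Longrightarrow> f (g t) = g (\<sigma> t)"
    using fixed_ray_dynamics[OF eg inv] by metis
  define t where "t n = 1 / real (Suc n)" for n
  have tpos: "0 < t n" for n by (simp add: t_def)
  have tlim: "t \<longlonglongrightarrow> 0" using LIMSEQ_inverse_real_of_nat unfolding t_def by (simp add: inverse_eq_divide)
  have tdec: "t (Suc n) < t n" for n unfolding t_def by (intro divide_strict_left_mono) auto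
  have \<sigma>pos: "0 < \<sigma> (t n)" for n using \<sigma>(3)[OF tpos[of n]] tpos[of n] by linarith
  have "decseq (\<lambda>n. \<sigma> (t n))" using \<sigma>(2)[OF tpos tdec] by (intro decseq_SucI) (simp add: less_imp_le)
  then obtain s where s: "(\<lambda>n. \<sigma> (t n)) \<longlonglongrightarrow> s" "\<And>n. s \<le> \<sigma> (t n)"
    using decseq_convergent[of "\<lambda>n. \<sigma> (t n)" 0] \<sigma>pos by (metis less_imp_le)
  have right: "(\<lambda>n. g (u n)) \<longlonglongrightarrow> z" if "u \<longlonglongrightarrow> 0" "\<And>n. 0 < u n" for u
  proof -
    have "filterlim u (at_right 0) sequentially"
      unfolding filterlim_at using that by (auto intro: always_eventually simp: less_imp_neq[symmetric])
    then show ?thesis using g(3) filterlim_compose by blast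
  qed
  have "(\<lambda>n. f (g (t n))) \<longlonglongrightarrow> f z" by (rule isCont_tendsto_compose[OF isCont_f right[OF tlim tpos]])
  then have fz: "(\<lambda>n. g (\<sigma> (t n))) \<longlonglongrightarrow> f z" by (simp add: \<sigma>(4)[OF tpos])
  have s0: "0 \<le> s" by (rule LIMSEQ_le_const[OF s(1)]) (use \<sigma>pos in \<open>auto intro: less_imp_le\<close>)
  show False
  proof (cases "s = 0")
    case True
    then have "(\<lambda>n. g (\<sigma> (t n))) \<longlonglongrightarrow> z" using right[of "\<lambda>n. \<sigma> (t n)"] s(1) \<sigma>pos by simp
    then have "f z = z" by (rule LIMSEQ_unique[OF fz])
    then show False using escaping_not_fixed[OF fixed_ray_escapes[OF Y zY]] by blast
  next
    case False
    then have sp: "0 < s" using s0 by simp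
    have "isCont g s" using escaping_curveD(1)[OF eg(1)] sp continuous_on_eq_continuous_at[OF open_greaterThan] by blast
    then have "(\<lambda>n. g (\<sigma> (t n))) \<longlonglongrightarrow> g s" using s(1) by (rule isCont_tendsto_compose)
    then have fzs: "f z = g s" by (rule LIMSEQ_unique[OF fz])
    have "f z \<in> Y" using Y zY by (auto simp: fixed_ray_def)
    moreover have "f z \<in> X" using fzs sp g(2) by simp
    ultimately have "X = Y" using fixed_ray_meet_eq[OF X(1) Y] by blast
    then obtain y where y: "0 < y" "z = g y" using zY g(2) by auto
    have "g (\<sigma> y) = g s" using \<sigma>(4)[OF y(1)] fzs y(2) by simp
    then have \<sigma>y: "\<sigma> y = s" using inj_onD[OF escaping_curveD(2)[OF eg(1)]] sp \<sigma>(3)[OF y(1)] y(1) by simp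
    have "\<forall>\<^sub>F n in sequentially. t n < y" using order_tendstoD(2)[OF tlim y(1)] .
    then obtain n where "t n < y" unfolding eventually_sequentially by blast
    then have "\<sigma> (t n) < s" using \<sigma>(2)[OF tpos] \<sigma>y by metis
    then show False using s(2)[of n] by simp
  qed
qed

lemma landing_curve_fixed_ray:
  assumes "fixed_ray f X" "lands_at f X z"
  shows "landing_curve z X"
proof -
  obtain g where g: "ray_param f g" "X = g ` {0<..}" "(g \<longlongrightarrow> z) (at_right 0)" using lands_atE[OF assms(2)] by blast
  note eg = ray_paramD(1)[OF g(1)]
  show ?thesis
    unfolding landing_curve_def
    using landing_point_not_on_ray[OF assms assms(1)] g(2,3) escaping_curveD(1,2,7)[OF eg] by blast
qed

lemma shared_landing_bad:
  assumes "fixed_ray f X" "fixed_ray f Y" "X \<noteq> Y" "lands_at f X z" "lands_at f Y z"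
  shows "X \<in> bad_rays"
proof (rule ccontr)
  assume "X \<notin> bad_rays"
  then obtain w where w: "lands_alone_at f X w" "repelling_fixed_point f w" using assms(1) by (auto simp: bad_rays_def)
  have "z = w"
    by (rule landing_point_unique[OF _ assms(4) repelling_not_on_fixed_ray[OF w(2) assms(1)]])
       (use w(1) in \<open>simp add: lands_alone_at_def\<close>)
  then show False using w(1) assms by (auto simp: lands_alone_at_def)
qed

text \<open>Two rays that share a landing point are both bad, and either of them determines that
  point.\<close>

lemma finite_fixed_ray_pairs: "finite (fixed_ray_pairs f)"
proof (rule finite_subset)
  define L where "L X = (SOME z. lands_at f X z)" for X
  show "fixed_ray_pairs f \<subseteq> (\<lambda>(X, Y). X \<union> {L X} \<union> Y) ` (bad_rays \<times> bad_rays)"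
  proof
    fix P assume "P \<in> fixed_ray_pairs f"
    then obtain X Y z where P: "P = X \<union> {z} \<union> Y" "fixed_ray f X" "fixed_ray f Y" "X \<noteq> Y" "lands_at f X z" "lands_at f Y z"
      unfolding fixed_ray_pairs_def by blast
    have "lands_at f X (L X)" unfolding L_def by (rule someI[of "lands_at f X", OF P(5)])
    then have "L X = z" using landing_point_unique[OF P(5) _ landing_point_not_on_ray[OF P(2,5,2)]] by blast
    moreover have "X \<in> bad_rays" "Y \<in> bad_rays" using shared_landing_bad P by blast+
    ultimately show "P \<in> (\<lambda>(X, Y). X \<union> {L X} \<union> Y) ` (bad_rays \<times> bad_rays)" using P(1) by force
  qed
  show "finite ((\<lambda>(X, Y). X \<union> {L X} \<union> Y) ` (bad_rays \<times> bad_rays))" using finite_bad_rays by blast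
qed

section \<open>Finiteness of the set of basic regions\<close>

lemma finite_basic_regions:
  assumes land: "\<And>X. fixed_ray f X \<Longrightarrow> \<exists>z. lands_at f X z"
  shows "finite (basic_regions f)"
proof -
  define \<R> where "\<R> = {X. fixed_ray f X}"
  have "\<forall>X. \<exists>z. X \<in> \<R> \<longrightarrow> lands_at f X z" using land by (auto simp: \<R>_def)
  then obtain L where L: "\<And>X. X \<in> \<R> \<Longrightarrow> lands_at f X (L X)" by metis
  have Luniq: "z = L X" if "X \<in> \<R>" "lands_at f X z" for X z
    by (rule landing_point_unique[OF L[OF that(1)] that(2)])
       (use landing_point_not_on_ray[OF _ L[OF that(1)]] that(1) in \<open>simp add: \<R>_def\<close>)
  have off: "L X \<notin> Y" if "X \<in> \<R>" "Y \<in> \<R>" for X Y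
    using landing_point_not_on_ray[OF _ L[OF that(1)]] that by (simp add: \<R>_def)
  have disj: "X \<inter> Y = {}" if "X \<in> \<R>" "Y \<in> \<R>" "X \<noteq> Y" for X Y
    using fixed_ray_meet_eq that by (auto simp: \<R>_def)
  have lc: "landing_curve (L X) X" if "X \<in> \<R>" for X
    using landing_curve_fixed_ray[OF _ L[OF that]] that by (simp add: \<R>_def)
  define C where "C X = insert (L X) X" for X
  have \<Gamma>: "fixed_ray_graph f = \<Union>(C ` \<R>)"
    unfolding fixed_ray_graph_def C_def \<R>_def[symmetric] using L Luniq by (auto simp: \<R>_def)
  have clC: "closed (C X)" if "X \<in> \<R>" for X unfolding C_def by (rule closed_landing_curve[OF lc[OF that]])
  \<comment> \<open>A ray may avoid the disc of radius r while its landing point lies in it; as the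
    landing point is a limit of the ray, the disc of radius r + 1 catches the ray itself.\<close>
  have fin: "finite {S \<in> C ` \<R>'. S \<inter> cball 0 r \<noteq> {}}" if sub: "\<R>' \<subseteq> \<R>" for \<R>' r
  proof (rule finite_subset)
    show "{S \<in> C ` \<R>'. S \<inter> cball 0 r \<noteq> {}} \<subseteq> C ` {X. fixed_ray f X \<and> X \<inter> cball 0 (r + 1) \<noteq> {}}"
    proof
      fix S assume "S \<in> {S \<in> C ` \<R>'. S \<inter> cball 0 r \<noteq> {}}"
      then obtain X where X': "X \<in> \<R>'" "S = C X" "S \<inter> cball 0 r \<noteq> {}" by blast
      then obtain p where p: "p \<in> S" "p \<in> cball 0 r" by blast
      have X: "X \<in> \<R>" "S = C X" "p \<in> C X" "norm p \<le> r" using sub X' p by auto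
      have "closure X = C X" using lands_atE[OF L[OF X(1)]] by (metis C_def)
      then obtain y where y: "y \<in> X" "dist y p < 1" using X(3) closure_approachable zero_less_one by blast
      have "norm y \<le> r + 1" using y(2) X(4) norm_triangle_sub[of y p] by (simp add: dist_norm)
      then have "X \<in> {X. fixed_ray f X \<and> X \<inter> cball 0 (r + 1) \<noteq> {}}" using X(1) y(1) by (auto simp: \<R>_def)
      then show "S \<in> C ` {X. fixed_ray f X \<and> X \<inter> cball 0 (r + 1) \<noteq> {}}" using X(2) by blast
    qed
    show "finite (C ` {X. fixed_ray f X \<and> X \<inter> cball 0 (r + 1) \<noteq> {}})" using finite_fixed_rays_meeting_ball by blast
  qed
  have closed: "closed (\<Union>(C ` \<R>'))" if "\<R>' \<subseteq> \<R>" for \<R>'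
    by (rule closed_locally_finite_Union[OF _ fin[OF that]]) (use clC that in auto)
  have pair: "\<exists>P\<in>fixed_ray_pairs f. \<not> connected_component (- P) a b"
    if ab: "a \<notin> fixed_ray_graph f" "b \<notin> fixed_ray_graph f" "\<not> connected_component (- fixed_ray_graph f) a b" for a b
  proof -
    obtain D where D: "D \<in> components (fixed_ray_graph f)" "\<not> connected_component (- D) a b"
      using separation_by_component_closed_pointwise[OF _ ab(3)] closed[OF order_refl] unfolding \<Gamma> by metis
    obtain p where p: "p \<in> D" "p \<in> fixed_ray_graph f"
      using D(1) in_components_nonempty in_components_subset by blast
    then obtain X where X: "X \<in> \<R>" "p \<in> C X" unfolding \<Gamma> by blast
    define z where "z = L X"
    \<comment> \<open>All rays that land at the same point as X. This star and the union of the
      other rays with their landing points are disjoint closed sets, so the connected set D lies in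
      the star.\<close>
    define J where "J = {Y \<in> \<R>. L Y = z}"
    have XJ: "X \<in> J" using X(1) by (simp add: J_def z_def)
    have JR: "J \<subseteq> \<R>" by (auto simp: J_def)
    have disjC: "\<Union>(C ` J) \<inter> \<Union>(C ` (\<R> - J)) = {}"
    proof (rule ccontr)
      assume "\<Union>(C ` J) \<inter> \<Union>(C ` (\<R> - J)) \<noteq> {}"
      then obtain q Y Y' where q: "Y \<in> J" "Y' \<in> \<R> - J" "q \<in> C Y" "q \<in> C Y'" by blast
      have YR: "Y \<in> \<R>" "Y' \<in> \<R>" "Y \<noteq> Y'" "L Y \<noteq> L Y'" using q(1,2) by (auto simp: J_def)
      show False using q(3,4) disj[OF YR(1-3)] off[OF YR(1,2)] off[OF YR(2,1)] YR(4) by (auto simp: C_def)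
    qed
    have "D \<subseteq> \<Union>(C ` J)"
    proof -
      have sub: "D \<subseteq> \<Union>(C ` J) \<union> \<Union>(C ` (\<R> - J))" using in_components_subset[OF D(1)] JR unfolding \<Gamma> by blast
      have "\<Union>(C ` J) \<inter> D \<noteq> {}" using p(1) X(2) XJ by blast
      then have "\<Union>(C ` (\<R> - J)) \<inter> D = {}"
        using connected_closedD[OF in_components_connected[OF D(1)], of "\<Union>(C ` J)" "\<Union>(C ` (\<R> - J))"]
          sub disjC closed[OF JR] closed[of "\<R> - J"] by blast
      then show ?thesis using sub by blast
    qed
    moreover have star: "\<Union>(C ` J) = insert z (\<Union>J)" using XJ by (auto simp: C_def J_def)
    ultimately have nab: "\<not> connected_component (- insert z (\<Union>J)) a b"
      using D(2) connected_component_of_subset[of "- insert z (\<Union>J)" a b "- D"] by auto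
    \<comment> \<open>A star with several rays consists of bad rays.\<close>
    have finJ: "finite J"
    proof (cases "J = {X}")
      case False
      have "J \<subseteq> bad_rays"
      proof
        fix Y assume Y: "Y \<in> J"
        obtain Y' where Y': "Y' \<in> J" "Y' \<noteq> Y" using False XJ Y by blast
        show "Y \<in> bad_rays"
          by (rule shared_landing_bad[of Y Y' z]) (use Y Y' L[of Y] L[of Y'] in \<open>auto simp: J_def \<R>_def\<close>)
      qed
      then show ?thesis using finite_bad_rays finite_subset by blast
    qed simp
    have notin: "a \<notin> insert z (\<Union>J)" "b \<notin> insert z (\<Union>J)" using ab(1,2) JR unfolding star[symmetric] \<Gamma> by blast+
    have lcJ: "landing_curve z Y" if "Y \<in> J" for Y using lc[of Y] that by (auto simp: J_def)
    have disjJ: "Y \<inter> Y' = {}" if "Y \<in> J" "Y' \<in> J" "Y \<noteq> Y'" for Y Y' using disj[of Y Y'] that JR by blast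
    have Jne: "J \<noteq> {}" using XJ by blast
    obtain Y Y' where YY: "Y \<in> J" "Y' \<in> J" "Y \<noteq> Y'" "\<not> connected_component (- (Y \<union> {z} \<union> Y')) a b"
      using star_separation[OF finJ Jne lcJ disjJ notin nab] by blast
    have "Y \<union> {z} \<union> Y' \<in> fixed_ray_pairs f"
      unfolding fixed_ray_pairs_def using YY(1-3) L[of Y] L[of Y'] by (auto simp: J_def \<R>_def)
    then show ?thesis using YY(4) by blast
  qed
  have finP: "finite (components (- P))" if hP: "P \<in> fixed_ray_pairs f" for P
  proof -
    obtain X Y z where P: "P = X \<union> {z} \<union> Y" "fixed_ray f X" "fixed_ray f Y" "X \<noteq> Y" "lands_at f X z" "lands_at f Y z"
      using hP unfolding fixed_ray_pairs_def by blast
    show ?thesis unfolding P(1)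
      by (rule finite_components_ray_pair[OF landing_curve_fixed_ray[OF P(2,5)] landing_curve_fixed_ray[OF P(3,6)]])
         (use fixed_ray_meet_eq[OF P(2,3)] P(4) in blast)
  qed
  have sub\<Gamma>: "P \<subseteq> fixed_ray_graph f" if "P \<in> fixed_ray_pairs f" for P
    using that unfolding fixed_ray_pairs_def fixed_ray_graph_def by blast
  define K where "K = Sigma (fixed_ray_pairs f) (\<lambda>P. components (- P))"
  \<comment> \<open>Codes a region by the complementary components of ray pairs that contain it.
    Different regions are separated by some pair, so the code is injective, with values in a finite
    power set.\<close>
  define \<Theta> where "\<Theta> D = {(P, E) \<in> K. D \<subseteq> E}" for D
  have "finite K" unfolding K_def using finite_fixed_ray_pairs finP by (rule finite_SigmaI)
  then have "finite (Pow K)" by simp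
  show ?thesis
    unfolding basic_regions_def
  proof (rule inj_on_finite[of \<Theta> _ "Pow K"])
    show "inj_on \<Theta> (components (- fixed_ray_graph f))"
    proof (rule inj_onI, rule ccontr)
      fix D D' assume D: "D \<in> components (- fixed_ray_graph f)" "D' \<in> components (- fixed_ray_graph f)"
        "\<Theta> D = \<Theta> D'" "D \<noteq> D'"
      obtain a b where ab: "a \<in> D" "b \<in> D'" using D(1,2) in_components_nonempty by blast
      have out: "a \<notin> fixed_ray_graph f" "b \<notin> fixed_ray_graph f" using ab D(1,2) in_components_subset by blast+
      have "\<not> connected_component (- fixed_ray_graph f) a b"
      proof
        assume cc: "connected_component (- fixed_ray_graph f) a b"
        then have "connected_component_set (- fixed_ray_graph f) a = connected_component_set (- fixed_ray_graph f) b"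
          using connected_component_eq by fastforce
        moreover have "D = connected_component_set (- fixed_ray_graph f) a"
          using D(1) ab(1) by (metis components_iff connected_component_eq)
        moreover have "D' = connected_component_set (- fixed_ray_graph f) b"
          using D(2) ab(2) by (metis components_iff connected_component_eq)
        ultimately show False using D(4) by simp
      qed
      then obtain P where P: "P \<in> fixed_ray_pairs f" "\<not> connected_component (- P) a b" using pair out by blast
      define E where "E = connected_component_set (- P) a"
      have aP: "a \<in> - P" using out(1) sub\<Gamma>[OF P(1)] by blast
      have "E \<in> components (- P)" using aP unfolding E_def by (rule componentsI)
      moreover have "D \<subseteq> E"
      proof -
        have "D \<subseteq> - P" using in_components_subset[OF D(1)] sub\<Gamma>[OF P(1)] by blast
        then show ?thesis unfolding E_def
          by (rule connected_component_maximal[OF ab(1) in_components_connected[OF D(1)]])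
      qed
      ultimately have "(P, E) \<in> \<Theta> D" using P(1) by (simp add: \<Theta>_def K_def)
      then have "(P, E) \<in> \<Theta> D'" unfolding D(3) .
      then have "D' \<subseteq> E" by (simp add: \<Theta>_def)
      then have "connected_component (- P) a b" using ab(2) by (auto simp: E_def)
      then show False using P(2) by blast
    qed
    show "\<Theta> ` components (- fixed_ray_graph f) \<subseteq> Pow K" by (auto simp: \<Theta>_def)
  qed fact
qed

end

theorem propositionA:
  fixes f :: "complex \<Rightarrow> complex"
  assumes "f \<in> class_B_hat"
  shows "finite {R. fixed_ray f R \<and> \<not> (\<exists>z. lands_alone_at f R z \<and> repelling_fixed_point f z)} \<and>
    ((\<forall>R. fixed_ray f R \<longrightarrow> (\<exists>z. lands_at f R z)) \<longrightarrow>
       finite (fixed_ray_pairs f) \<and> finite (basic_regions f))"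
proof -
  obtain R where "ray_map f R" using class_B_hat_ray_map[OF assms] by blast
  then interpret ray_map f R .
  show ?thesis
    using finite_bad_rays finite_fixed_ray_pairs finite_basic_regions unfolding bad_rays_def by blast
qed

end
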